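(* Let $d\ge2$, $s>0$ and $\beta>\frac{3-2d}{4}$. Then $$\big\||\square-(2s)^2|^\beta\big(e^{it\phi_s(D)}f\,e^{it\phi_s(D)}g\big)\big\|_{L^2(\mathbb{R}^{d+1})}^2\le\mathbf{KG}_{(++)}(\beta,d)\int_{\mathbb{R}^{2d}}|\widehat f(\eta_1)|^2|\widehat g(\eta_2)|^2\,\phi_s(|\eta_1|)\phi_s(|\eta_2|)\,\mathcal K_{\frac12}^{\frac{d-2}{2}+2\beta}(\eta_1,\eta_2)\,\mathrm d\eta_1\,\mathrm d\eta_2,$$ where $$\mathbf{KG}_{(++)}(\beta,d):=2^{\frac{-5d+1}{2}+2\beta}\,\pi^{\frac{-5d+1}{2}}\,\frac{\Gamma(\frac{d-1}{2})}{\Gamma(d-1)}.$$ Moreover, the constant $\mathbf{KG}_{(++)}(\beta,d)$ is sharp (it cannot be replaced by a smaller one).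
   Context: For $s>0$ and $r\ge0$, $\phi_s(r)=\sqrt{s^2+r^2}$. Spatial Fourier transform: $\widehat f(\xi)=\int_{\mathbb R^d}e^{-ix\cdot\xi}f(x)\,\mathrm dx$. $D=\sqrt{-\Delta_x}$, and the Klein--Gordon propagator is $e^{it\phi_s(D)}f(x)=(2\pi)^{-d}\int_{\mathbb R^d}e^{i(x\cdot\xi+t\phi_s(|\xi|))}\widehat f(\xi)\,\mathrm d\xi$. The operator $|\square-(2s)^2|^\beta$ is the space-time Fourier multiplier with symbol $\big|\tau^2-|\xi|^2-(2s)^2\big|^\beta$, $(\tau,\xi)$ dual to $(t,x)\in\mathbb R\times\mathbb R^d$. The kernel is $$\mathcal K_a^b(\eta_1,\eta_2)=\frac{\big(\phi_s(|\eta_1|)\phi_s(|\eta_2|)-\eta_1\cdot\eta_2-s^2\big)^b}{\big(\phi_s(|\eta_1|)\phi_s(|\eta_2|)-\eta_1\cdot\eta_2+s^2\big)^a},\qquad\eta_1,\eta_2\in\mathbb R^d.$$ $\Gamma$ is the gamma function. $f,g$ are sufficiently nice functions on $\mathbb R^d$ (e.g. such that the right-hand side is finite). *)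

theory Defs
  imports "HOL-Analysis.Analysis"
begin

section \<open>Fourier transform\<close>

text \<open>
  On the spatial side \<open>'a\<close> is \<open>real ^ 'n\<close>; on the space-time side it is
  \<open>real \<times> (real ^ 'n)\<close>, whose inner product is
  \<open>(t, x) \<bullet> (\<tau>, \<xi>) = t * \<tau> + x \<bullet> \<xi>\<close>.
\<close>

definition fourier :: "('a::euclidean_space \<Rightarrow> complex) \<Rightarrow> 'a \<Rightarrow> complex" where
  "fourier f \<xi> = (LINT x|lborel. exp (- (\<i> * complex_of_real (x \<bullet> \<xi>))) * f x)"

definition dir_deriv :: "'a::euclidean_space \<Rightarrow> ('a \<Rightarrow> complex) \<Rightarrow> 'a \<Rightarrow> complex" where
  "dir_deriv v f x = frechet_derivative f (at x) v"

text \<open>The Schwartz space: every iterated directional derivative exists and decays rapidly.\<close>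

definition schwartz :: "('a::euclidean_space \<Rightarrow> complex) \<Rightarrow> bool" where
  "schwartz f \<longleftrightarrow>
     (\<forall>vs. foldr dir_deriv vs f differentiable_on UNIV \<and>
       (\<forall>k::nat. \<exists>B. \<forall>x. norm x ^ k * norm (foldr dir_deriv vs f x) \<le> B))"

text \<open>
  The function \<open>\<Phi>\<close> is the Fourier transform of the function \<open>F\<close> in the sense of tempered
  distributions.  This is needed because neither the product of two Klein--Gordon waves nor its
  image under the multiplier has to be integrable over space-time, so that \<^const>\<open>fourier\<close>
  does not apply to them.  For \<open>F\<close> in \<open>L\<^sup>1\<close> it agrees with \<^const>\<open>fourier\<close>, and for \<open>F\<close> in \<open>L\<^sup>2\<close>
  with the Fourier--Plancherel transform, up to null sets.
\<close>

definition has_fourier_transform ::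
    "('a::euclidean_space \<Rightarrow> complex) \<Rightarrow> ('a \<Rightarrow> complex) \<Rightarrow> bool" where
  "has_fourier_transform F \<Phi> \<longleftrightarrow>
     F \<in> borel_measurable borel \<and> \<Phi> \<in> borel_measurable borel \<and>
     (\<forall>\<psi>. schwartz \<psi> \<longrightarrow>
        integrable lborel (\<lambda>p. F p * fourier \<psi> p) \<and>
        integrable lborel (\<lambda>p. \<Phi> p * \<psi> p) \<and>
        (LINT p|lborel. F p * fourier \<psi> p) = (LINT p|lborel. \<Phi> p * \<psi> p))"

text \<open>
  \<open>H\<close> is the image of \<open>F\<close> under the Fourier multiplier with symbol \<open>m\<close>.  A relation is used since
  \<open>H\<close> is determined only up to a null set, and exists only if the symbol times the Fourier
  transform of \<open>F\<close> is again the Fourier transform of a function.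
\<close>

definition fourier_multiplier ::
    "('a::euclidean_space \<Rightarrow> real) \<Rightarrow> ('a \<Rightarrow> complex) \<Rightarrow> ('a \<Rightarrow> complex) \<Rightarrow> bool" where
  "fourier_multiplier m F H \<longleftrightarrow>
     (\<exists>\<Phi>. has_fourier_transform F \<Phi> \<and>
          has_fourier_transform H (\<lambda>p. complex_of_real (m p) * \<Phi> p))"

definition L2_norm_sq :: "('a::euclidean_space \<Rightarrow> complex) \<Rightarrow> ennreal" where
  "L2_norm_sq F = (\<integral>\<^sup>+p. ennreal ((norm (F p))\<^sup>2) \<partial>lborel)"

section \<open>The Klein--Gordon equation\<close>

definition phi :: "real \<Rightarrow> real \<Rightarrow> real" where
  "phi s r = sqrt (s\<^sup>2 + r\<^sup>2)"

definition kg_propagator ::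
    "real \<Rightarrow> (real ^ 'n \<Rightarrow> complex) \<Rightarrow> real \<times> (real ^ 'n) \<Rightarrow> complex" where
  "kg_propagator s f = (\<lambda>(t, x).
     (LINT \<xi>|lborel. exp (\<i> * complex_of_real (x \<bullet> \<xi> + t * phi s (norm \<xi>))) * fourier f \<xi>)
       / complex_of_real ((2 * pi) ^ CARD('n)))"

text \<open>
  Since \<open>0 powr b = 0\<close> for every \<open>b\<close>, the symbol below and the kernel \<open>kg_kernel\<close> take the value
  \<open>0\<close> where the base vanishes, also for exponents \<open>\<le> 0\<close>.  These are the null sets
  \<open>\<tau>\<^sup>2 - \<bar>\<xi>\<bar>\<^sup>2 = (2 s)\<^sup>2\<close> and \<open>\<eta>1 = \<eta>2\<close>, so neither the multiplier nor the integral is affected.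
\<close>

definition box_symbol :: "real \<Rightarrow> real \<Rightarrow> real \<times> (real ^ 'n) \<Rightarrow> real" where
  "box_symbol s \<beta> = (\<lambda>(\<tau>, \<xi>). \<bar>\<tau>\<^sup>2 - (norm \<xi>)\<^sup>2 - (2 * s)\<^sup>2\<bar> powr \<beta>)"

definition kg_kernel :: "real \<Rightarrow> real \<Rightarrow> real \<Rightarrow> real ^ 'n \<Rightarrow> real ^ 'n \<Rightarrow> real" where
  "kg_kernel s a b \<eta>1 \<eta>2 =
     (phi s (norm \<eta>1) * phi s (norm \<eta>2) - \<eta>1 \<bullet> \<eta>2 - s\<^sup>2) powr b /
     (phi s (norm \<eta>1) * phi s (norm \<eta>2) - \<eta>1 \<bullet> \<eta>2 + s\<^sup>2) powr a"

definition kg_integral ::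
    "real \<Rightarrow> real \<Rightarrow> (real ^ 'n \<Rightarrow> complex) \<Rightarrow> (real ^ 'n \<Rightarrow> complex) \<Rightarrow> ennreal" where
  "kg_integral s \<beta> f g =
     (\<integral>\<^sup>+(\<eta>1, \<eta>2).
        ennreal ((norm (fourier f \<eta>1))\<^sup>2 * (norm (fourier g \<eta>2))\<^sup>2
          * phi s (norm \<eta>1) * phi s (norm \<eta>2)
          * kg_kernel s (1/2) ((real CARD('n) - 2) / 2 + 2 * \<beta>) \<eta>1 \<eta>2)
      \<partial>lborel)"

text \<open>
  The ``sufficiently nice'' pairs of functions: the integrals defining the Fourier transform and
  the propagator converge absolutely, and the right-hand side of the estimate is finite.
\<close>

definition nice_pair ::
    "real \<Rightarrow> real \<Rightarrow> (real ^ 'n \<Rightarrow> complex) \<Rightarrow> (real ^ 'n \<Rightarrow> complex) \<Rightarrow> bool" where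
  "nice_pair s \<beta> f g \<longleftrightarrow>
     integrable lborel f \<and> integrable lborel (fourier f) \<and>
     integrable lborel g \<and> integrable lborel (fourier g) \<and>
     kg_integral s \<beta> f g < \<infinity>"

text \<open>\<open>H\<close> is \<open>\<bar>\<box> - (2 s)\<^sup>2\<bar>\<^sup>\<beta>\<close> applied to the product of the waves with data \<open>f\<close> and \<open>g\<close>.\<close>

definition kg_box_product ::
    "real \<Rightarrow> real \<Rightarrow> (real ^ 'n \<Rightarrow> complex) \<Rightarrow> (real ^ 'n \<Rightarrow> complex)
      \<Rightarrow> (real \<times> (real ^ 'n) \<Rightarrow> complex) \<Rightarrow> bool" where
  "kg_box_product s \<beta> f g H \<longleftrightarrow>
     fourier_multiplier (box_symbol s \<beta>) (\<lambda>p. kg_propagator s f p * kg_propagator s g p) H"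

definition KG_pp :: "real \<Rightarrow> nat \<Rightarrow> real" where
  "KG_pp \<beta> d =
     2 powr ((- 5 * real d + 1) / 2 + 2 * \<beta>) * pi powr ((- 5 * real d + 1) / 2)
       * Gamma ((real d - 1) / 2) / Gamma (real d - 1)"

end

theory Submission
  imports Defs "HOL-Probability.Probability"
begin

text \<open>
  The space-time Fourier transform of a product of two waves is, up to a constant, the push-forward
  of \<open>f^(\<eta>1) g^(\<eta>2) d\<eta>1 d\<eta>2\<close> under \<open>(\<eta>1, \<eta>2) \<mapsto> (\<phi>(\<eta>1) + \<phi>(\<eta>2), \<eta>1 + \<eta>2)\<close>.  The Lorentz invariant measure
  \<open>d\<eta>1 d\<eta>2 / (\<phi>(\<eta>1) \<phi>(\<eta>2))\<close> is pushed forward to an explicit density depending only on \<open>\<tau>\<^sup>2 - \<bar>\<xi>\<bar>\<^sup>2\<close>, and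
  the kernel \<open>K\<close> is a constant times this density times the square of the symbol.  So the estimate
  is Cauchy--Schwarz on the fibres, followed by Plancherel.  Equality holds if \<open>\<phi>(\<eta>1) \<phi>(\<eta>2) f^(\<eta>1) g^(\<eta>2)\<close>
  is constant on the fibres, as for \<open>f^ = g^ = exp(-\<phi>) / \<phi>\<close>; this is the transform of an integrable
  function because it is a superposition of Gaussians.
\<close>

section \<open>Gaussians, the inversion formula and the \<open>L\<^sup>2\<close> bound\<close>

text \<open>The multiplier is a relation between functions that are tied to their transforms only by
  duality with Schwartz functions, and the bound is claimed for every \<open>H\<close> so related.
  So both partners of \<open>has_fourier_transform\<close> must determine each other up to null
  sets, and Plancherel must be an equality, as an inequality alone would lose either the bound or
  its sharpness. Uniqueness needs enough Schwartz functions, for which modulated and translated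
  Gaussians suffice; existence needs Schwartz functions to have integrable transforms. The
  push-forward density is computed by turning \<open>\<xi>\<close> into a coordinate axis and
  working on lines parallel to it, where the transverse momentum only changes the mass and a Lorentz
  boost serves as the substitution. For sharpness the extremal data need a finite right-hand side.
  With \<open>X\<close> the excess of \<open>\<tau>\<^sup>2 - (norm \<xi>)\<^sup>2\<close> over
  \<open>(2 * s)\<^sup>2\<close>, the power of \<open>X\<close> that occurs is
  \<open>2 * \<beta> + d - 2\<close>; the lower bound on \<open>\<beta>\<close> keeps it above -1/2,
  so that the singularity at the threshold is integrable.\<close>

lemma lborel_prod_Basis:
  fixes f :: "'a::euclidean_space \<Rightarrow> real \<Rightarrow> complex"
  assumes int: "\<And>b. b \<in> Basis \<Longrightarrow> integrable lborel (f b)"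
  shows "integrable lborel (\<lambda>x. \<Prod>b\<in>Basis. f b (x \<bullet> b))"
    and "(LINT x|lborel. (\<Prod>b\<in>Basis. f b (x \<bullet> b))) = (\<Prod>b\<in>Basis. LINT x|lborel. f b x)"
proof -
  interpret product_sigma_finite "\<lambda>_::'a. lborel :: real measure" by standard
  have [measurable]: "\<And>b. b \<in> Basis \<Longrightarrow> f b \<in> borel_measurable borel"
    using borel_measurable_integrable[OF int] by simp
  have eq: "(\<Prod>b\<in>Basis. f b ((\<Sum>b\<in>Basis. y b *\<^sub>R b) \<bullet> b)) = (\<Prod>b\<in>Basis. f b (y b))" for y :: "'a \<Rightarrow> real"
    by (intro prod.cong) auto
  show "integrable lborel (\<lambda>x. \<Prod>b\<in>Basis. f b (x \<bullet> b))"
    by (subst lborel_eq, subst integrable_distr_eq) (auto simp: eq intro!: product_integrable_prod int)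
  show "(LINT x|lborel. (\<Prod>b\<in>Basis. f b (x \<bullet> b))) = (\<Prod>b\<in>Basis. LINT x|lborel. f b x)"
    by (subst lborel_eq, subst integral_distr) (auto simp: eq intro!: product_integral_prod int)
qed

section \<open>Gaussians, their transforms and damped plane waves\<close>

definition gauss :: "'a::euclidean_space \<Rightarrow> real" where
  "gauss x = exp (- (norm x)\<^sup>2 / 2)"

lemma gauss_pos: "gauss x > 0" and gauss_le_1: "gauss x \<le> 1"
  by (auto simp: gauss_def)

lemma gauss_minus [simp]: "gauss (- x) = gauss x"
  by (simp add: gauss_def)

lemma continuous_on_gauss: "continuous_on A gauss"
  unfolding gauss_def by (intro continuous_intros) auto

lemma borel_measurable_gauss [measurable]: "gauss \<in> borel_measurable borel"
  by (intro borel_measurable_continuous_onI continuous_on_gauss)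

text \<open>The characteristic function of the standard normal law, taken at \<open>- t\<close>
  because \<open>fourier\<close> has a minus sign in the exponent; the factor
  \<open>sqrt (2 * pi)\<close> undoes the normalisation of the density.\<close>

lemma fourier_gauss_real:
  "integrable lborel (\<lambda>x::real. exp (- (\<i> * complex_of_real (x * t))) * complex_of_real (exp (- x\<^sup>2 / 2)))"
  "(LINT x|lborel. exp (- (\<i> * complex_of_real (x * t))) * complex_of_real (exp (- x\<^sup>2 / 2))) = complex_of_real (sqrt (2 * pi) * exp (- t\<^sup>2 / 2))"
proof -
  have "integrable lborel (\<lambda>x::real. sqrt (2 * pi) * std_normal_density x)"
    by (intro integrable_mult_right integrable_normal_density) simp
  then have g: "integrable lborel (\<lambda>x::real. exp (- x\<^sup>2 / 2))"
    by (simp add: std_normal_density_def)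
  show "integrable lborel (\<lambda>x::real. exp (- (\<i> * complex_of_real (x * t))) * complex_of_real (exp (- x\<^sup>2 / 2)))"
    by (rule Bochner_Integration.integrable_bound[OF g]) (auto simp: norm_mult)
  have "complex_of_real (exp (- (t^2) / 2)) = char std_normal_distribution (-t)"
    by (simp add: char_std_normal_distribution)
  also have "\<dots> = (LINT x|lborel. std_normal_density x *\<^sub>R exp (\<i> * complex_of_real (- t * x)))"
    unfolding char_def by (subst integral_density) auto
  also have "\<dots> = (LINT x|lborel. complex_of_real (1 / sqrt (2 * pi)) * (exp (- (\<i> * complex_of_real (x * t))) * complex_of_real (exp (- x\<^sup>2 / 2))))"
    by (intro Bochner_Integration.integral_cong) (auto simp: std_normal_density_def scaleR_conv_of_real mult_ac)
  also have "\<dots> = complex_of_real (1 / sqrt (2 * pi)) * (LINT x|lborel. (exp (- (\<i> * complex_of_real (x * t))) * complex_of_real (exp (- x\<^sup>2 / 2))))"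
    by simp
  finally have *: "complex_of_real (exp (- (t^2) / 2)) = complex_of_real (1 / sqrt (2 * pi)) * (LINT x|lborel. (exp (- (\<i> * complex_of_real (x * t))) * complex_of_real (exp (- x\<^sup>2 / 2))))" .
  have "complex_of_real (sqrt (2 * pi)) * complex_of_real (1 / sqrt (2 * pi)) = 1"
    by (simp flip: of_real_mult)
  then show "(LINT x|lborel. exp (- (\<i> * complex_of_real (x * t))) * complex_of_real (exp (- x\<^sup>2 / 2))) = complex_of_real (sqrt (2 * pi) * exp (- t\<^sup>2 / 2))"
    by (simp only: of_real_mult[of "sqrt (2 * pi)"] * mult.assoc[symmetric] mult_1)
qed

lemma gauss_prod:
  fixes x :: "'a::euclidean_space"
  shows "exp (- (\<i> * complex_of_real (x \<bullet> \<xi>))) * complex_of_real (gauss x) =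
    (\<Prod>b\<in>Basis. exp (- (\<i> * complex_of_real ((x \<bullet> b) * (\<xi> \<bullet> b)))) * complex_of_real (exp (- (x \<bullet> b)\<^sup>2 / 2)))"
proof -
  have "(norm x)\<^sup>2 = (\<Sum>b\<in>Basis. (x \<bullet> b)\<^sup>2)"
    unfolding power2_norm_eq_inner euclidean_inner[of x x] by (simp add: power2_eq_square)
  then have "gauss x = (\<Prod>b\<in>Basis. exp (- (x \<bullet> b)\<^sup>2 / 2))"
    unfolding gauss_def by (simp add: exp_sum[symmetric] sum_divide_distrib sum_negf)
  moreover have "exp (- (\<i> * complex_of_real (x \<bullet> \<xi>))) = (\<Prod>b\<in>Basis. exp (- (\<i> * complex_of_real ((x \<bullet> b) * (\<xi> \<bullet> b)))))"
    unfolding euclidean_inner[of x \<xi>] by (simp add: exp_sum[symmetric] sum_distrib_left sum_negf)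
  ultimately show ?thesis by (simp add: prod.distrib)
qed

lemma fourier_gauss:
  fixes \<xi> :: "'a::euclidean_space"
  shows "fourier (\<lambda>x. complex_of_real (gauss x)) \<xi> = complex_of_real (sqrt (2 * pi) ^ DIM('a) * gauss \<xi>)"
proof -
  have "(norm \<xi>)\<^sup>2 = (\<Sum>b\<in>Basis. (\<xi> \<bullet> b)\<^sup>2)"
    unfolding power2_norm_eq_inner euclidean_inner[of \<xi> \<xi>] by (simp add: power2_eq_square)
  then have g: "gauss \<xi> = (\<Prod>b\<in>Basis. exp (- (\<xi> \<bullet> b)\<^sup>2 / 2))"
    unfolding gauss_def by (simp add: exp_sum[symmetric] sum_divide_distrib sum_negf)
  show ?thesis
    unfolding fourier_def gauss_prod
    by (subst lborel_prod_Basis(2)[where f="\<lambda>b t. exp (- (\<i> * complex_of_real (t * (\<xi> \<bullet> b)))) * complex_of_real (exp (- t\<^sup>2 / 2))"])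
      (simp_all only: fourier_gauss_real g, simp_all add: prod.distrib)
qed

lemma integrable_gauss: "integrable lborel (gauss :: 'a::euclidean_space \<Rightarrow> real)"
proof -
  have "integrable lborel (\<lambda>x::'a. exp (- (\<i> * complex_of_real (x \<bullet> 0))) * complex_of_real (gauss x))"
    unfolding gauss_prod
    by (rule lborel_prod_Basis(1)[where f="\<lambda>b t. exp (- (\<i> * complex_of_real (t * (0 \<bullet> b)))) * complex_of_real (exp (- t\<^sup>2 / 2))", OF fourier_gauss_real(1)])
  then have "integrable lborel (\<lambda>x::'a. complex_of_real (gauss x))" by simp
  from integrable_norm[OF this] show ?thesis by (simp add: gauss_pos abs_of_pos)
qed

lemma integral_gauss: "(LINT x|(lborel :: 'a::euclidean_space measure). gauss x) = sqrt (2 * pi) ^ DIM('a)"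
proof -
  have "complex_of_real (LINT x|(lborel :: 'a measure). gauss x) = fourier (\<lambda>x::'a. complex_of_real (gauss x)) 0"
    unfolding fourier_def by simp
  then show ?thesis unfolding fourier_gauss by (simp add: gauss_def del: of_real_power)
qed

lemma lborel_integral_affine:
  fixes f :: "'a::euclidean_space \<Rightarrow> 'b::{banach, second_countable_topology}"
  assumes c: "c \<noteq> 0" and [measurable]: "f \<in> borel_measurable borel"
  shows "(LINT x|lborel. f x) = \<bar>c\<bar> ^ DIM('a) *\<^sub>R (LINT x|lborel. f (t + c *\<^sub>R x))"
  by (subst lborel_affine[OF c, of t]) (simp add: integral_density integral_distr)

lemma lborel_integrable_affine:
  fixes f :: "'a::euclidean_space \<Rightarrow> 'b::{banach, second_countable_topology}"
  assumes c: "c \<noteq> 0" and f: "integrable lborel f"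
  shows "integrable lborel (\<lambda>x. f (t + c *\<^sub>R x))"
proof -
  have [measurable]: "f \<in> borel_measurable borel" using borel_measurable_integrable[OF f] by simp
  have "integrable (density (distr lborel borel (\<lambda>x. t + c *\<^sub>R x)) (\<lambda>_. ennreal (\<bar>c\<bar> ^ DIM('a)))) f"
    using f lborel_affine[OF c, of t] by simp
  then have "integrable lborel (\<lambda>x. \<bar>c\<bar> ^ DIM('a) *\<^sub>R f (t + c *\<^sub>R x))"
    by (simp add: integrable_density integrable_distr_eq)
  then have "integrable lborel (\<lambda>x. inverse (\<bar>c\<bar> ^ DIM('a)) *\<^sub>R \<bar>c\<bar> ^ DIM('a) *\<^sub>R f (t + c *\<^sub>R x))"
    by (rule integrable_scaleR_right)
  then show ?thesis using c by simp
qed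

lemma integrable_modulate:
  fixes f :: "'a::euclidean_space \<Rightarrow> complex"
  assumes "integrable lborel f" and [measurable]: "g \<in> borel_measurable borel"
  shows "integrable lborel (\<lambda>x. exp (\<i> * complex_of_real (g x)) * f x)"
    "integrable lborel (\<lambda>x. exp (- (\<i> * complex_of_real (g x))) * f x)"
proof -
  have [measurable]: "f \<in> borel_measurable borel" using borel_measurable_integrable[OF assms(1)] by simp
  show "integrable lborel (\<lambda>x. exp (\<i> * complex_of_real (g x)) * f x)"
    by (rule Bochner_Integration.integrable_bound[OF assms(1)]) (measurable, simp add: norm_mult)
  show "integrable lborel (\<lambda>x. exp (- (\<i> * complex_of_real (g x))) * f x)"
    by (rule Bochner_Integration.integrable_bound[OF assms(1)]) (measurable, simp add: norm_mult)
qed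

text \<open>The plane wave of frequency \<open>q\<close>, damped so that it becomes integrable; the
  damping disappears as \<open>e\<close> tends to 0. Its transform is \<open>gauss_kernel e\<close>
  centred at \<open>q\<close>, an approximate identity left unnormalised: its mass
  \<open>(2 * pi) ^ DIM('a)\<close> is the source of the constant in inversion and in
  Plancherel.\<close>

definition gauss_wave :: "real \<Rightarrow> 'a::euclidean_space \<Rightarrow> 'a \<Rightarrow> complex" where
  "gauss_wave e q p = exp (\<i> * complex_of_real (p \<bullet> q)) * complex_of_real (gauss (e *\<^sub>R p))"

definition gauss_kernel :: "real \<Rightarrow> 'a::euclidean_space \<Rightarrow> real" where
  "gauss_kernel e x = sqrt (2 * pi) ^ DIM('a) / e ^ DIM('a) * gauss (x /\<^sub>R e)"

lemma borel_measurable_gauss_wave [measurable]: "gauss_wave e q \<in> borel_measurable borel"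
  unfolding gauss_wave_def[abs_def] by measurable

lemma borel_measurable_gauss_kernel [measurable]: "gauss_kernel e \<in> borel_measurable borel"
  unfolding gauss_kernel_def[abs_def] by measurable

lemma integrable_gauss_scaled: "e \<noteq> 0 \<Longrightarrow> integrable lborel (\<lambda>p::'a::euclidean_space. gauss (e *\<^sub>R p))"
  using lborel_integrable_affine[OF _ integrable_gauss, of e 0] by simp

lemma integrable_gauss_wave: "e > 0 \<Longrightarrow> integrable lborel (gauss_wave e q)"
  unfolding gauss_wave_def[abs_def]
  by (intro integrable_modulate integrable_of_real integrable_gauss_scaled) auto

lemma fourier_gauss_wave:
  fixes q :: "'a::euclidean_space"
  assumes e: "e > 0"
  shows "fourier (gauss_wave e q) x = complex_of_real (gauss_kernel e (x - q))"
proof -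
  have "fourier (gauss_wave e q) x = (LINT p|lborel. exp (- (\<i> * complex_of_real (p \<bullet> (x - q)))) * complex_of_real (gauss (e *\<^sub>R p)))"
    unfolding fourier_def
  proof (rule Bochner_Integration.integral_cong[OF refl])
    fix p :: 'a
    have "exp (- (\<i> * complex_of_real (p \<bullet> x))) * exp (\<i> * complex_of_real (p \<bullet> q)) = exp (- (\<i> * complex_of_real (p \<bullet> (x - q))))"
      by (simp add: exp_add[symmetric] inner_diff_right right_diff_distrib)
    then show "exp (- (\<i> * complex_of_real (p \<bullet> x))) * gauss_wave e q p = exp (- (\<i> * complex_of_real (p \<bullet> (x - q)))) * complex_of_real (gauss (e *\<^sub>R p))"
      unfolding gauss_wave_def mult.assoc[symmetric] by simp
  qed
  also have "\<dots> = (1 / e ^ DIM('a)) *\<^sub>R fourier (\<lambda>p. complex_of_real (gauss p)) ((x - q) /\<^sub>R e)"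
  proof -
    have "fourier (\<lambda>p. complex_of_real (gauss p)) ((x - q) /\<^sub>R e) = \<bar>e\<bar> ^ DIM('a) *\<^sub>R
       (LINT p|lborel. exp (- (\<i> * complex_of_real ((0 + e *\<^sub>R p) \<bullet> ((x - q) /\<^sub>R e)))) * complex_of_real (gauss (0 + e *\<^sub>R p)))"
      unfolding fourier_def using e by (intro lborel_integral_affine) auto
    moreover have "(0 + e *\<^sub>R p) \<bullet> ((x - q) /\<^sub>R e) = p \<bullet> (x - q)" for p
      using e by (simp add: mult.assoc[symmetric])
    ultimately have "fourier (\<lambda>p. complex_of_real (gauss p)) ((x - q) /\<^sub>R e) = \<bar>e\<bar> ^ DIM('a) *\<^sub>R
       (LINT p|lborel. exp (- (\<i> * complex_of_real (p \<bullet> (x - q)))) * complex_of_real (gauss (0 + e *\<^sub>R p)))"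
      by (simp only:)
    then show ?thesis using e by simp
  qed
  finally show ?thesis unfolding fourier_gauss gauss_kernel_def by (simp add: scaleR_conv_of_real)
qed

lemma gauss_kernel_nonneg: "e > 0 \<Longrightarrow> gauss_kernel e x \<ge> 0"
  using gauss_pos[of "x /\<^sub>R e"] by (simp add: gauss_kernel_def)

lemma gauss_kernel_minus: "gauss_kernel e (- x) = gauss_kernel e x"
  by (simp add: gauss_kernel_def)

text \<open>Rescaling moves \<open>e\<close> from the kernel into the argument of \<open>f\<close>.
  For bounded \<open>f\<close> a fixed multiple of \<open>gauss\<close> then dominates for all
  \<open>e\<close>, and the limit depends only on how \<open>f\<close> behaves near
  \<open>q\<close>.\<close>

lemma integral_gauss_kernel_mult:
  fixes f :: "'a::euclidean_space \<Rightarrow> complex"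
  assumes e: "e > 0" and [measurable]: "f \<in> borel_measurable borel"
  shows "(LINT x|lborel. f x * complex_of_real (gauss_kernel e (x - q))) =
    complex_of_real (sqrt (2 * pi) ^ DIM('a)) * (LINT y|lborel. f (q + e *\<^sub>R y) * complex_of_real (gauss y))"
proof -
  have "(LINT x|lborel. f x * complex_of_real (gauss_kernel e (x - q))) =
    \<bar>e\<bar> ^ DIM('a) *\<^sub>R (LINT y|lborel. f (q + e *\<^sub>R y) * complex_of_real (gauss_kernel e (q + e *\<^sub>R y - q)))"
    using e by (intro lborel_integral_affine) auto
  also have "(LINT y|lborel. f (q + e *\<^sub>R y) * complex_of_real (gauss_kernel e (q + e *\<^sub>R y - q))) =
    (LINT y|lborel. complex_of_real (sqrt (2 * pi) ^ DIM('a) / e ^ DIM('a)) * (f (q + e *\<^sub>R y) * complex_of_real (gauss y)))"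
    using e by (intro Bochner_Integration.integral_cong) (auto simp: gauss_kernel_def)
  also have "\<dots> = complex_of_real (sqrt (2 * pi) ^ DIM('a) / e ^ DIM('a)) * (LINT y|lborel. f (q + e *\<^sub>R y) * complex_of_real (gauss y))"
    by (rule integral_mult_right_zero)
  finally show ?thesis using e by (simp add: scaleR_conv_of_real)
qed

lemma nn_integral_gauss_kernel:
  fixes q :: "'a::euclidean_space"
  assumes e: "e > 0"
  shows "(\<integral>\<^sup>+x. ennreal (gauss_kernel e (x - q)) \<partial>lborel) = ennreal ((2 * pi) ^ DIM('a))"
proof -
  have "integrable lborel (\<lambda>x::'a. gauss_kernel e (x - q))"
    using lborel_integrable_affine[OF _ integrable_gauss, of "1/e" "- q /\<^sub>R e"] e
    unfolding gauss_kernel_def by (simp add: scaleR_diff_right divide_inverse_commute)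
  moreover have "complex_of_real (LINT x|lborel. gauss_kernel e (x - q)) = complex_of_real ((2 * pi) ^ DIM('a))"
  proof -
    have "complex_of_real (LINT x|lborel. gauss_kernel e (x - q)) = (LINT x|lborel. 1 * complex_of_real (gauss_kernel e (x - q)))" by simp
    also have "\<dots> = complex_of_real (sqrt (2 * pi) ^ DIM('a) * (LINT y|(lborel :: 'a measure). gauss y))"
      by (subst integral_gauss_kernel_mult[OF e]) (auto)
    also have "sqrt (2 * pi) ^ DIM('a) * (LINT y|(lborel :: 'a measure). gauss y) = (2 * pi) ^ DIM('a)"
      unfolding integral_gauss power_mult_distrib[symmetric] by simp
    finally show ?thesis .
  qed
  ultimately show ?thesis
    using gauss_kernel_nonneg[OF e] by (subst nn_integral_eq_integral) (simp_all only: of_real_eq_iff, auto)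
qed

section \<open>The multiplication formula, inversion, and the upper half of Plancherel\<close>

lemma borel_measurable_fourier [measurable]:
  assumes [measurable]: "f \<in> borel_measurable borel"
  shows "fourier f \<in> borel_measurable borel"
  unfolding fourier_def[abs_def] by measurable

lemma ennreal_norm_integral_le:
  fixes f :: "'a \<Rightarrow> 'b::{banach, second_countable_topology}"
  shows "ennreal (norm (integral\<^sup>L M f)) \<le> (\<integral>\<^sup>+x. ennreal (norm (f x)) \<partial>M)"
  by (cases "integrable M f") (auto simp: integral_norm_bound_ennreal not_integrable_integral_eq)

lemma norm_fourier_le: "norm (fourier f \<xi>) \<le> (LINT x|lborel. norm (f x))"
  unfolding fourier_def by (rule order_trans[OF integral_norm_bound]) (simp add: norm_mult)

lemma integrable_mult_pair_bounded:
  fixes f :: "'a::euclidean_space \<Rightarrow> complex" and g :: "'b::euclidean_space \<Rightarrow> complex"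
  assumes f: "integrable lborel f" and g: "integrable lborel g"
    and [measurable]: "case_prod k \<in> borel_measurable (borel \<Otimes>\<^sub>M borel)"
    and k: "\<And>x y. norm (k x y :: complex) \<le> B"
  shows "integrable (lborel \<Otimes>\<^sub>M lborel) (\<lambda>(x, y). k x y * f x * g y)"
proof (rule Bochner_Integration.integrable_bound)
  have fm [measurable]: "f \<in> borel_measurable borel" "g \<in> borel_measurable borel"
    using f g by (auto dest: borel_measurable_integrable)
  show "integrable (lborel \<Otimes>\<^sub>M lborel) (\<lambda>(x, y). B * (norm (f x) * norm (g y)))"
    by (rule lborel_pair.Fubini_integrable) (use f g in \<open>auto intro!: integrable_norm simp: norm_mult abs_mult\<close>)
  show "(\<lambda>(x, y). k x y * f x * g y) \<in> borel_measurable (lborel \<Otimes>\<^sub>M lborel)" by measurable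
  show "AE z in lborel \<Otimes>\<^sub>M lborel. norm (case z of (x, y) \<Rightarrow> k x y * f x * g y) \<le> norm (case z of (x, y) \<Rightarrow> B * (norm (f x) * norm (g y)))"
  proof (rule AE_I2, clarify)
    fix x y
    have "norm (k x y * f x * g y) \<le> B * (norm (f x) * norm (g y))"
      unfolding norm_mult mult.assoc by (intro mult_right_mono k) auto
    then show "norm (k x y * f x * g y) \<le> norm (B * (norm (f x) * norm (g y)))" by simp
  qed
qed

text \<open>Serves for the oscillating kernel of the multiplication formula and for the Gaussian
  kernel in the uniqueness proof.\<close>

lemma Fubini_bounded_kernel:
  fixes f :: "'a::euclidean_space \<Rightarrow> complex" and g :: "'b::euclidean_space \<Rightarrow> complex"
  assumes f: "integrable lborel f" and g: "integrable lborel g"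
    and km: "case_prod k \<in> borel_measurable (borel \<Otimes>\<^sub>M borel)"
    and k: "\<And>x y. norm (k x y :: complex) \<le> B"
  shows "(LINT x|lborel. f x * (LINT y|lborel. k x y * g y)) = (LINT y|lborel. (LINT x|lborel. k x y * f x) * g y)"
proof -
  have "(LINT x|lborel. f x * (LINT y|lborel. k x y * g y)) = (LINT x|lborel. LINT y|lborel. k x y * f x * g y)"
    by (intro Bochner_Integration.integral_cong refl, subst integral_mult_right_zero[symmetric]) (simp add: mult_ac)
  also have "\<dots> = (LINT y|lborel. LINT x|lborel. k x y * f x * g y)"
    using lborel_pair.Fubini_integral[OF integrable_mult_pair_bounded[OF assms]] by simp
  also have "\<dots> = (LINT y|lborel. (LINT x|lborel. k x y * f x) * g y)"
    by (intro Bochner_Integration.integral_cong refl, subst integral_mult_left_zero[symmetric]) (simp add: mult_ac)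
  finally show ?thesis .
qed

lemma fourier_multiplication_formula:
  assumes "integrable lborel f" "integrable lborel g"
  shows "(LINT x|lborel. f x * fourier g x) = (LINT x|lborel. fourier f x * g x)"
proof -
  have "(LINT x|lborel. f x * fourier g x) = (LINT x|lborel. f x * (LINT y|lborel. exp (- (\<i> * complex_of_real (x \<bullet> y))) * g y))"
    unfolding fourier_def by (simp add: inner_commute)
  also have "\<dots> = (LINT x|lborel. fourier f x * g x)"
    unfolding fourier_def by (rule Fubini_bounded_kernel[OF assms, of _ 1]) auto
  finally show ?thesis .
qed

lemma gauss_scaled_tendsto: "(\<lambda>n. gauss ((1 / real (Suc n)) *\<^sub>R p)) \<longlonglongrightarrow> 1"
proof -
  have "(\<lambda>n. (1 / real (Suc n)) *\<^sub>R p) \<longlonglongrightarrow> 0 *\<^sub>R p"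
    by (intro tendsto_intros LIMSEQ_inverse_real_of_nat[unfolded inverse_eq_divide])
  then have "(\<lambda>n. gauss ((1 / real (Suc n)) *\<^sub>R p)) \<longlonglongrightarrow> gauss (0 *\<^sub>R p)"
    using continuous_on_gauss[of UNIV] by (intro isCont_tendsto_compose[where g = gauss]) (auto simp: continuous_on_eq_continuous_at)
  then show ?thesis by (simp add: gauss_def)
qed

text \<open>Pairing \<open>fourier \<psi>\<close> with a damped plane wave and moving the transform
  to the other factor gives averages of \<open>\<psi>\<close> around \<open>q\<close>. Both
  expressions converge as the damping is removed, the first by integrability of
  \<open>fourier \<psi>\<close>, the second by continuity and boundedness of
  \<open>\<psi>\<close>.\<close>

lemma fourier_inversion:
  fixes \<psi> :: "'a::euclidean_space \<Rightarrow> complex"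
  assumes int: "integrable lborel \<psi>" and int': "integrable lborel (fourier \<psi>)"
    and cont: "continuous_on UNIV \<psi>" and bd: "\<And>x. norm (\<psi> x) \<le> B"
  shows "fourier (fourier \<psi>) (- q) = complex_of_real ((2 * pi) ^ DIM('a)) * \<psi> q"
proof -
  define e where "e n = 1 / real (Suc n)" for n
  have e: "e n > 0" for n by (simp add: e_def)
  have e0: "e \<longlonglongrightarrow> 0" unfolding e_def by (rule LIMSEQ_inverse_real_of_nat[unfolded inverse_eq_divide])
  have [measurable]: "\<psi> \<in> borel_measurable borel" "fourier \<psi> \<in> borel_measurable borel"
    using int int' by (auto dest: borel_measurable_integrable)
  have "(LINT p|lborel. fourier \<psi> p * gauss_wave (e n) q p) = complex_of_real (sqrt (2 * pi) ^ DIM('a)) * (LINT y|lborel. \<psi> (q + e n *\<^sub>R y) * complex_of_real (gauss y))" for n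
    unfolding fourier_multiplication_formula[OF int integrable_gauss_wave[OF e], symmetric] fourier_gauss_wave[OF e]
    by (rule integral_gauss_kernel_mult[OF e]) measurable
  moreover have "(\<lambda>n. LINT p|lborel. fourier \<psi> p * gauss_wave (e n) q p) \<longlonglongrightarrow> (LINT p|lborel. fourier \<psi> p * exp (\<i> * complex_of_real (p \<bullet> q)))"
  proof (rule integral_dominated_convergence[where w="\<lambda>p. norm (fourier \<psi> p)"])
    show "AE p in lborel. (\<lambda>n. fourier \<psi> p * gauss_wave (e n) q p) \<longlonglongrightarrow> fourier \<psi> p * exp (\<i> * complex_of_real (p \<bullet> q))"
    proof (rule AE_I2)
      fix p
      have "(\<lambda>n. fourier \<psi> p * (exp (\<i> * complex_of_real (p \<bullet> q)) * complex_of_real (gauss (e n *\<^sub>R p)))) \<longlonglongrightarrow> fourier \<psi> p * (exp (\<i> * complex_of_real (p \<bullet> q)) * complex_of_real 1)"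
        unfolding e_def by (intro tendsto_intros gauss_scaled_tendsto)
      then show "(\<lambda>n. fourier \<psi> p * gauss_wave (e n) q p) \<longlonglongrightarrow> fourier \<psi> p * exp (\<i> * complex_of_real (p \<bullet> q))"
        by (simp add: gauss_wave_def)
    qed
    show "AE p in lborel. norm (fourier \<psi> p * gauss_wave (e n) q p) \<le> norm (fourier \<psi> p)" for n
      by (intro AE_I2) (simp add: gauss_wave_def norm_mult gauss_pos abs_of_pos gauss_le_1 mult_left_le)
  qed (use int' in auto)
  moreover have "(\<lambda>n. LINT y|lborel. \<psi> (q + e n *\<^sub>R y) * complex_of_real (gauss y)) \<longlonglongrightarrow> (LINT y|(lborel :: 'a measure). \<psi> q * complex_of_real (gauss y))"
  proof (rule integral_dominated_convergence[where w="\<lambda>y. B * gauss y"])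
    show "AE y in lborel. (\<lambda>n. \<psi> (q + e n *\<^sub>R y) * complex_of_real (gauss y)) \<longlonglongrightarrow> \<psi> q * complex_of_real (gauss y)"
    proof (rule AE_I2)
      fix y
      have "(\<lambda>n. q + e n *\<^sub>R y) \<longlonglongrightarrow> q + 0 *\<^sub>R y" by (intro tendsto_intros e0)
      then have "(\<lambda>n. \<psi> (q + e n *\<^sub>R y)) \<longlonglongrightarrow> \<psi> (q + 0 *\<^sub>R y)"
        using cont by (intro isCont_tendsto_compose[where g = \<psi>]) (auto simp: continuous_on_eq_continuous_at)
      then show "(\<lambda>n. \<psi> (q + e n *\<^sub>R y) * complex_of_real (gauss y)) \<longlonglongrightarrow> \<psi> q * complex_of_real (gauss y)"
        by (intro tendsto_intros) auto
    qed
    show "AE y in lborel. norm (\<psi> (q + e n *\<^sub>R y) * complex_of_real (gauss y)) \<le> B * gauss y" for n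
      by (intro AE_I2) (simp add: norm_mult gauss_pos abs_of_pos bd mult_right_mono less_imp_le)
  qed (use integrable_gauss in auto)
  ultimately have "(LINT p|lborel. fourier \<psi> p * exp (\<i> * complex_of_real (p \<bullet> q))) = complex_of_real (sqrt (2 * pi) ^ DIM('a)) * (LINT y|(lborel :: 'a measure). \<psi> q * complex_of_real (gauss y))"
    by (auto intro: LIMSEQ_unique tendsto_mult_left)
  also have "\<dots> = complex_of_real (sqrt (2 * pi) ^ DIM('a) * (LINT y|(lborel :: 'a measure). gauss y)) * \<psi> q" by simp
  also have "sqrt (2 * pi) ^ DIM('a) * (LINT y|(lborel :: 'a measure). gauss y) = (2 * pi) ^ DIM('a)"
    unfolding integral_gauss power_mult_distrib[symmetric] by simp
  finally show ?thesis unfolding fourier_def[of "fourier \<psi>"] by (simp add: mult.commute)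
qed

text \<open>The damped energy of \<open>fourier \<psi>\<close> is \<open>\<psi>\<close> paired with
  its own average against a nonnegative kernel of mass \<open>(2 * pi) ^ DIM('a)\<close>. Schur's
  test bounds this pairing uniformly in the damping, and Fatou's lemma removes the damping. No
  regularity enters, and the norms may be infinite.\<close>

lemma L2_norm_sq_fourier_le:
  fixes \<psi> :: "'a::euclidean_space \<Rightarrow> complex"
  assumes int: "integrable lborel \<psi>"
  shows "L2_norm_sq (fourier \<psi>) \<le> ennreal ((2 * pi) ^ DIM('a)) * L2_norm_sq \<psi>"
proof -
  define e where "e n = 1 / real (Suc n)" for n
  have e: "e n > 0" for n by (simp add: e_def)
  have [measurable]: "\<psi> \<in> borel_measurable borel" using int by (auto dest: borel_measurable_integrable)
  define J where "J n = (\<integral>\<^sup>+p. ennreal ((norm (fourier \<psi> p))\<^sup>2 * gauss (e n *\<^sub>R p)) \<partial>lborel)" for n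
  have J: "J n \<le> ennreal ((2 * pi) ^ DIM('a)) * L2_norm_sq \<psi>" for n
  proof -
    have kn: "gauss_kernel (e n) z \<ge> 0" for z :: 'a by (rule gauss_kernel_nonneg[OF e])
    define P where "P x = (LINT y|lborel. \<psi> y * complex_of_real (gauss_kernel (e n) (y - x)))" for x
    have Pm [measurable]: "P \<in> borel_measurable borel" unfolding P_def by measurable
    have P: "P x = (LINT p|lborel. fourier \<psi> p * gauss_wave (e n) x p)" for x
      unfolding P_def fourier_multiplication_formula[OF int integrable_gauss_wave[OF e], symmetric] fourier_gauss_wave[OF e] ..
    \<comment> \<open>\<open>fourier \<psi> * G\<close> is the damped energy density, while
      \<open>fourier G\<close> is the conjugate of the averaged function \<open>P\<close>; the
      multiplication formula links the two.\<close>
    define G where "G p = cnj (fourier \<psi> p) * complex_of_real (gauss (e n *\<^sub>R p))" for p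
    have [measurable]: "(\<lambda>p. cnj (fourier \<psi> p)) \<in> borel_measurable borel"
      by (rule measurable_compose[OF _ borel_measurable_continuous_onI[OF continuous_on_cnj[OF continuous_on_id]]])
        (rule borel_measurable_fourier, measurable)
    have Gm [measurable]: "G \<in> borel_measurable borel" unfolding G_def by measurable
    have Gint: "integrable lborel G"
    proof (rule Bochner_Integration.integrable_bound)
      show "integrable lborel (\<lambda>p::'a. (LINT x|lborel. norm (\<psi> x)) * gauss (e n *\<^sub>R p))"
        using e[of n] by (intro integrable_mult_right integrable_gauss_scaled) auto
      show "AE p in lborel. norm (G p) \<le> norm ((LINT x|lborel. norm (\<psi> x)) * gauss (e n *\<^sub>R p))"
        unfolding G_def using norm_fourier_le[of \<psi>] gauss_pos
        by (auto simp: norm_mult abs_mult less_imp_le intro!: mult_right_mono order_trans[OF norm_fourier_le abs_ge_self])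
    qed simp
    have FG: "fourier G x = cnj (P x)" for x
    proof -
      have "cnj (P x) = (LINT p|lborel. cnj (fourier \<psi> p * gauss_wave (e n) x p))" unfolding P by (rule Bochner_Integration.integral_cnj[symmetric])
      also have "\<dots> = fourier G x" unfolding fourier_def[of G] G_def gauss_wave_def
        by (intro Bochner_Integration.integral_cong) (auto simp: exp_cnj mult_ac)
      finally show ?thesis ..
    qed
    have "integrable lborel (\<lambda>p. fourier \<psi> p * G p)"
    proof (rule Bochner_Integration.integrable_bound)
      show "integrable lborel (\<lambda>p. (LINT x|lborel. norm (\<psi> x)) * norm (G p))" using Gint by simp
      show "AE p in lborel. norm (fourier \<psi> p * G p) \<le> norm ((LINT x|lborel. norm (\<psi> x)) * norm (G p))"
        using norm_fourier_le[of \<psi>]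
        by (auto simp: norm_mult abs_mult intro!: mult_right_mono order_trans[OF norm_fourier_le abs_ge_self])
    qed simp
    moreover have eqG: "fourier \<psi> p * G p = complex_of_real ((norm (fourier \<psi> p))\<^sup>2 * gauss (e n *\<^sub>R p))" for p
      unfolding G_def by (simp add: mult.assoc[symmetric] complex_norm_square[symmetric])
    ultimately have intJ: "integrable lborel (\<lambda>p. (norm (fourier \<psi> p))\<^sup>2 * gauss (e n *\<^sub>R p))"
      by (simp only: complex_of_real_integrable_eq)
    have "complex_of_real (LINT p|lborel. (norm (fourier \<psi> p))\<^sup>2 * gauss (e n *\<^sub>R p)) = (LINT x|lborel. \<psi> x * cnj (P x))"
      unfolding FG[symmetric] fourier_multiplication_formula[OF int Gint] eqG by (rule integral_complex_of_real[symmetric])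
    then have "norm (complex_of_real (LINT p|lborel. (norm (fourier \<psi> p))\<^sup>2 * gauss (e n *\<^sub>R p))) = norm (LINT x|lborel. \<psi> x * cnj (P x))"
      by (rule arg_cong)
    then have "norm (LINT p|lborel. (norm (fourier \<psi> p))\<^sup>2 * gauss (e n *\<^sub>R p)) = norm (LINT x|lborel. \<psi> x * cnj (P x))"
      by (simp only: norm_of_real real_norm_def)
    then have *: "\<bar>LINT p|lborel. (norm (fourier \<psi> p))\<^sup>2 * gauss (e n *\<^sub>R p)\<bar> = norm (LINT x|lborel. \<psi> x * cnj (P x))"
      by (simp only: real_norm_def)
    have nonneg: "(norm (fourier \<psi> p))\<^sup>2 * gauss (e n *\<^sub>R p) \<ge> 0" for p
      by (simp add: gauss_pos less_imp_le)
    have nn: "(LINT p|lborel. (norm (fourier \<psi> p))\<^sup>2 * gauss (e n *\<^sub>R p)) \<ge> 0"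
      by (intro integral_nonneg_AE AE_I2 nonneg)
    have "J n = ennreal (LINT p|lborel. (norm (fourier \<psi> p))\<^sup>2 * gauss (e n *\<^sub>R p))"
      unfolding J_def by (rule nn_integral_eq_integral[OF intJ AE_I2[OF nonneg]])
    then have "J n = ennreal (norm (LINT x|lborel. \<psi> x * cnj (P x)))"
      unfolding *[symmetric] abs_of_nonneg[OF nn] .
    also have "\<dots> \<le> (\<integral>\<^sup>+x. ennreal (norm (\<psi> x * cnj (P x))) \<partial>lborel)"
      by (rule ennreal_norm_integral_le)
    also have "\<dots> \<le> (\<integral>\<^sup>+x. (\<integral>\<^sup>+y. ennreal (norm (\<psi> x) * (norm (\<psi> y) * gauss_kernel (e n) (y - x))) \<partial>lborel) \<partial>lborel)"
    proof (intro nn_integral_mono)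
      fix x
      have "ennreal (norm (P x)) \<le> (\<integral>\<^sup>+y. ennreal (norm (\<psi> y * complex_of_real (gauss_kernel (e n) (y - x)))) \<partial>lborel)"
        unfolding P_def by (rule ennreal_norm_integral_le)
      also have "\<dots> = (\<integral>\<^sup>+y. ennreal (norm (\<psi> y) * gauss_kernel (e n) (y - x)) \<partial>lborel)"
        by (simp add: norm_mult kn)
      finally have "ennreal (norm (\<psi> x)) * ennreal (norm (P x)) \<le> ennreal (norm (\<psi> x)) * (\<integral>\<^sup>+y. ennreal (norm (\<psi> y) * gauss_kernel (e n) (y - x)) \<partial>lborel)"
        by (rule mult_left_mono) simp
      also have "\<dots> = (\<integral>\<^sup>+y. ennreal (norm (\<psi> x)) * ennreal (norm (\<psi> y) * gauss_kernel (e n) (y - x)) \<partial>lborel)"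
        by (rule nn_integral_cmult[symmetric]) measurable
      finally show "ennreal (norm (\<psi> x * cnj (P x))) \<le> (\<integral>\<^sup>+y. ennreal (norm (\<psi> x) * (norm (\<psi> y) * gauss_kernel (e n) (y - x))) \<partial>lborel)"
        by (simp add: norm_mult ennreal_mult')
    qed
    \<comment> \<open>Schur's test: after the arithmetic-geometric mean inequality each half
      contains only one of the two values of \<open>\<psi>\<close>, and the kernel is integrated out
      in the other variable.\<close>
    also have "\<dots> \<le> (\<integral>\<^sup>+x. (\<integral>\<^sup>+y. ennreal ((norm (\<psi> x))\<^sup>2 / 2) * ennreal (gauss_kernel (e n) (y - x)) + ennreal ((norm (\<psi> y))\<^sup>2 / 2) * ennreal (gauss_kernel (e n) (y - x)) \<partial>lborel) \<partial>lborel)"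
    proof (intro nn_integral_mono)
      fix x y
      have "norm (\<psi> x) * norm (\<psi> y) \<le> (norm (\<psi> x))\<^sup>2 / 2 + (norm (\<psi> y))\<^sup>2 / 2"
        using sum_squares_bound[of "norm (\<psi> x)" "norm (\<psi> y)"] by (simp add: field_simps)
      then have "norm (\<psi> x) * (norm (\<psi> y) * gauss_kernel (e n) (y - x)) \<le> (norm (\<psi> x))\<^sup>2 / 2 * gauss_kernel (e n) (y - x) + (norm (\<psi> y))\<^sup>2 / 2 * gauss_kernel (e n) (y - x)"
        unfolding mult.assoc[symmetric] distrib_right[symmetric] by (intro mult_right_mono kn)
      then show "ennreal (norm (\<psi> x) * (norm (\<psi> y) * gauss_kernel (e n) (y - x))) \<le> ennreal ((norm (\<psi> x))\<^sup>2 / 2) * ennreal (gauss_kernel (e n) (y - x)) + ennreal ((norm (\<psi> y))\<^sup>2 / 2) * ennreal (gauss_kernel (e n) (y - x))"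
        by (subst (1 2) ennreal_mult''[symmetric, OF kn], subst ennreal_plus[symmetric]) (auto intro!: ennreal_leI mult_nonneg_nonneg kn)
    qed
    also have "\<dots> = (\<integral>\<^sup>+x. (\<integral>\<^sup>+y. ennreal ((norm (\<psi> x))\<^sup>2 / 2) * ennreal (gauss_kernel (e n) (y - x)) \<partial>lborel) + (\<integral>\<^sup>+y. ennreal ((norm (\<psi> y))\<^sup>2 / 2) * ennreal (gauss_kernel (e n) (y - x)) \<partial>lborel) \<partial>lborel)"
      by (rule nn_integral_cong, rule nn_integral_add) measurable
    also have "\<dots> = (\<integral>\<^sup>+x. (\<integral>\<^sup>+y. ennreal ((norm (\<psi> x))\<^sup>2 / 2) * ennreal (gauss_kernel (e n) (y - x)) \<partial>lborel) \<partial>lborel) + (\<integral>\<^sup>+x. (\<integral>\<^sup>+y. ennreal ((norm (\<psi> y))\<^sup>2 / 2) * ennreal (gauss_kernel (e n) (y - x)) \<partial>lborel) \<partial>lborel)"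
      by (rule nn_integral_add) measurable
    also have "\<dots> = (\<integral>\<^sup>+x. ennreal ((norm (\<psi> x))\<^sup>2 / 2) * ennreal ((2 * pi) ^ DIM('a)) \<partial>lborel) + (\<integral>\<^sup>+x. ennreal ((norm (\<psi> x))\<^sup>2 / 2) * ennreal ((2 * pi) ^ DIM('a)) \<partial>lborel)"
      (is "?S1 + ?S2 = _")
    proof (rule arg_cong2[where f="(+)"])
      have K: "(\<integral>\<^sup>+y. ennreal ((norm (\<psi> x))\<^sup>2 / 2) * ennreal (gauss_kernel (e n) (y - x)) \<partial>lborel) = ennreal ((norm (\<psi> x))\<^sup>2 / 2) * ennreal ((2 * pi) ^ DIM('a))" for x
        unfolding nn_integral_gauss_kernel[OF e, of n x, symmetric] by (rule nn_integral_cmult) measurable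
      show "?S1 = (\<integral>\<^sup>+x. ennreal ((norm (\<psi> x))\<^sup>2 / 2) * ennreal ((2 * pi) ^ DIM('a)) \<partial>lborel)"
        by (rule nn_integral_cong) (rule K)
      have "?S2 = (\<integral>\<^sup>+y. (\<integral>\<^sup>+x. ennreal ((norm (\<psi> y))\<^sup>2 / 2) * ennreal (gauss_kernel (e n) (y - x)) \<partial>lborel) \<partial>lborel)"
        by (rule lborel_pair.Fubini') measurable
      also have "\<dots> = (\<integral>\<^sup>+y. (\<integral>\<^sup>+x. ennreal ((norm (\<psi> y))\<^sup>2 / 2) * ennreal (gauss_kernel (e n) (x - y)) \<partial>lborel) \<partial>lborel)"
      proof (intro nn_integral_cong arg_cong2[where f="(*)"] refl arg_cong[where f=ennreal])
        fix x y show "gauss_kernel (e n) (y - x) = gauss_kernel (e n) (x - y)"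
          using gauss_kernel_minus[of "e n" "x - y"] by simp
      qed
      also have "\<dots> = (\<integral>\<^sup>+x. ennreal ((norm (\<psi> x))\<^sup>2 / 2) * ennreal ((2 * pi) ^ DIM('a)) \<partial>lborel)"
        by (rule nn_integral_cong) (rule K)
      finally show "?S2 = (\<integral>\<^sup>+x. ennreal ((norm (\<psi> x))\<^sup>2 / 2) * ennreal ((2 * pi) ^ DIM('a)) \<partial>lborel)" .
    qed
    also have "\<dots>
       = (\<integral>\<^sup>+x. ennreal ((norm (\<psi> x))\<^sup>2 / 2) * ennreal ((2 * pi) ^ DIM('a)) + ennreal ((norm (\<psi> x))\<^sup>2 / 2) * ennreal ((2 * pi) ^ DIM('a)) \<partial>lborel)"
      by (rule nn_integral_add[symmetric]) measurable
    also have "\<dots> = (\<integral>\<^sup>+x. ennreal ((2 * pi) ^ DIM('a)) * ennreal ((norm (\<psi> x))\<^sup>2) \<partial>lborel)"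
    proof (rule nn_integral_cong)
      fix x
      have "ennreal ((norm (\<psi> x))\<^sup>2 / 2) + ennreal ((norm (\<psi> x))\<^sup>2 / 2) = ennreal ((norm (\<psi> x))\<^sup>2)"
        by (subst ennreal_plus[symmetric]) auto
      then show "ennreal ((norm (\<psi> x))\<^sup>2 / 2) * ennreal ((2 * pi) ^ DIM('a)) + ennreal ((norm (\<psi> x))\<^sup>2 / 2) * ennreal ((2 * pi) ^ DIM('a)) = ennreal ((2 * pi) ^ DIM('a)) * ennreal ((norm (\<psi> x))\<^sup>2)"
        unfolding distrib_right[symmetric] by (simp add: mult.commute)
    qed
    also have "\<dots> = ennreal ((2 * pi) ^ DIM('a)) * L2_norm_sq \<psi>"
      unfolding L2_norm_sq_def by (rule nn_integral_cmult) measurable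
    finally show ?thesis .
  qed
  have "L2_norm_sq (fourier \<psi>) = (\<integral>\<^sup>+p. liminf (\<lambda>n. ennreal ((norm (fourier \<psi> p))\<^sup>2 * gauss (e n *\<^sub>R p))) \<partial>lborel)"
    unfolding L2_norm_sq_def
  proof (intro nn_integral_cong)
    fix p
    have "(\<lambda>n. ennreal ((norm (fourier \<psi> p))\<^sup>2 * gauss (e n *\<^sub>R p))) \<longlonglongrightarrow> ennreal ((norm (fourier \<psi> p))\<^sup>2 * 1)"
      unfolding e_def by (intro tendsto_ennrealI tendsto_intros gauss_scaled_tendsto)
    then show "ennreal ((norm (fourier \<psi> p))\<^sup>2) = liminf (\<lambda>n. ennreal ((norm (fourier \<psi> p))\<^sup>2 * gauss (e n *\<^sub>R p)))"
      by (simp add: lim_imp_Liminf)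
  qed
  also have "\<dots> \<le> liminf J" unfolding J_def by (rule nn_integral_liminf) measurable
  also have "\<dots> \<le> ennreal ((2 * pi) ^ DIM('a)) * L2_norm_sq \<psi>"
    using J by (intro Liminf_le) auto
  finally show ?thesis .
qed

section \<open>Uniqueness and the Fourier transform on \<open>L\<^sup>2\<close>\<close>

text \<open>The positive and the negative part of \<open>K\<close> are densities of two measures
  that agree on boxes, an intersection-stable generator. Hence the measures agree, and so do their
  densities almost everywhere.\<close>

lemma AE_eq_0_if_box_integrals_0_real:
  fixes K :: "'a::euclidean_space \<Rightarrow> real"
  assumes int: "integrable lborel K"
    and box: "\<And>a b. (LINT x|lborel. indicator (box a b) x * K x) = 0"
  shows "AE x in lborel. K x = 0"
proof -
  have [measurable]: "K \<in> borel_measurable borel" using int by (auto dest: borel_measurable_integrable)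
  \<comment> \<open>\<open>ennreal\<close> sends negative reals to 0, so \<open>P\<close> and
    \<open>N\<close> are the positive and the negative part.\<close>
  define P where "P x = ennreal (K x)" for x
  define N where "N x = ennreal (- K x)" for x
  have [measurable]: "P \<in> borel_measurable borel" unfolding P_def[abs_def] by measurable
  have [measurable]: "N \<in> borel_measurable borel" unfolding N_def[abs_def] by measurable
  have eq: "emeasure (density lborel P) (box a b) = emeasure (density lborel N) (box a b)
      \<and> emeasure (density lborel P) (box a b) \<noteq> \<infinity>" for a b :: 'a
  proof -
    have i: "integrable lborel (\<lambda>x. indicator (box a b) x * K x)"
      using integrable_mult_indicator[OF _ int, of "box a b"] by simp
    have P: "(\<integral>\<^sup>+x. ennreal (indicator (box a b) x * K x) \<partial>lborel) = emeasure (density lborel P) (box a b)"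
      by (subst emeasure_density) (auto simp: P_def intro!: nn_integral_cong split: split_indicator)
    have N: "(\<integral>\<^sup>+x. ennreal (- (indicator (box a b) x * K x)) \<partial>lborel) = emeasure (density lborel N) (box a b)"
      by (subst emeasure_density) (auto simp: N_def intro!: nn_integral_cong split: split_indicator)
    have fin: "emeasure (density lborel P) (box a b) \<noteq> \<infinity>" "emeasure (density lborel N) (box a b) \<noteq> \<infinity>"
      using i unfolding P[symmetric] N[symmetric] by (auto simp: real_integrable_def)
    have "enn2real (emeasure (density lborel P) (box a b)) - enn2real (emeasure (density lborel N) (box a b)) = 0"
      using real_lebesgue_integral_def[OF i] box[of a b] unfolding P N by simp
    then show ?thesis using fin
      by (metis eq_iff_diff_eq_0 ennreal_enn2real_if infinity_ennreal_def)
  qed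
  have "density lborel P = density lborel N"
  proof (rule measure_eqI_generator_eq)
    let ?E = "range (\<lambda>(a, b). box a b::'a set)"
    show "Int_stable ?E" by (auto simp: Int_stable_def box_Int_box)
    show "?E \<subseteq> Pow UNIV" "sets (density lborel P) = sigma_sets UNIV ?E" "sets (density lborel N) = sigma_sets UNIV ?E"
      by (simp_all add: borel_eq_box)
    let ?A = "\<lambda>n::nat. box (- (real n *\<^sub>R One)) (real n *\<^sub>R One) :: 'a set"
    show "range ?A \<subseteq> ?E" "(\<Union>i. ?A i) = UNIV" unfolding UN_box_eq_UNIV by auto
    show "emeasure (density lborel P) (?A i) \<noteq> \<infinity>" for i using eq by blast
    show "emeasure (density lborel P) X = emeasure (density lborel N) X" if "X \<in> ?E" for X
      using that eq by auto
  qed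
  then have "AE x in lborel. P x = N x"
    by (intro sigma_finite_measure.density_unique[OF sigma_finite_lborel]) auto
  then show ?thesis
  proof eventually_elim
    case (elim x)
    then show ?case unfolding P_def N_def by (cases "K x \<ge> 0") (auto simp: ennreal_eq_0_iff ennreal_neg)
  qed
qed

lemma AE_eq_0_if_box_integrals_0:
  fixes K :: "'a::euclidean_space \<Rightarrow> complex"
  assumes int: "integrable lborel K"
    and box: "\<And>a b. (LINT x|lborel. indicator (box a b) x * K x) = 0"
  shows "AE x in lborel. K x = 0"
proof -
  have i: "integrable lborel (\<lambda>x. indicator (box a b) x * K x)" for a b
  proof -
    have "(\<lambda>x. indicator (box a b) x * K x) = (\<lambda>x. indicat_real (box a b) x *\<^sub>R K x)"
      by (auto simp: fun_eq_iff split: split_indicator)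
    then show ?thesis using integrable_mult_indicator[OF _ int, of "box a b"] by simp
  qed
  have "AE x in lborel. Re (K x) = 0"
  proof (rule AE_eq_0_if_box_integrals_0_real)
    fix a b
    have "(LINT x|lborel. indicator (box a b) x * Re (K x)) = Re (LINT x|lborel. indicator (box a b) x * K x)"
      by (subst integral_Re[OF i, symmetric]) (auto intro!: Bochner_Integration.integral_cong split: split_indicator)
    then show "(LINT x|lborel. indicator (box a b) x * Re (K x)) = 0" by (simp add: box)
  qed (use int in simp)
  moreover have "AE x in lborel. Im (K x) = 0"
  proof (rule AE_eq_0_if_box_integrals_0_real)
    fix a b
    have "(LINT x|lborel. indicator (box a b) x * Im (K x)) = Im (LINT x|lborel. indicator (box a b) x * K x)"
      by (subst integral_Im[OF i, symmetric]) (auto intro!: Bochner_Integration.integral_cong split: split_indicator)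
    then show "(LINT x|lborel. indicator (box a b) x * Im (K x)) = 0" by (simp add: box)
  qed (use int in simp)
  ultimately show ?thesis by eventually_elim (simp add: complex_eq_iff)
qed

text \<open>Off the frontier the indicator of a box is locally constant, which is what makes its
  Gaussian averages converge there.\<close>

lemma AE_not_in_frontier_box:
  fixes a b :: "'a::euclidean_space"
  shows "AE x in lborel. x \<in> box a b \<or> x \<notin> cbox a b"
proof -
  have "emeasure lborel (cbox a b - box a b) = emeasure lborel (cbox a b) - emeasure lborel (box a b)"
    by (rule emeasure_Diff) (auto simp: box_subset_cbox emeasure_lborel_box_eq)
  also have "\<dots> = 0" by (simp add: emeasure_lborel_box_eq emeasure_lborel_cbox_eq)
  finally have "cbox a b - box a b \<in> null_sets lborel" by (intro null_setsI) auto
  from AE_not_in[OF this] show ?thesis by eventually_elim auto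
qed

text \<open>Tested against Gaussian kernels, a function with vanishing transform gives zero; the kernels
  approximate the indicator of a box boundedly and almost everywhere.\<close>
theorem fourier_eq_0_imp_AE_eq_0:
  fixes K :: "'a::euclidean_space \<Rightarrow> complex"
  assumes int: "integrable lborel K" and zero: "\<And>\<xi>. fourier K \<xi> = 0"
  shows "AE x in lborel. K x = 0"
proof (rule AE_eq_0_if_box_integrals_0[OF int])
  fix a b :: 'a
  define h :: "'a \<Rightarrow> complex" where "h = indicator (box a b)"
  have [measurable]: "K \<in> borel_measurable borel" using int by (auto dest: borel_measurable_integrable)
  have hm [measurable]: "h \<in> borel_measurable borel" unfolding h_def by (rule borel_measurable_indicator) simp
  have hint: "integrable lborel h" unfolding h_def
  proof (rule integrableI_bounded)
    have "(\<integral>\<^sup>+x. ennreal (norm (indicator (box a b) x :: complex)) \<partial>lborel) = (\<integral>\<^sup>+x. indicator (box a b) x \<partial>lborel)"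
      by (intro nn_integral_cong) (auto split: split_indicator)
    then show "(\<integral>\<^sup>+x. ennreal (norm (indicator (box a b) x :: complex)) \<partial>lborel) < \<infinity>"
      by (simp add: emeasure_lborel_box_eq)
  qed (rule borel_measurable_indicator, simp)
  have h1: "norm (h x) \<le> 1" for x by (auto simp: h_def split: split_indicator)
  define e where "e n = 1 / real (Suc n)" for n
  have e: "e n > 0" for n by (simp add: e_def)
  have e0: "e \<longlonglongrightarrow> 0" unfolding e_def by (rule LIMSEQ_inverse_real_of_nat[unfolded inverse_eq_divide])
  \<comment> \<open>The average of the indicator at scale \<open>e n\<close>. The Gaussian is not
    normalised, so the limit is \<open>c\<close> times the indicator.\<close>
  define H where "H n y = (LINT z|lborel. h (y + e n *\<^sub>R z) * complex_of_real (gauss z))" for n y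
  have Hm [measurable]: "H n \<in> borel_measurable borel" for n unfolding H_def by measurable
  define c where "c = sqrt (2 * pi) ^ DIM('a)"
  have c0: "c > 0" by (simp add: c_def)
  \<comment> \<open>The Gaussian kernel is the transform of a damped plane wave, so integrating
    \<open>K\<close> against it amounts to integrating \<open>fourier K\<close>.\<close>
  have "(LINT y|lborel. K y * H n y) = 0" for n
  proof -
    have kb: "norm (complex_of_real (gauss_kernel (e n) (w - y))) \<le> c / e n ^ DIM('a)" for w y :: 'a
    proof -
      have "norm (complex_of_real (gauss_kernel (e n) (w - y))) = c / e n ^ DIM('a) * gauss ((w - y) /\<^sub>R e n)"
        unfolding norm_of_real abs_of_nonneg[OF gauss_kernel_nonneg[OF e]] by (simp add: gauss_kernel_def c_def)
      also have "\<dots> \<le> c / e n ^ DIM('a)" using c0 e[of n] by (intro mult_left_le gauss_le_1) simp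
      finally show ?thesis .
    qed
    have "complex_of_real c * (LINT y|lborel. K y * H n y) = (LINT y|lborel. K y * (complex_of_real c * H n y))"
      by (subst integral_mult_right_zero[symmetric]) (simp add: mult_ac)
    also have "\<dots> = (LINT y|lborel. K y * (LINT w|lborel. complex_of_real (gauss_kernel (e n) (w - y)) * h w))"
      unfolding H_def c_def integral_gauss_kernel_mult[OF e hm, symmetric] by (simp add: mult.commute)
    also have "\<dots> = (LINT w|lborel. (LINT y|lborel. complex_of_real (gauss_kernel (e n) (w - y)) * K y) * h w)"
      by (rule Fubini_bounded_kernel[OF int hint _ kb]) measurable
    also have "\<dots> = (LINT w|lborel. (LINT y|lborel. K y * fourier (gauss_wave (e n) w) y) * h w)"
    proof -
      have "complex_of_real (gauss_kernel (e n) (w - y)) * K y = K y * fourier (gauss_wave (e n) w) y" for w y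
        using gauss_kernel_minus[of "e n" "y - w"] by (simp add: fourier_gauss_wave[OF e])
      then show ?thesis by (simp only:)
    qed
    also have "\<dots> = 0"
      by (simp add: fourier_multiplication_formula[OF int integrable_gauss_wave[OF e]] zero)
    finally show ?thesis using c0 by simp
  qed
  moreover have "(\<lambda>n. LINT y|lborel. K y * H n y) \<longlonglongrightarrow> (LINT y|lborel. K y * (complex_of_real c * h y))"
  proof (rule integral_dominated_convergence[where w="\<lambda>y. c * norm (K y)"])
    have gb: "norm (h (y + e n *\<^sub>R z) * complex_of_real (gauss z)) \<le> gauss z" for y z n
      using mult_right_mono[OF h1[of "y + e n *\<^sub>R z"], of "gauss z"] by (simp add: norm_mult gauss_pos abs_of_pos less_imp_le)
    show "AE y in lborel. (\<lambda>n. K y * H n y) \<longlonglongrightarrow> K y * (complex_of_real c * h y)"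
      using AE_not_in_frontier_box[of a b]
    proof eventually_elim
      case (elim y)
      have "(\<lambda>n. H n y) \<longlonglongrightarrow> (LINT z|(lborel :: 'a measure). h y * complex_of_real (gauss z))"
        unfolding H_def
      proof (rule integral_dominated_convergence[where w=gauss])
        show "AE z in lborel. (\<lambda>n. h (y + e n *\<^sub>R z) * complex_of_real (gauss z)) \<longlonglongrightarrow> h y * complex_of_real (gauss z)"
        proof (rule AE_I2)
          fix z
          have "(\<lambda>n. y + e n *\<^sub>R z) \<longlonglongrightarrow> y + 0 *\<^sub>R z" by (intro tendsto_intros e0)
          then have lim: "(\<lambda>n. y + e n *\<^sub>R z) \<longlonglongrightarrow> y" by simp
          have "eventually (\<lambda>n. h (y + e n *\<^sub>R z) = h y) sequentially"
          proof (cases "y \<in> box a b")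
            case True
            have "eventually (\<lambda>n. y + e n *\<^sub>R z \<in> box a b) sequentially"
              using topological_tendstoD[OF lim open_box True] .
            then show ?thesis by eventually_elim (use True in \<open>simp add: h_def\<close>)
          next
            case False
            then have "y \<in> - cbox a b" using elim by auto
            then have "eventually (\<lambda>n. y + e n *\<^sub>R z \<in> - cbox a b) sequentially"
              by (intro topological_tendstoD[OF lim]) auto
            then show ?thesis
            proof eventually_elim
              case (elim n)
              then have "y + e n *\<^sub>R z \<notin> box a b" using box_subset_cbox[of a b] by auto
              then show ?case using False by (simp add: h_def)
            qed
          qed
          then show "(\<lambda>n. h (y + e n *\<^sub>R z) * complex_of_real (gauss z)) \<longlonglongrightarrow> h y * complex_of_real (gauss z)"
            by (intro tendsto_mult tendsto_eventually tendsto_const)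
        qed
        show "AE z in lborel. norm (h (y + e n *\<^sub>R z) * complex_of_real (gauss z)) \<le> gauss z" for n
          by (intro AE_I2 gb)
      qed (use integrable_gauss in auto)
      also have "(LINT z|(lborel :: 'a measure). h y * complex_of_real (gauss z)) = complex_of_real c * h y"
        by (simp add: c_def integral_gauss[symmetric])
      finally show ?case by (intro tendsto_intros)
    qed
    show "AE y in lborel. norm (K y * H n y) \<le> c * norm (K y)" for n
    proof (rule AE_I2)
      fix y
      have "norm (H n y) \<le> (LINT z|(lborel :: 'a measure). gauss z)" unfolding H_def
        by (rule Bochner_Integration.integral_norm_bound_integral[OF _ integrable_gauss gb])
           (rule Bochner_Integration.integrable_bound[OF integrable_gauss], measurable,
             use gb[of y n] in \<open>auto intro!: AE_I2 order_trans[OF _ abs_ge_self]\<close>)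
      then show "norm (K y * H n y) \<le> c * norm (K y)"
        unfolding norm_mult c_def integral_gauss by (subst mult.commute) (intro mult_right_mono, auto)
    qed
  qed (use int in auto)
  ultimately have "(LINT y|lborel. K y * (complex_of_real c * h y)) = 0"
    by (simp add: LIMSEQ_const_iff)
  then have "complex_of_real c * (LINT y|lborel. h y * K y) = 0"
    by (subst (asm) mult.left_commute) (simp add: mult.commute)
  then show "(LINT x|lborel. indicator (box a b) x * K x) = 0"
    using c0 by (simp add: h_def)
qed

section \<open>Square-integrable functions and their transforms\<close>

lemma integrable_mult_L2:
  fixes F G :: "'a::euclidean_space \<Rightarrow> complex"
  assumes [measurable]: "F \<in> borel_measurable borel" "G \<in> borel_measurable borel"
    and fin: "L2_norm_sq F < \<infinity>" "L2_norm_sq G < \<infinity>"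
  shows "integrable lborel (\<lambda>x. F x * G x)"
proof (rule integrableI_bounded)
  have "(\<integral>\<^sup>+x. ennreal (norm (F x * G x)) \<partial>lborel) \<le> (\<integral>\<^sup>+x. ennreal ((norm (F x))\<^sup>2) + ennreal ((norm (G x))\<^sup>2) \<partial>lborel)"
  proof (rule nn_integral_mono)
    fix x
    have "norm (F x * G x) \<le> (norm (F x))\<^sup>2 + (norm (G x))\<^sup>2"
      using sum_squares_bound[of "norm (F x)" "norm (G x)"] mult_nonneg_nonneg[OF norm_ge_zero norm_ge_zero, of "F x" "G x"] unfolding norm_mult by linarith
    then show "ennreal (norm (F x * G x)) \<le> ennreal ((norm (F x))\<^sup>2) + ennreal ((norm (G x))\<^sup>2)"
      by (simp add: ennreal_plus[symmetric] ennreal_leI del: ennreal_plus)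
  qed
  also have "\<dots> = L2_norm_sq F + L2_norm_sq G" unfolding L2_norm_sq_def by (rule nn_integral_add) measurable
  also have "\<dots> < \<infinity>" using fin by simp
  finally show "(\<integral>\<^sup>+x. ennreal (norm (F x * G x)) \<partial>lborel) < \<infinity>" .
qed measurable

lemma L2_norm_sq_mono: "(\<And>x. norm (F x) \<le> norm (G x)) \<Longrightarrow> L2_norm_sq F \<le> L2_norm_sq G"
  unfolding L2_norm_sq_def by (intro nn_integral_mono ennreal_leI power_mono) auto

lemma L2_norm_sq_cmult:
  fixes F :: "'a::euclidean_space \<Rightarrow> complex"
  assumes [measurable]: "F \<in> borel_measurable borel"
  shows "L2_norm_sq (\<lambda>x. c * F x) = ennreal ((norm c)\<^sup>2) * L2_norm_sq F"
  unfolding L2_norm_sq_def norm_mult power_mult_distrib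
  by (simp add: ennreal_mult' nn_integral_cmult)

lemma ennreal_norm_integral_mult_sq_le:
  fixes F G :: "'a::euclidean_space \<Rightarrow> complex"
  assumes [measurable]: "F \<in> borel_measurable borel" "G \<in> borel_measurable borel"
  shows "(ennreal (norm (LINT x|lborel. F x * G x)))\<^sup>2 \<le> L2_norm_sq F * L2_norm_sq G"
proof -
  have "ennreal (norm (LINT x|lborel. F x * G x)) \<le> (\<integral>\<^sup>+x. ennreal (norm (F x)) * ennreal (norm (G x)) \<partial>lborel)"
    using ennreal_norm_integral_le[of lborel "\<lambda>x. F x * G x"] by (simp add: norm_mult ennreal_mult')
  then have "(ennreal (norm (LINT x|lborel. F x * G x)))\<^sup>2 \<le> (\<integral>\<^sup>+x. ennreal (norm (F x)) * ennreal (norm (G x)) \<partial>lborel)\<^sup>2"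
    by (rule power_mono) simp
  also have "\<dots> \<le> (\<integral>\<^sup>+x. (ennreal (norm (F x)))\<^sup>2 \<partial>lborel) * (\<integral>\<^sup>+x. (ennreal (norm (G x)))\<^sup>2 \<partial>lborel)"
    by (rule Cauchy_Schwarz_nn_integral) auto
  also have "\<dots> = L2_norm_sq F * L2_norm_sq G"
    unfolding L2_norm_sq_def by (simp add: ennreal_power)
  finally show ?thesis .
qed

lemma L2_tail_tendsto_0:
  fixes H :: "'a::euclidean_space \<Rightarrow> complex"
  assumes [measurable]: "H \<in> borel_measurable borel" and fin: "L2_norm_sq H < \<infinity>"
  shows "(\<lambda>n. L2_norm_sq (\<lambda>x. H x * indicator (- ball 0 (real n)) x)) \<longlonglongrightarrow> 0"
proof -
  have "(\<lambda>n. \<integral>\<^sup>+x. ennreal ((norm (H x * indicator (- ball 0 (real n)) x))\<^sup>2) \<partial>lborel) \<longlonglongrightarrow> (\<integral>\<^sup>+x. 0 \<partial>(lborel :: 'a measure))"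
  proof (rule nn_integral_dominated_convergence[where w="\<lambda>x. ennreal ((norm (H x))\<^sup>2)"])
    show "AE x in lborel. (\<lambda>n. ennreal ((norm (H x * indicator (- ball 0 (real n)) x))\<^sup>2)) \<longlonglongrightarrow> 0"
    proof (rule AE_I2, rule tendsto_eventually)
      fix x :: 'a
      obtain m :: nat where "norm x < m" using reals_Archimedean2 by blast
      then show "eventually (\<lambda>n. ennreal ((norm (H x * indicator (- ball 0 (real n)) x))\<^sup>2) = 0) sequentially"
        by (intro eventually_sequentiallyI[of m]) auto
    qed
    show "AE x in lborel. ennreal ((norm (H x * indicator (- ball 0 (real n)) x))\<^sup>2) \<le> ennreal ((norm (H x))\<^sup>2)" for n
      by (auto split: split_indicator)
  qed (use fin in \<open>auto simp: L2_norm_sq_def\<close>)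
  then show ?thesis by (simp add: L2_norm_sq_def)
qed

lemma fourier_diff:
  assumes "integrable lborel f" "integrable lborel g"
  shows "fourier (\<lambda>x. f x - g x) \<xi> = fourier f \<xi> - fourier g \<xi>"
  unfolding fourier_def right_diff_distrib
  by (rule Bochner_Integration.integral_diff) (auto intro!: integrable_modulate assms)

text \<open>The Fourier transform on \<open>L\<^sup>2\<close>: the transforms of the truncations of \<open>H\<close> to balls converge
  almost everywhere along a sequence of radii for which the tails decay geometrically.\<close>
lemma L2_fourier_transform:
  fixes H :: "'a::euclidean_space \<Rightarrow> complex"
  assumes Hm [measurable]: "H \<in> borel_measurable borel" and fin: "L2_norm_sq H < \<infinity>"
  shows "\<exists>G. G \<in> borel_measurable borel \<and> L2_norm_sq G \<le> ennreal ((2 * pi) ^ DIM('a)) * L2_norm_sq H \<and>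
    (\<forall>\<psi>. integrable lborel \<psi> \<and> L2_norm_sq \<psi> < \<infinity> \<longrightarrow>
      integrable lborel (\<lambda>x. H x * fourier \<psi> x) \<and> integrable lborel (\<lambda>x. G x * \<psi> x) \<and>
      (LINT x|lborel. H x * fourier \<psi> x) = (LINT x|lborel. G x * \<psi> x))"
proof -
  define C where "C = (2 * pi) ^ DIM('a)"
  have C: "C > 0" by (simp add: C_def)
  define tail where "tail n = L2_norm_sq (\<lambda>x. H x * indicator (- ball 0 (real n)) x)" for n :: nat
  have "\<exists>n. tail n \<le> ennreal ((1/8) ^ j)" for j
  proof -
    have "eventually (\<lambda>n. tail n < ennreal ((1/8) ^ j)) sequentially"
      unfolding tail_def by (rule order_tendstoD[OF L2_tail_tendsto_0[OF Hm fin]]) simp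
    then show ?thesis by (auto dest!: eventually_happens intro: less_imp_le)
  qed
  then obtain R where R: "\<And>j. tail (R j) \<le> ennreal ((1/8) ^ j)" by metis
  \<comment> \<open>\<open>r\<close> dominates \<open>R\<close>, so the tails keep their bound; it
    is monotone, so later truncations extend earlier ones; and \<open>j \<le> r j\<close> makes the
    balls exhaust the space.\<close>
  define r where "r j = j + (\<Sum>i\<le>j. R i)" for j
  have r: "R j \<le> r j" "i \<le> j \<Longrightarrow> r i \<le> r j" "j \<le> r j" for i j
  proof -
    show "R j \<le> r j" unfolding r_def by (intro trans_le_add2 member_le_sum) auto
    show "r i \<le> r j" if "i \<le> j" unfolding r_def using that by (intro add_mono sum_mono2) auto
  qed (simp add: r_def)
  have tr: "tail (r j) \<le> ennreal ((1/8) ^ j)" for j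
  proof -
    have "tail (r j) \<le> tail (R j)"
      unfolding tail_def by (rule L2_norm_sq_mono) (use r(1)[of j] in \<open>auto split: split_indicator\<close>)
    with R[of j] show ?thesis by simp
  qed
  define Hj where "Hj = (\<lambda>j x. H x * indicator (ball 0 (real (r j))) x)"
  have Hjm [measurable]: "Hj j \<in> borel_measurable borel" for j
    unfolding Hj_def by (intro borel_measurable_times borel_measurable_indicator Hm) simp
  have Hjle: "norm (Hj j x) \<le> norm (H x)" for j x by (auto simp: Hj_def split: split_indicator)
  have Hjint: "integrable lborel (Hj j)" for j
  proof -
    have "L2_norm_sq (\<lambda>x::'a. indicator (ball 0 (real (r j))) x :: complex) = emeasure lborel (ball 0 (real (r j)) :: 'a set)"
    proof -
      have "L2_norm_sq (\<lambda>x::'a. indicator (ball 0 (real (r j))) x :: complex) = (\<integral>\<^sup>+x. indicator (ball 0 (real (r j)) :: 'a set) x \<partial>lborel)"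
        unfolding L2_norm_sq_def by (intro nn_integral_cong) (simp split: split_indicator)
      then show ?thesis by simp
    qed
    also have "\<dots> < \<infinity>" by (simp add: emeasure_ball)
    finally show ?thesis unfolding Hj_def
      by (intro integrable_mult_L2 fin Hm) (auto intro: borel_measurable_indicator)
  qed
  define Gj where "Gj j = fourier (Hj j)" for j
  have Gjm [measurable]: "Gj j \<in> borel_measurable borel" for j unfolding Gj_def by measurable
  have diff: "L2_norm_sq (\<lambda>x. Gj j x - Gj i x) \<le> ennreal (C * (1/8) ^ i)" if "i \<le> j" for i j
  proof -
    have "L2_norm_sq (\<lambda>x. Gj j x - Gj i x) = L2_norm_sq (fourier (\<lambda>x. Hj j x - Hj i x))"
    proof -
      have "fourier (\<lambda>x. Hj j x - Hj i x) = (\<lambda>x. fourier (Hj j) x - fourier (Hj i) x)"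
        by (rule ext) (rule fourier_diff[OF Hjint Hjint])
      then show ?thesis unfolding Gj_def by (simp only:)
    qed
    also have "\<dots> \<le> ennreal C * L2_norm_sq (\<lambda>x. Hj j x - Hj i x)"
      unfolding C_def by (intro L2_norm_sq_fourier_le Bochner_Integration.integrable_diff Hjint)
    also have "\<dots> \<le> ennreal C * tail (r i)"
      unfolding tail_def by (intro mult_left_mono L2_norm_sq_mono) (use r(2)[OF that] in \<open>auto simp: Hj_def split: split_indicator\<close>)
    also have "\<dots> \<le> ennreal C * ennreal ((1/8) ^ i)" by (intro mult_left_mono tr) simp
    also have "\<dots> = ennreal (C * (1/8) ^ i)" using C by (simp add: ennreal_mult')
    finally show ?thesis .
  qed
  define D where "D i x = Gj (Suc i) x - Gj i x" for i x
  have [measurable]: "D i \<in> borel_measurable borel" for i unfolding D_def by measurable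
  \<comment> \<open>The weight \<open>4 ^ i\<close> against the decay \<open>(1/8) ^ i\<close>
    leaves a convergent series. Where the weighted sum is finite, \<open>norm (D i x)\<close> is at
    most a multiple of \<open>(1/2) ^ i\<close>, so the increments are summable.\<close>
  have "(\<integral>\<^sup>+x. (\<Sum>i. ennreal (4 ^ i * (norm (D i x))\<^sup>2)) \<partial>lborel) = (\<Sum>i. \<integral>\<^sup>+x. ennreal (4 ^ i * (norm (D i x))\<^sup>2) \<partial>lborel)"
    by (rule nn_integral_suminf) measurable
  also have "\<dots> \<le> (\<Sum>i. ennreal (C * (1/2) ^ i))"
  proof (intro suminf_le)
    fix i
    have "(\<integral>\<^sup>+x. ennreal (4 ^ i * (norm (D i x))\<^sup>2) \<partial>lborel) = ennreal (4 ^ i) * L2_norm_sq (D i)"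
      unfolding L2_norm_sq_def by (simp add: ennreal_mult' nn_integral_cmult)
    also have "\<dots> \<le> ennreal (4 ^ i) * ennreal (C * (1/8) ^ i)"
      unfolding D_def by (intro mult_left_mono diff) auto
    also have "\<dots> = ennreal (4 ^ i * (C * (1/8) ^ i))" by (simp add: ennreal_mult')
    also have "4 ^ i * (C * (1/8) ^ i) = C * (1/2) ^ i"
      by (simp add: power_mult_distrib[symmetric] mult.left_commute)
    finally show "(\<integral>\<^sup>+x. ennreal (4 ^ i * (norm (D i x))\<^sup>2) \<partial>lborel) \<le> ennreal (C * (1/2) ^ i)" .
  qed auto
  also have "\<dots> < \<infinity>"
    using C by (subst suminf_ennreal_eq[OF _ sums_mult[OF geometric_sums]]) auto
  finally have "AE x in lborel. (\<Sum>i. ennreal (4 ^ i * (norm (D i x))\<^sup>2)) \<noteq> \<infinity>"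
    by (intro nn_integral_PInf_AE) auto
  then have conv: "AE x in lborel. convergent (\<lambda>j. Gj j x)"
  proof eventually_elim
    case (elim x)
    define B where "B = enn2real (\<Sum>i. ennreal (4 ^ i * (norm (D i x))\<^sup>2))"
    have B: "(\<Sum>i. ennreal (4 ^ i * (norm (D i x))\<^sup>2)) = ennreal B" "B \<ge> 0"
    proof -
      have "(\<Sum>i. ennreal (4 ^ i * (norm (D i x))\<^sup>2)) < top"
        using elim unfolding infinity_ennreal_def less_top .
      then show "(\<Sum>i. ennreal (4 ^ i * (norm (D i x))\<^sup>2)) = ennreal B" unfolding B_def by (rule ennreal_enn2real[symmetric])
    qed (simp add: B_def)
    have "norm (D i x) \<le> sqrt B * (1/2) ^ i" for i
    proof -
      have "ennreal (4 ^ i * (norm (D i x))\<^sup>2) \<le> ennreal B"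
      proof -
        define f where "f i = ennreal (4 ^ i * (norm (D i x))\<^sup>2)" for i
        have "sum f {i} \<le> suminf f" by (rule sum_le_suminf) auto
        moreover have "suminf f = ennreal B" unfolding B(1)[symmetric] f_def ..
        ultimately show ?thesis by (simp add: f_def)
      qed
      then have "4 ^ i * (norm (D i x))\<^sup>2 \<le> B" using B(2) by (subst (asm) ennreal_le_iff) auto
      moreover have "(4::real) ^ i = (2 ^ i)\<^sup>2" by (simp add: power2_eq_square power_mult_distrib[symmetric])
      ultimately have "(2 ^ i * norm (D i x))\<^sup>2 \<le> B" by (simp add: power_mult_distrib)
      then have "2 ^ i * norm (D i x) \<le> sqrt B" using real_le_rsqrt by blast
      then show ?thesis by (simp add: power_one_over field_simps)
    qed
    then have "summable (\<lambda>i. D i x)"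
      by (intro summable_comparison_test[where f="\<lambda>i. D i x" and g="\<lambda>i. sqrt B * (1/2) ^ i"] exI[of _ 0] allI impI) (auto intro!: summable_mult summable_geometric)
    then have "convergent (\<lambda>j. \<Sum>i<j. D i x)" by (simp add: summable_iff_convergent)
    then have "convergent (\<lambda>j. Gj j x - Gj 0 x)"
      unfolding D_def sum_lessThan_telescope[of "\<lambda>i. Gj i x"] .
    then have "convergent (\<lambda>j. Gj 0 x + (Gj j x - Gj 0 x))"
      by (intro convergent_add convergent_const)
    then show ?case by simp
  qed
  \<comment> \<open>Where the sequence diverges, the value of \<open>lim\<close> is arbitrary; by
    \<open>conv\<close> this concerns only a null set.\<close>
  define G where "G x = lim (\<lambda>j. Gj j x)" for x
  have Gm [measurable]: "G \<in> borel_measurable borel"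
    unfolding G_def by (rule borel_measurable_lim_metric) measurable
  have lim: "AE x in lborel. (\<lambda>j. Gj j x) \<longlonglongrightarrow> G x"
    using conv by eventually_elim (simp add: G_def convergent_LIMSEQ_iff)
  \<comment> \<open>Used twice: with \<open>F = Gj i\<close> it gives the rate of convergence, with
    \<open>F = 0\<close> the norm bound.\<close>
  have fatou: "L2_norm_sq (\<lambda>x. G x - F x) \<le> B"
    if [measurable]: "F \<in> borel_measurable borel" and ev: "eventually (\<lambda>j. L2_norm_sq (\<lambda>x. Gj j x - F x) \<le> B) sequentially" for F B
  proof -
    have "L2_norm_sq (\<lambda>x. G x - F x) = (\<integral>\<^sup>+x. liminf (\<lambda>j. ennreal ((norm (Gj j x - F x))\<^sup>2)) \<partial>lborel)"
      unfolding L2_norm_sq_def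
    proof (rule nn_integral_cong_AE)
      show "AE x in lborel. ennreal ((norm (G x - F x))\<^sup>2) = liminf (\<lambda>j. ennreal ((norm (Gj j x - F x))\<^sup>2))"
        using lim
      proof eventually_elim
        case (elim x)
        then have "(\<lambda>j. ennreal ((norm (Gj j x - F x))\<^sup>2)) \<longlonglongrightarrow> ennreal ((norm (G x - F x))\<^sup>2)"
          by (intro tendsto_intros tendsto_ennrealI)
        then show ?case by (rule lim_imp_Liminf[OF trivial_limit_sequentially, symmetric])
      qed
    qed
    also have "\<dots> \<le> liminf (\<lambda>j. L2_norm_sq (\<lambda>x. Gj j x - F x))"
      unfolding L2_norm_sq_def by (rule nn_integral_liminf) measurable
    also have "\<dots> \<le> liminf (\<lambda>j. B)" by (rule Liminf_mono[OF ev])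
    also have "\<dots> = B" by (simp add: Liminf_const)
    finally show ?thesis .
  qed
  have Gdiff: "L2_norm_sq (\<lambda>x. G x - Gj i x) \<le> ennreal (C * (1/8) ^ i)" for i
    by (rule fatou) (auto intro!: eventually_sequentiallyI[of i] diff)
  have "L2_norm_sq (\<lambda>x. G x - 0) \<le> ennreal C * L2_norm_sq H"
  proof (rule fatou)
    have "L2_norm_sq (Gj j) \<le> ennreal C * L2_norm_sq H" for j
    proof -
      have "L2_norm_sq (Gj j) \<le> ennreal C * L2_norm_sq (Hj j)"
        unfolding C_def Gj_def by (rule L2_norm_sq_fourier_le[OF Hjint])
      also have "\<dots> \<le> ennreal C * L2_norm_sq H" by (intro mult_left_mono L2_norm_sq_mono Hjle) simp
      finally show ?thesis .
    qed
    then show "eventually (\<lambda>j. L2_norm_sq (\<lambda>x. Gj j x - 0) \<le> ennreal C * L2_norm_sq H) sequentially" by simp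
  qed simp
  then have Gle: "L2_norm_sq G \<le> ennreal C * L2_norm_sq H" by simp
  then have Gfin: "L2_norm_sq G < \<infinity>"
    using fin by (metis (no_types, lifting) ennreal_less_top ennreal_mult_less_top infinity_ennreal_def le_less_trans)
  have "integrable lborel (\<lambda>x. H x * fourier \<psi> x) \<and> integrable lborel (\<lambda>x. G x * \<psi> x) \<and>
      (LINT x|lborel. H x * fourier \<psi> x) = (LINT x|lborel. G x * \<psi> x)"
    if \<psi>: "integrable lborel \<psi>" "L2_norm_sq \<psi> < \<infinity>" for \<psi>
  proof -
    have [measurable]: "\<psi> \<in> borel_measurable borel" using \<psi> by (auto dest: borel_measurable_integrable)
    have "L2_norm_sq (fourier \<psi>) < \<infinity>"
      using L2_norm_sq_fourier_le[OF \<psi>(1)] \<psi>(2) by (metis (no_types, lifting) ennreal_less_top ennreal_mult_less_top infinity_ennreal_def le_less_trans)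
    then have i1: "integrable lborel (\<lambda>x. H x * fourier \<psi> x)" by (intro integrable_mult_L2 fin) measurable
    have i2: "integrable lborel (\<lambda>x. G x * \<psi> x)" by (intro integrable_mult_L2 Gfin \<psi>) measurable
    have "(\<lambda>j. LINT x|lborel. Hj j x * fourier \<psi> x) \<longlonglongrightarrow> (LINT x|lborel. H x * fourier \<psi> x)"
    proof (rule integral_dominated_convergence[where w="\<lambda>x. norm (H x * fourier \<psi> x)"])
      show "AE x in lborel. norm (Hj j x * fourier \<psi> x) \<le> norm (H x * fourier \<psi> x)" for j
        using Hjle by (auto simp: norm_mult intro!: AE_I2 mult_right_mono)
      show "AE x in lborel. (\<lambda>j. Hj j x * fourier \<psi> x) \<longlonglongrightarrow> H x * fourier \<psi> x"
      proof (intro AE_I2 tendsto_mult tendsto_const tendsto_eventually)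
        fix x :: 'a
        obtain m :: nat where m: "norm x < m" using reals_Archimedean2 by blast
        show "eventually (\<lambda>j. Hj j x = H x) sequentially"
        proof (rule eventually_sequentiallyI[of m])
          fix j assume "m \<le> j"
          then have "norm x < real (r j)" using r(3)[of j] m by linarith
          then show "Hj j x = H x" by (simp add: Hj_def)
        qed
      qed
    qed (use i1 in auto)
    \<comment> \<open>The truncations are integrable, so the multiplication formula turns the left
      side into an integral of \<open>Gj j * \<psi>\<close>. Cauchy-Schwarz and \<open>Gdiff\<close>
      give the limit, as there is no pointwise majorant of the \<open>Gj j\<close> at hand.\<close>
    moreover have "(\<lambda>j. LINT x|lborel. Hj j x * fourier \<psi> x) \<longlonglongrightarrow> (LINT x|lborel. G x * \<psi> x)"
    proof -
      define b where "b = enn2real (L2_norm_sq \<psi>)"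
      have b: "L2_norm_sq \<psi> = ennreal b" "b \<ge> 0"
        using ennreal_enn2real[of "L2_norm_sq \<psi>"] \<psi>(2) unfolding b_def infinity_ennreal_def by auto
      define X where "X j = norm ((LINT x|lborel. G x * \<psi> x) - (LINT x|lborel. Hj j x * fourier \<psi> x))" for j
      have "(X j)\<^sup>2 \<le> C * b * (1/8) ^ j" for j
      proof -
        have "integrable lborel (\<lambda>x. Gj j x * \<psi> x)"
        proof (rule integrable_mult_L2)
          have "L2_norm_sq (Gj j) \<le> ennreal C * L2_norm_sq (Hj j)"
            unfolding C_def Gj_def by (rule L2_norm_sq_fourier_le[OF Hjint])
          also have "\<dots> \<le> ennreal C * L2_norm_sq H" by (intro mult_left_mono L2_norm_sq_mono Hjle) simp
          also have "\<dots> < \<infinity>" using fin by (simp add: ennreal_mult_less_top)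
          finally show "L2_norm_sq (Gj j) < \<infinity>" .
        qed (use \<psi> in auto)
        then have "(LINT x|lborel. G x * \<psi> x) - (LINT x|lborel. Hj j x * fourier \<psi> x) = (LINT x|lborel. (G x - Gj j x) * \<psi> x)"
          unfolding fourier_multiplication_formula[OF Hjint \<psi>(1)] left_diff_distrib Gj_def[symmetric]
          by (subst Bochner_Integration.integral_diff) (use i2 in auto)
        then have "ennreal ((X j)\<^sup>2) = (ennreal (norm (LINT x|lborel. (G x - Gj j x) * \<psi> x)))\<^sup>2"
          by (simp add: X_def ennreal_power)
        also have "\<dots> \<le> L2_norm_sq (\<lambda>x. G x - Gj j x) * L2_norm_sq \<psi>"
          by (rule ennreal_norm_integral_mult_sq_le) measurable
        also have "\<dots> \<le> ennreal (C * (1/8) ^ j) * ennreal b" unfolding b(1) by (intro mult_right_mono Gdiff) simp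
        also have "\<dots> = ennreal (C * b * (1/8) ^ j)" using C b(2) by (simp add: ennreal_mult[symmetric] mult_ac)
        finally show ?thesis using C b(2) by (subst (asm) ennreal_le_iff) auto
      qed
      moreover have "(\<lambda>j. C * b * (1/8) ^ j) \<longlonglongrightarrow> C * b * 0"
        by (intro tendsto_intros LIMSEQ_power_zero) simp
      ultimately have "(\<lambda>j. (X j)\<^sup>2) \<longlonglongrightarrow> 0"
        by (intro real_tendsto_sandwich[of "\<lambda>j. 0" "\<lambda>j. (X j)\<^sup>2" sequentially "\<lambda>j. C * b * (1/8) ^ j"]) auto
      then have "(\<lambda>j. sqrt ((X j)\<^sup>2)) \<longlonglongrightarrow> sqrt 0" by (rule tendsto_real_sqrt)
      then have "X \<longlonglongrightarrow> 0" by (simp add: X_def[abs_def])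
      then have "(\<lambda>j. (LINT x|lborel. G x * \<psi> x) - (LINT x|lborel. Hj j x * fourier \<psi> x)) \<longlonglongrightarrow> 0"
        unfolding X_def by (rule tendsto_norm_zero_cancel)
      from tendsto_diff[OF tendsto_const[of "LINT x|lborel. G x * \<psi> x"] this] show ?thesis by simp
    qed
    ultimately show ?thesis using i1 i2 LIMSEQ_unique by blast
  qed
  then show ?thesis using Gle unfolding C_def by (intro exI[of _ G]) auto
qed

section \<open>Reflection and the inverse transform on square-integrable functions\<close>

lemma lborel_integral_uminus:
  fixes f :: "'a::euclidean_space \<Rightarrow> complex"
  assumes [measurable]: "f \<in> borel_measurable borel"
  shows "(LINT x|lborel. f (- x)) = (LINT x|lborel. f x)"
  using lborel_integral_affine[of "-1" f 0] by simp

lemma lborel_integrable_uminus: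
  fixes f :: "'a::euclidean_space \<Rightarrow> complex"
  shows "integrable lborel f \<Longrightarrow> integrable lborel (\<lambda>x. f (- x))"
  using lborel_integrable_affine[of "-1" f 0] by simp

lemma L2_norm_sq_uminus:
  fixes f :: "'a::euclidean_space \<Rightarrow> complex"
  assumes [measurable]: "f \<in> borel_measurable borel"
  shows "L2_norm_sq (\<lambda>x. f (- x)) = L2_norm_sq f"
proof -
  have "L2_norm_sq f = (\<integral>\<^sup>+x. ennreal ((norm (f x))\<^sup>2) \<partial>distr lborel borel uminus)"
    unfolding L2_norm_sq_def
    by (subst lborel_affine[of "-1" "0 :: 'a"]) (simp_all add: density_1)
  also have "\<dots> = L2_norm_sq (\<lambda>x. f (- x))"
    unfolding L2_norm_sq_def by (subst nn_integral_distr) auto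
  finally show ?thesis ..
qed

lemma fourier_uminus:
  assumes [measurable]: "f \<in> borel_measurable borel"
  shows "fourier (\<lambda>x. f (- x)) \<xi> = fourier f (- \<xi>)"
  unfolding fourier_def
  by (subst lborel_integral_uminus[symmetric]) (auto simp: inner_minus_left)

text \<open>Exactly the hypotheses of \<open>fourier_inversion\<close>. Duality identities are
  verified on this class, which contains the Schwartz functions and asks for no derivatives.\<close>

definition test_function :: "('a::euclidean_space \<Rightarrow> complex) \<Rightarrow> bool" where
  "test_function \<psi> \<longleftrightarrow> integrable lborel \<psi> \<and> integrable lborel (fourier \<psi>) \<and>
     continuous_on UNIV \<psi> \<and> (\<exists>B. \<forall>x. norm (\<psi> x) \<le> B)"

lemma L2_norm_sq_bounded_finite:
  fixes F :: "'a::euclidean_space \<Rightarrow> complex"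
  assumes int: "integrable lborel F" and B: "\<And>x. norm (F x) \<le> B"
  shows "L2_norm_sq F < \<infinity>"
proof -
  have [measurable]: "F \<in> borel_measurable borel" using int by (auto dest: borel_measurable_integrable)
  have B0: "B \<ge> 0" using norm_ge_zero B order_trans by blast
  have "L2_norm_sq F \<le> (\<integral>\<^sup>+x. ennreal B * ennreal (norm (F x)) \<partial>lborel)"
    unfolding L2_norm_sq_def using B B0
    by (intro nn_integral_mono) (simp add: ennreal_mult'[symmetric] power2_eq_square mult_right_mono ennreal_leI)
  also have "\<dots> = ennreal B * (\<integral>\<^sup>+x. ennreal (norm (F x)) \<partial>lborel)" by (rule nn_integral_cmult) measurable
  also have "\<dots> < \<infinity>" using int by (simp add: integrable_iff_bounded ennreal_mult_less_top)
  finally show ?thesis .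
qed

lemma test_function_L2:
  assumes "test_function \<psi>"
  shows "L2_norm_sq \<psi> < \<infinity>" "L2_norm_sq (fourier \<psi>) < \<infinity>"
  using assms norm_fourier_le[of \<psi>] unfolding test_function_def by (blast intro: L2_norm_sq_bounded_finite)+

lemma test_function_double_fourier:
  fixes \<psi> :: "'a::euclidean_space \<Rightarrow> complex"
  assumes \<psi>: "test_function \<psi>"
  shows "fourier (\<lambda>p. fourier \<psi> (- p)) q = complex_of_real ((2 * pi) ^ DIM('a)) * \<psi> q"
proof -
  have [measurable]: "\<psi> \<in> borel_measurable borel" using \<psi> by (auto simp: test_function_def dest: borel_measurable_integrable)
  obtain B where B: "\<And>x. norm (\<psi> x) \<le> B" using \<psi> by (auto simp: test_function_def)
  show ?thesis
    by (subst fourier_uminus, measurable) (rule fourier_inversion[of \<psi> B], use \<psi> B in \<open>auto simp: test_function_def\<close>)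
qed

lemma integrable_cancel_cmult:
  fixes f :: "'a \<Rightarrow> complex"
  assumes "c \<noteq> 0" "integrable M (\<lambda>x. c * f x)"
  shows "integrable M f"
proof -
  have "integrable M (\<lambda>x. (1 / c) * (c * f x))" by (intro integrable_mult_right assms(2))
  moreover have "(\<lambda>x. (1 / c) * (c * f x)) = f" using assms(1) by auto
  ultimately show ?thesis by (simp only:)
qed

text \<open>The forward transform of \<open>G\<close>, reflected and divided by
  \<open>(2 * pi) ^ DIM('a)\<close>. To check it against \<open>\<psi>\<close>, the forward identity
  is applied to the reflected transform of \<open>\<psi>\<close>, which inversion turns back into a
  multiple of \<open>\<psi>\<close>.\<close>

lemma L2_inverse_fourier_transform:
  fixes G :: "'a::euclidean_space \<Rightarrow> complex"
  assumes Gm [measurable]: "G \<in> borel_measurable borel" and fin: "L2_norm_sq G < \<infinity>"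
  shows "\<exists>H. H \<in> borel_measurable borel \<and> ennreal ((2 * pi) ^ DIM('a)) * L2_norm_sq H \<le> L2_norm_sq G \<and>
    (\<forall>\<psi>. test_function \<psi> \<longrightarrow>
      integrable lborel (\<lambda>x. H x * fourier \<psi> x) \<and> integrable lborel (\<lambda>x. G x * \<psi> x) \<and>
      (LINT x|lborel. H x * fourier \<psi> x) = (LINT x|lborel. G x * \<psi> x))"
proof -
  define C where "C = (2 * pi) ^ DIM('a)"
  have C: "C > 0" by (simp add: C_def)
  obtain K where Km [measurable]: "K \<in> borel_measurable borel" and K: "L2_norm_sq K \<le> ennreal C * L2_norm_sq G"
    and eq: "\<And>\<psi>. integrable lborel \<psi> \<Longrightarrow> L2_norm_sq \<psi> < \<infinity> \<Longrightarrow>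
      integrable lborel (\<lambda>x. G x * fourier \<psi> x) \<and> integrable lborel (\<lambda>x. K x * \<psi> x) \<and>
      (LINT x|lborel. G x * fourier \<psi> x) = (LINT x|lborel. K x * \<psi> x)"
    using L2_fourier_transform[OF Gm fin] unfolding C_def by blast
  define H where "H p = complex_of_real (1 / C) * K (- p)" for p
  have Hm: "H \<in> borel_measurable borel" unfolding H_def[abs_def] by measurable
  have "ennreal C * L2_norm_sq H = ennreal C * (ennreal ((1 / C)\<^sup>2) * L2_norm_sq K)"
    unfolding H_def by (subst L2_norm_sq_cmult) (use C in \<open>auto simp: L2_norm_sq_uminus norm_divide\<close>)
  also have "\<dots> \<le> ennreal C * (ennreal ((1 / C)\<^sup>2) * (ennreal C * L2_norm_sq G))"
    by (intro mult_left_mono K) auto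
  also have "\<dots> = ennreal (C * ((1 / C)\<^sup>2 * C)) * L2_norm_sq G"
    using C by (simp add: ennreal_mult mult.assoc)
  also have "C * ((1 / C)\<^sup>2 * C) = 1" using C by (simp add: power2_eq_square)
  finally have le: "ennreal C * L2_norm_sq H \<le> L2_norm_sq G" by simp
  have "integrable lborel (\<lambda>x. H x * fourier \<psi> x) \<and> integrable lborel (\<lambda>x. G x * \<psi> x) \<and>
      (LINT x|lborel. H x * fourier \<psi> x) = (LINT x|lborel. G x * \<psi> x)" if \<psi>: "test_function \<psi>" for \<psi>
  proof -
    have [measurable]: "\<psi> \<in> borel_measurable borel" using \<psi> by (auto simp: test_function_def dest: borel_measurable_integrable)
    define \<theta> where "\<theta> p = fourier \<psi> (- p)" for p
    have \<theta>: "integrable lborel \<theta>" using \<psi> unfolding \<theta>_def test_function_def by (intro lborel_integrable_uminus) simp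
    have \<theta>2: "L2_norm_sq \<theta> < \<infinity>"
      unfolding \<theta>_def by (subst L2_norm_sq_uminus) (use test_function_L2[OF \<psi>] in auto)
    have F\<theta>: "fourier \<theta> q = complex_of_real C * \<psi> q" for q
      unfolding \<theta>_def C_def by (rule test_function_double_fourier[OF \<psi>])
    note e = eq[OF \<theta> \<theta>2, unfolded F\<theta>]
    have K\<theta>: "K (- p) * \<theta> (- p) = complex_of_real C * (H p * fourier \<psi> p)" for p
      using C by (simp add: H_def \<theta>_def)
    have "integrable lborel (\<lambda>p. complex_of_real C * (H p * fourier \<psi> p))"
      unfolding K\<theta>[symmetric] using e by (intro lborel_integrable_uminus[of "\<lambda>p. K p * \<theta> p"]) simp
    then have i1: "integrable lborel (\<lambda>p. H p * fourier \<psi> p)"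
      by (rule integrable_cancel_cmult[rotated]) (use C in simp)
    have "integrable lborel (\<lambda>x. complex_of_real (1 / C) * (G x * (complex_of_real C * \<psi> x)))"
      using e by (intro integrable_mult_right) simp
    moreover have "complex_of_real (1 / C) * (G x * (complex_of_real C * \<psi> x)) = G x * \<psi> x" for x using C by simp
    ultimately have i2: "integrable lborel (\<lambda>x. G x * \<psi> x)" by (simp only:)
    have "complex_of_real C * (LINT x|lborel. G x * \<psi> x) = (LINT x|lborel. G x * (complex_of_real C * \<psi> x))"
      by (subst integral_mult_right_zero[symmetric]) (simp add: mult.left_commute)
    also have "\<dots> = (LINT x|lborel. K x * \<theta> x)" using e by simp
    also have "\<dots> = (LINT x|lborel. K (- x) * \<theta> (- x))"
      by (rule lborel_integral_uminus[symmetric]) (use \<theta> in \<open>auto dest: borel_measurable_integrable\<close>)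
    also have "\<dots> = complex_of_real C * (LINT x|lborel. H x * fourier \<psi> x)"
      unfolding K\<theta> by (rule integral_mult_right_zero)
    finally show ?thesis using i1 i2 C by simp
  qed
  then show ?thesis using Hm le unfolding C_def by blast
qed

section \<open>Schwartz functions\<close>

text \<open>A product over the coordinates, hence integrable by Fubini, yet bounded below by the
  power \<open>- 2 * DIM('a)\<close> of \<open>1 + norm x\<close>. It is the majorant wherever a
  decay rate has to yield integrability.\<close>

definition weight :: "'a::euclidean_space \<Rightarrow> real" where
  "weight x = (\<Prod>b\<in>Basis. 1 / (1 + (x \<bullet> b)\<^sup>2))"

lemma integrable_one_over_1_plus_square: "integrable lborel (\<lambda>x::real. 1 / (1 + x\<^sup>2))"
  using integrable_inverse_1_plus_square by (simp add: set_integrable_def inverse_eq_divide)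

lemma integrable_weight: "integrable lborel (weight :: 'a::euclidean_space \<Rightarrow> real)"
proof -
  have "integrable lborel (\<lambda>x::'a. \<Prod>b\<in>Basis. complex_of_real (1 / (1 + (x \<bullet> b)\<^sup>2)))"
    by (rule lborel_prod_Basis(1)[where f="\<lambda>b t. complex_of_real (1 / (1 + t\<^sup>2))"])
      (intro integrable_of_real integrable_one_over_1_plus_square)
  then have "integrable lborel (\<lambda>x::'a. complex_of_real (weight x))"
    unfolding weight_def of_real_prod .
  then show ?thesis by (simp only: complex_of_real_integrable_eq)
qed

lemma weight_pos: "weight x > 0"
  unfolding weight_def by (intro prod_pos) (auto simp: add_pos_nonneg)

lemma weight_ge: "1 \<le> weight (x :: 'a::euclidean_space) * (1 + norm x) ^ (2 * DIM('a))"
proof -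
  have "(\<Prod>b\<in>Basis. 1 + (x \<bullet> b)\<^sup>2) \<le> (\<Prod>b\<in>(Basis::'a set). (1 + norm x)\<^sup>2)"
  proof (rule prod_mono)
    fix b :: 'a assume b: "b \<in> Basis"
    have "\<bar>x \<bullet> b\<bar> \<le> norm x" using Basis_le_norm[OF b] .
    then have "(x \<bullet> b)\<^sup>2 \<le> (norm x)\<^sup>2" by (rule abs_le_square_iff[THEN iffD1, of "x \<bullet> b" "norm x", simplified])
    moreover have "(1 + norm x)\<^sup>2 = 1 + 2 * norm x + (norm x)\<^sup>2" by (simp add: power2_sum)
    ultimately show "0 \<le> 1 + (x \<bullet> b)\<^sup>2 \<and> 1 + (x \<bullet> b)\<^sup>2 \<le> (1 + norm x)\<^sup>2"
      using norm_ge_zero[of x] zero_le_power2[of "x \<bullet> b"] by linarith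
  qed
  also have "\<dots> = (1 + norm x) ^ (2 * DIM('a))" by (simp add: power_mult)
  finally have "(\<Prod>b\<in>Basis. 1 + (x \<bullet> b)\<^sup>2) \<le> (1 + norm x) ^ (2 * DIM('a))" .
  moreover have "(\<Prod>b\<in>Basis. 1 + (x \<bullet> b)\<^sup>2) > 0" by (intro prod_pos) (auto simp: add_pos_nonneg)
  ultimately show ?thesis by (simp add: weight_def prod_dividef field_simps)
qed

lemma one_plus_power_le: "(r::real) \<ge> 0 \<Longrightarrow> (1 + r) ^ k \<le> 2 ^ k * (1 + r ^ k)"
proof (cases "r \<le> 1")
  case True
  assume "r \<ge> 0"
  then have "(1 + r) ^ k \<le> 2 ^ k" using True by (intro power_mono) auto
  also have "\<dots> \<le> 2 ^ k * (1 + r ^ k)" using \<open>r \<ge> 0\<close> by simp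
  finally show ?thesis .
next
  case False
  assume "r \<ge> 0"
  then have "(1 + r) ^ k \<le> (2 * r) ^ k" using False by (intro power_mono) auto
  also have "\<dots> \<le> 2 ^ k * (1 + r ^ k)" by (simp add: power_mult_distrib)
  finally show ?thesis .
qed

section \<open>Decay of Schwartz functions and of their transforms\<close>

lemma schwartz_dir_deriv: "schwartz f \<Longrightarrow> schwartz (dir_deriv v f)"
  unfolding schwartz_def
proof
  fix vs
  assume "\<forall>vs. foldr dir_deriv vs f differentiable_on UNIV \<and> (\<forall>k::nat. \<exists>B. \<forall>x. norm x ^ k * norm (foldr dir_deriv vs f x) \<le> B)"
  \<comment> \<open>\<open>foldr\<close> applies the last entry of the list first, so appending
    \<open>v\<close> differentiates in direction \<open>v\<close> before all the others.\<close>
  from spec[OF this, of "vs @ [v]"]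
  show "foldr dir_deriv vs (dir_deriv v f) differentiable_on UNIV \<and> (\<forall>k::nat. \<exists>B. \<forall>x. norm x ^ k * norm (foldr dir_deriv vs (dir_deriv v f) x) \<le> B)"
    by simp
qed

lemma schwartz_differentiable: "schwartz f \<Longrightarrow> f differentiable (at x)"
  unfolding schwartz_def by (metis UNIV_I differentiable_on_def foldr.simps(1) id_apply)

lemma schwartz_continuous: "schwartz f \<Longrightarrow> continuous_on UNIV f"
  by (simp add: schwartz_differentiable differentiable_imp_continuous_within continuous_at_imp_continuous_on)

lemma schwartz_measurable: "schwartz f \<Longrightarrow> f \<in> borel_measurable borel"
  by (intro borel_measurable_continuous_onI schwartz_continuous)

lemma schwartz_decay:
  assumes "schwartz f"
  shows "\<exists>C\<ge>0. \<forall>x. norm (f x) * (1 + norm x) ^ k \<le> C"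
proof -
  have "\<exists>B. \<forall>x. norm x ^ k * norm (f x) \<le> B" for k
    using assms unfolding schwartz_def by (metis foldr.simps(1) id_apply)
  then obtain B where B: "\<And>k x. norm x ^ k * norm (f x) \<le> B k" by metis
  have "norm (f x) * (1 + norm x) ^ k \<le> 2 ^ k * (B 0 + B k)" for x
  proof -
    have "norm (f x) * (1 + norm x) ^ k \<le> norm (f x) * (2 ^ k * (1 + norm x ^ k))"
      by (intro mult_left_mono one_plus_power_le) auto
    also have "\<dots> = 2 ^ k * (norm x ^ 0 * norm (f x) + norm x ^ k * norm (f x))" by (simp add: algebra_simps)
    also have "\<dots> \<le> 2 ^ k * (B 0 + B k)" by (intro mult_left_mono add_mono B) auto
    finally show ?thesis .
  qed
  moreover have "0 \<le> 2 ^ k * (B 0 + B k)"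
    using order_trans[OF _ calculation[of 0]] by simp
  ultimately show ?thesis by blast
qed

lemma schwartz_le_weight:
  fixes f :: "'a::euclidean_space \<Rightarrow> complex"
  assumes "schwartz f"
  shows "\<exists>C\<ge>0. \<forall>x. norm (f x) \<le> C * weight x"
proof -
  obtain C where C: "C \<ge> 0" "\<And>x. norm (f x) * (1 + norm x) ^ (2 * DIM('a)) \<le> C"
    using schwartz_decay[OF assms] by blast
  have "norm (f x) \<le> C * weight x" for x
  proof -
    have "norm (f x) * 1 \<le> norm (f x) * (weight x * (1 + norm x) ^ (2 * DIM('a)))"
      by (intro mult_left_mono weight_ge) auto
    also have "\<dots> = (norm (f x) * (1 + norm x) ^ (2 * DIM('a))) * weight x" by simp
    also have "\<dots> \<le> C * weight x" using weight_pos[of x] by (intro mult_right_mono C) auto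
    finally show ?thesis by simp
  qed
  then show ?thesis using C by blast
qed

lemma schwartz_integrable:
  fixes f :: "'a::euclidean_space \<Rightarrow> complex"
  assumes "schwartz f"
  shows "integrable lborel f"
proof -
  obtain C where C: "C \<ge> 0" "\<And>x. norm (f x) \<le> C * weight x" using schwartz_le_weight[OF assms] by blast
  show ?thesis
  proof (rule Bochner_Integration.integrable_bound)
    show "integrable lborel (\<lambda>x::'a. C * weight x)" by (intro integrable_mult_right integrable_weight)
    show "f \<in> borel_measurable lborel" using schwartz_measurable[OF assms] by simp
    show "AE x in lborel. norm (f x) \<le> norm (C * weight x)"
      using C(2) by (intro AE_I2) (auto intro: order_trans[OF _ abs_ge_self])
  qed
qed

lemma fourier_translate:
  fixes f :: "'a::euclidean_space \<Rightarrow> complex"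
  assumes [measurable]: "f \<in> borel_measurable borel"
  shows "fourier (\<lambda>x. f (a + x)) \<xi> = exp (\<i> * complex_of_real (a \<bullet> \<xi>)) * fourier f \<xi>"
proof -
  have "fourier f \<xi> = (LINT x|lborel. exp (- (\<i> * complex_of_real ((a + x) \<bullet> \<xi>))) * f (a + x))"
    unfolding fourier_def by (subst lborel_integral_affine[of 1 _ a]) auto
  also have "\<dots> = (LINT x|lborel. exp (- (\<i> * complex_of_real (a \<bullet> \<xi>))) * (exp (- (\<i> * complex_of_real (x \<bullet> \<xi>))) * f (a + x)))"
  proof (intro Bochner_Integration.integral_cong refl)
    fix x
    have "exp (- (\<i> * complex_of_real ((a + x) \<bullet> \<xi>))) = exp (- (\<i> * complex_of_real (a \<bullet> \<xi>))) * exp (- (\<i> * complex_of_real (x \<bullet> \<xi>)))"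
      by (simp add: inner_add_left distrib_left exp_add[symmetric])
    then show "exp (- (\<i> * complex_of_real ((a + x) \<bullet> \<xi>))) * f (a + x) = exp (- (\<i> * complex_of_real (a \<bullet> \<xi>))) * (exp (- (\<i> * complex_of_real (x \<bullet> \<xi>))) * f (a + x))"
      by (simp only: mult.assoc)
  qed
  also have "\<dots> = exp (- (\<i> * complex_of_real (a \<bullet> \<xi>))) * fourier (\<lambda>x. f (a + x)) \<xi>"
    unfolding fourier_def by (rule integral_mult_right_zero)
  finally show ?thesis by (simp add: exp_minus)
qed

lemma schwartz_has_vector_derivative_line:
  fixes g :: "'a::euclidean_space \<Rightarrow> complex"
  assumes "schwartz g"
  shows "((\<lambda>t. g (x + t *\<^sub>R b)) has_vector_derivative dir_deriv b g (x + t *\<^sub>R b)) (at t)"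
proof -
  let ?D = "frechet_derivative g (at (x + t *\<^sub>R b))"
  have D: "(g has_derivative ?D) (at (x + t *\<^sub>R b))"
    using schwartz_differentiable[OF assms] frechet_derivative_works by blast
  have "((\<lambda>t. x + t *\<^sub>R b) has_derivative (\<lambda>h. h *\<^sub>R b)) (at t)" by (auto intro!: derivative_eq_intros)
  from diff_chain_at[OF this D]
  have "((\<lambda>t. g (x + t *\<^sub>R b)) has_derivative (\<lambda>h. ?D (h *\<^sub>R b))) (at t)" by (simp add: o_def)
  moreover have "?D (h *\<^sub>R b) = h *\<^sub>R ?D b" for h
    using has_derivative_linear[OF D] by (simp add: linear_cmul)
  ultimately show ?thesis by (simp add: has_vector_derivative_def dir_deriv_def)
qed

text \<open>Difference quotients take the place of integration by parts. Translation multiplies the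
  transform by an exponential, whose difference quotient tends to
  \<open>\<i> * (b \<bullet> \<xi>)\<close>, while the quotients of \<open>g\<close> converge under
  an integrable majorant supplied by the mean value inequality.\<close>

lemma fourier_dir_deriv:
  fixes g :: "'a::euclidean_space \<Rightarrow> complex"
  assumes g: "schwartz g" and b: "b \<in> Basis"
  shows "fourier (dir_deriv b g) \<xi> = \<i> * complex_of_real (b \<bullet> \<xi>) * fourier g \<xi>"
proof -
  have gm [measurable]: "g \<in> borel_measurable borel" using g by (rule schwartz_measurable)
  have dg: "schwartz (dir_deriv b g)" using g by (rule schwartz_dir_deriv)
  have dgm [measurable]: "dir_deriv b g \<in> borel_measurable borel" using dg by (rule schwartz_measurable)
  let ?k = "2 * DIM('a)"
  obtain C where C: "C \<ge> 0" "\<And>x. norm (dir_deriv b g x) * (1 + norm x) ^ ?k \<le> C" using schwartz_decay[OF dg] by blast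
  have nb: "norm b = 1" using b by simp
  \<comment> \<open>A shift by at most one unit changes \<open>1 + norm x\<close> by a factor of at
    most 2, so the decay of the derivative is uniform along the segment.\<close>
  have line: "norm (dir_deriv b g (x + t *\<^sub>R b)) \<le> C * 2 ^ ?k * weight x" if "t \<in> {0..1}" for x t
  proof -
    have "norm x \<le> norm (x + t *\<^sub>R b) + norm (t *\<^sub>R b)" by (metis add_diff_cancel norm_triangle_ineq4)
    moreover have "norm (t *\<^sub>R b) \<le> 1" using that nb by simp
    ultimately have "norm x \<le> norm (x + t *\<^sub>R b) + 1" by (rule order_trans[OF _ add_left_mono])
    moreover have "norm (x + t *\<^sub>R b) \<ge> 0" by (rule norm_ge_zero)
    moreover have "1 + p \<le> 2 * (1 + q)" if "p \<le> q + 1" "0 \<le> q" for p q :: real using that by simp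
    ultimately have le: "1 + norm x \<le> 2 * (1 + norm (x + t *\<^sub>R b))" by blast
    have "norm (dir_deriv b g (x + t *\<^sub>R b)) * 1 \<le> norm (dir_deriv b g (x + t *\<^sub>R b)) * (weight x * (1 + norm x) ^ ?k)"
      by (intro mult_left_mono weight_ge) auto
    also have "\<dots> \<le> norm (dir_deriv b g (x + t *\<^sub>R b)) * (weight x * (2 * (1 + norm (x + t *\<^sub>R b))) ^ ?k)"
      using le weight_pos[of x] by (intro mult_left_mono power_mono) auto
    also have "\<dots> = (norm (dir_deriv b g (x + t *\<^sub>R b)) * (1 + norm (x + t *\<^sub>R b)) ^ ?k) * (2 ^ ?k * weight x)"
      by (simp only: power_mult_distrib mult_ac)
    also have "\<dots> \<le> C * (2 ^ ?k * weight x)" using weight_pos[of x] by (intro mult_right_mono C) auto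
    finally show ?thesis by (simp only: mult_1_right mult.assoc)
  qed
  define h where "h n = 1 / real (Suc n)" for n
  have h: "h n > 0" "h n \<le> 1" for n by (auto simp: h_def)
  have h0: "h \<longlonglongrightarrow> 0" unfolding h_def by (rule LIMSEQ_inverse_real_of_nat[unfolded inverse_eq_divide])
  have hfl: "filterlim h (at 0) sequentially"
    using h0 h(1) by (auto simp: filterlim_at intro!: always_eventually) (metis less_irrefl)
  define Q where "Q n x = (g (h n *\<^sub>R b + x) - g x) /\<^sub>R h n" for n x
  have Qm [measurable]: "Q n \<in> borel_measurable borel" for n unfolding Q_def by measurable
  have Qlim: "(\<lambda>n. Q n x) \<longlonglongrightarrow> dir_deriv b g x" for x
  proof -
    have "((\<lambda>t. (g (x + t *\<^sub>R b) - g x) /\<^sub>R t) \<longlongrightarrow> dir_deriv b g x) (at 0)"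
    proof (rule LIM_zero_cancel, rule tendsto_norm_zero_cancel)
      have "((\<lambda>t. norm (g (x + t *\<^sub>R b) - g x - t *\<^sub>R dir_deriv b g x) / norm t) \<longlongrightarrow> 0) (at 0)"
        using schwartz_has_vector_derivative_line[OF g, of x b 0]
        by (simp add: has_vector_derivative_def has_derivative_at)
      moreover have "eventually (\<lambda>t. norm (g (x + t *\<^sub>R b) - g x - t *\<^sub>R dir_deriv b g x) / norm t
          = norm ((g (x + t *\<^sub>R b) - g x) /\<^sub>R t - dir_deriv b g x)) (at (0::real))"
        unfolding eventually_at_filter
      proof (intro always_eventually allI impI)
        fix t :: real assume t: "t \<noteq> 0"
        have "g (x + t *\<^sub>R b) - g x - t *\<^sub>R dir_deriv b g x = t *\<^sub>R ((g (x + t *\<^sub>R b) - g x) /\<^sub>R t - dir_deriv b g x)"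
          using t by (simp add: scaleR_diff_right)
        then show "norm (g (x + t *\<^sub>R b) - g x - t *\<^sub>R dir_deriv b g x) / norm t
          = norm ((g (x + t *\<^sub>R b) - g x) /\<^sub>R t - dir_deriv b g x)" using t by simp
      qed
      ultimately show "((\<lambda>t. norm ((g (x + t *\<^sub>R b) - g x) /\<^sub>R t - dir_deriv b g x)) \<longlongrightarrow> 0) (at 0)"
        by (rule Lim_transform_eventually)
    qed
    from filterlim_compose[OF this hfl] show ?thesis unfolding Q_def by (simp add: add.commute)
  qed
  have Qb: "norm (Q n x) \<le> C * 2 ^ ?k * weight x" for n x
  proof -
    have "norm (g (x + h n *\<^sub>R b) - g (x + 0 *\<^sub>R b)) \<le> (C * 2 ^ ?k * weight x) * norm (h n - 0)"
    proof (rule differentiable_bound[of "{0..1}" "\<lambda>t. g (x + t *\<^sub>R b)" "\<lambda>t r. r *\<^sub>R dir_deriv b g (x + t *\<^sub>R b)"])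
      show "((\<lambda>t. g (x + t *\<^sub>R b)) has_derivative (\<lambda>r. r *\<^sub>R dir_deriv b g (x + t *\<^sub>R b))) (at t within {0..1})" for t
        using schwartz_has_vector_derivative_line[OF g, of x b t] unfolding has_vector_derivative_def by (rule has_derivative_at_withinI)
      show "onorm (\<lambda>r. r *\<^sub>R dir_deriv b g (x + t *\<^sub>R b)) \<le> C * 2 ^ ?k * weight x" if "t \<in> {0..1}" for t
      proof (rule onorm_le)
        fix r :: real
        show "norm (r *\<^sub>R dir_deriv b g (x + t *\<^sub>R b)) \<le> C * 2 ^ ?k * weight x * norm r"
          using mult_right_mono[OF line[OF that, of x] norm_ge_zero[of r]] by (simp only: norm_scaleR real_norm_def mult.commute)
      qed
    qed (use h[of n] in auto)
    then have "norm (g (h n *\<^sub>R b + x) - g x) \<le> (C * 2 ^ ?k * weight x) * h n"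
      using h(1)[of n] by (simp add: add.commute)
    then show ?thesis using h(1)[of n] by (simp add: Q_def divide_inverse_commute[symmetric] pos_divide_le_eq)
  qed
  have gi: "integrable lborel g" using g by (rule schwartz_integrable)
  have gi': "integrable lborel (\<lambda>x. g (h n *\<^sub>R b + x))" for n
    using lborel_integrable_affine[OF _ gi, of 1 "h n *\<^sub>R b"] by simp
  have FQ: "fourier (Q n) \<xi> = ((exp (\<i> * complex_of_real (b \<bullet> \<xi>) * h n) - 1) / h n) * fourier g \<xi>" for n
  proof -
    have "fourier (\<lambda>x. g (h n *\<^sub>R b + x) - g x) \<xi> = fourier (\<lambda>x. g (h n *\<^sub>R b + x)) \<xi> - fourier g \<xi>"
      by (rule fourier_diff[OF gi' gi])
    also have "\<dots> = (exp (\<i> * complex_of_real (b \<bullet> \<xi>) * h n) - 1) * fourier g \<xi>"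
      unfolding fourier_translate[OF gm] by (simp add: algebra_simps)
    finally have "fourier (\<lambda>x. g (h n *\<^sub>R b + x) - g x) \<xi> = (exp (\<i> * complex_of_real (b \<bullet> \<xi>) * h n) - 1) * fourier g \<xi>" .
    moreover have "fourier (Q n) \<xi> = (1 / complex_of_real (h n)) * fourier (\<lambda>x. g (h n *\<^sub>R b + x) - g x) \<xi>"
      unfolding fourier_def Q_def integral_mult_right_zero[symmetric]
      by (intro Bochner_Integration.integral_cong refl) (simp add: scaleR_conv_of_real divide_inverse mult.left_commute)
    ultimately show ?thesis by simp
  qed
  have "(\<lambda>n. fourier (Q n) \<xi>) \<longlonglongrightarrow> fourier (dir_deriv b g) \<xi>"
    unfolding fourier_def
  proof (rule integral_dominated_convergence[where w="\<lambda>x. C * 2 ^ ?k * weight x"])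
    show "AE x in lborel. (\<lambda>n. exp (- (\<i> * complex_of_real (x \<bullet> \<xi>))) * Q n x) \<longlonglongrightarrow> exp (- (\<i> * complex_of_real (x \<bullet> \<xi>))) * dir_deriv b g x"
      by (intro AE_I2 tendsto_intros Qlim)
    show "AE x in lborel. norm (exp (- (\<i> * complex_of_real (x \<bullet> \<xi>))) * Q n x) \<le> C * 2 ^ ?k * weight x" for n
      using Qb by (intro AE_I2) (simp add: norm_mult)
    show "integrable lborel (\<lambda>x::'a. C * 2 ^ ?k * weight x)" by (intro integrable_mult_right integrable_weight)
  qed measurable
  moreover have "(\<lambda>n. fourier (Q n) \<xi>) \<longlonglongrightarrow> (\<i> * complex_of_real (b \<bullet> \<xi>)) * fourier g \<xi>"
  proof -
    have "((\<lambda>t. exp (\<i> * complex_of_real (b \<bullet> \<xi>) * t)) has_field_derivative \<i> * complex_of_real (b \<bullet> \<xi>)) (at 0)"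
      by (auto intro!: derivative_eq_intros)
    then have "((\<lambda>t. (exp (\<i> * complex_of_real (b \<bullet> \<xi>) * t) - 1) / t) \<longlongrightarrow> \<i> * complex_of_real (b \<bullet> \<xi>)) (at 0)"
      by (simp add: has_field_derivative_iff)
    moreover have "filterlim (\<lambda>n. complex_of_real (h n)) (at 0) sequentially"
      using tendsto_of_real[OF h0, where 'a=complex] h(1) by (auto simp: filterlim_at intro!: always_eventually) (metis less_irrefl)
    ultimately have "(\<lambda>n. (exp (\<i> * complex_of_real (b \<bullet> \<xi>) * h n) - 1) / h n) \<longlonglongrightarrow> \<i> * complex_of_real (b \<bullet> \<xi>)"
      by (rule filterlim_compose)
    then show ?thesis unfolding FQ by (intro tendsto_intros)
  qed
  ultimately show ?thesis by (rule LIMSEQ_unique)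
qed

lemma schwartz_dir_deriv_funpow: "schwartz f \<Longrightarrow> schwartz ((dir_deriv v ^^ m) f)"
  by (induction m) (auto intro: schwartz_dir_deriv)

lemma fourier_dir_deriv_funpow:
  fixes g :: "'a::euclidean_space \<Rightarrow> complex"
  assumes g: "schwartz g" and b: "b \<in> Basis"
  shows "fourier ((dir_deriv b ^^ m) g) \<xi> = (\<i> * complex_of_real (b \<bullet> \<xi>)) ^ m * fourier g \<xi>"
  by (induction m) (auto simp: fourier_dir_deriv[OF schwartz_dir_deriv_funpow[OF g] b])

text \<open>The issue is integrability of the transform. Taking \<open>2 * DIM('a)\<close>
  derivatives in a basis direction bounds the transform times that power of the coordinate, and at
  each \<open>\<xi>\<close> the largest coordinate alone controls the whole product in
  \<open>weight\<close>.\<close>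

lemma schwartz_imp_test_function:
  fixes \<psi> :: "'a::euclidean_space \<Rightarrow> complex"
  assumes \<psi>: "schwartz \<psi>"
  shows "test_function \<psi>"
proof -
  let ?k = "2 * DIM('a)"
  define M where "M b = (LINT x|lborel. norm ((dir_deriv b ^^ ?k) \<psi> x))" for b
  define M0 where "M0 = (LINT x|lborel. norm (\<psi> x))"
  have M: "\<bar>b \<bullet> \<xi>\<bar> ^ ?k * norm (fourier \<psi> \<xi>) \<le> M b" if "b \<in> Basis" for b \<xi>
    using norm_fourier_le[of "(dir_deriv b ^^ ?k) \<psi>" \<xi>] unfolding fourier_dir_deriv_funpow[OF \<psi> that] M_def
    by (simp add: norm_mult norm_power)
  have M0: "norm (fourier \<psi> \<xi>) \<le> M0" for \<xi> unfolding M0_def by (rule norm_fourier_le)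
  define S where "S = M0 + (\<Sum>b\<in>Basis. M b)"
  have Mnn: "M b \<ge> 0" for b unfolding M_def by simp
  have le: "norm (fourier \<psi> \<xi>) \<le> 2 ^ ?k * S * weight \<xi>" for \<xi>
  proof -
    have "finite ((\<lambda>b. \<bar>b \<bullet> \<xi>\<bar>) ` (Basis :: 'a set))" "(\<lambda>b. \<bar>b \<bullet> \<xi>\<bar>) ` (Basis :: 'a set) \<noteq> {}" by auto
    from Max_in[OF this] obtain c :: 'a where c: "c \<in> Basis" and eq: "\<bar>c \<bullet> \<xi>\<bar> = Max ((\<lambda>b. \<bar>b \<bullet> \<xi>\<bar>) ` Basis)" by force
    have max: "\<bar>b \<bullet> \<xi>\<bar> \<le> \<bar>c \<bullet> \<xi>\<bar>" if "b \<in> Basis" for b unfolding eq using that by (intro Max_ge) auto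
    define r where "r = \<bar>c \<bullet> \<xi>\<bar>"
    have "(\<Prod>b\<in>Basis. 1 + (\<xi> \<bullet> b)\<^sup>2) \<le> (\<Prod>b\<in>(Basis::'a set). (1 + r)\<^sup>2)"
    proof (rule prod_mono)
      fix b :: 'a assume b: "b \<in> Basis"
      have "(\<xi> \<bullet> b)\<^sup>2 \<le> r\<^sup>2" unfolding r_def using max[OF b] by (simp add: abs_le_square_iff inner_commute)
      moreover have "(1 + r)\<^sup>2 = 1 + 2 * r + r\<^sup>2" by (simp add: power2_sum)
      ultimately show "0 \<le> 1 + (\<xi> \<bullet> b)\<^sup>2 \<and> 1 + (\<xi> \<bullet> b)\<^sup>2 \<le> (1 + r)\<^sup>2"
        using zero_le_power2[of "\<xi> \<bullet> b"] by (auto simp: r_def)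
    qed
    also have "\<dots> = (1 + r) ^ ?k" by (simp add: power_mult)
    also have "\<dots> \<le> 2 ^ ?k * (1 + r ^ ?k)" by (rule one_plus_power_le) (simp add: r_def)
    finally have "(\<Prod>b\<in>Basis. 1 + (\<xi> \<bullet> b)\<^sup>2) * norm (fourier \<psi> \<xi>) \<le> 2 ^ ?k * (1 + r ^ ?k) * norm (fourier \<psi> \<xi>)"
      by (intro mult_right_mono) auto
    also have "\<dots> = 2 ^ ?k * (norm (fourier \<psi> \<xi>) + r ^ ?k * norm (fourier \<psi> \<xi>))" by (simp add: algebra_simps)
    also have "\<dots> \<le> 2 ^ ?k * (M0 + M c)"
      unfolding r_def by (intro mult_left_mono add_mono M0 M c) auto
    also have "\<dots> \<le> 2 ^ ?k * S" unfolding S_def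
      using c Mnn by (intro mult_left_mono add_left_mono member_le_sum) auto
    finally have "(\<Prod>b\<in>Basis. 1 + (\<xi> \<bullet> b)\<^sup>2) * norm (fourier \<psi> \<xi>) \<le> 2 ^ ?k * S" .
    moreover have "(\<Prod>b\<in>Basis. 1 + (\<xi> \<bullet> b)\<^sup>2) > 0" by (intro prod_pos) (auto simp: add_pos_nonneg)
    ultimately show ?thesis by (simp add: weight_def prod_dividef field_simps)
  qed
  have [measurable]: "\<psi> \<in> borel_measurable borel" using \<psi> by (rule schwartz_measurable)
  have "integrable lborel (fourier \<psi>)"
  proof (rule Bochner_Integration.integrable_bound)
    show "integrable lborel (\<lambda>x::'a. 2 ^ ?k * S * weight x)" by (intro integrable_mult_right integrable_weight)
    show "AE x in lborel. norm (fourier \<psi> x) \<le> norm (2 ^ ?k * S * weight x)"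
      using le by (intro AE_I2) (auto intro: order_trans[OF _ abs_ge_self])
  qed measurable
  moreover have "\<exists>B. \<forall>x. norm (\<psi> x) \<le> B" using schwartz_decay[OF \<psi>, of 0] by auto
  ultimately show ?thesis
    unfolding test_function_def using schwartz_integrable[OF \<psi>] schwartz_continuous[OF \<psi>] by blast
qed

section \<open>Polynomials times Gaussians as Schwartz functions\<close>

inductive complex_polynomial :: "('a::euclidean_space \<Rightarrow> complex) \<Rightarrow> bool" where
  const: "complex_polynomial (\<lambda>x. c)"
| inner: "complex_polynomial (\<lambda>x. complex_of_real (x \<bullet> v))"
| add: "complex_polynomial p \<Longrightarrow> complex_polynomial q \<Longrightarrow> complex_polynomial (\<lambda>x. p x + q x)"
| mult: "complex_polynomial p \<Longrightarrow> complex_polynomial q \<Longrightarrow> complex_polynomial (\<lambda>x. p x * q x)"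

lemma complex_polynomial_derivative:
  "complex_polynomial p \<Longrightarrow> \<exists>p'. (\<forall>x. (p has_derivative p' x) (at x)) \<and> (\<forall>w. complex_polynomial (\<lambda>x. p' x w))"
proof (induction rule: complex_polynomial.induct)
  case (const c)
  show ?case by (rule exI[of _ "\<lambda>x w. 0"]) (auto intro: complex_polynomial.const)
next
  case (inner v)
  show ?case by (rule exI[of _ "\<lambda>x w. complex_of_real (w \<bullet> v)"])
    (auto intro!: complex_polynomial.const derivative_eq_intros)
next
  case (add p q)
  then obtain p' q' where "\<And>x. (p has_derivative p' x) (at x)" "\<And>w. complex_polynomial (\<lambda>x. p' x w)"
    "\<And>x. (q has_derivative q' x) (at x)" "\<And>w. complex_polynomial (\<lambda>x. q' x w)" by blast
  then show ?case by (intro exI[of _ "\<lambda>x w. p' x w + q' x w"])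
    (auto intro!: complex_polynomial.add has_derivative_add)
next
  case (mult p q)
  then obtain p' q' where "\<And>x. (p has_derivative p' x) (at x)" "\<And>w. complex_polynomial (\<lambda>x. p' x w)"
    "\<And>x. (q has_derivative q' x) (at x)" "\<And>w. complex_polynomial (\<lambda>x. q' x w)" by blast
  with mult.hyps show ?case by (intro exI[of _ "\<lambda>x w. p x * q' x w + p' x w * q x"])
    (auto intro!: complex_polynomial.add complex_polynomial.mult has_derivative_mult)
qed

lemma complex_polynomial_bound:
  "complex_polynomial p \<Longrightarrow> \<exists>C\<ge>0. \<exists>k. \<forall>x. norm (p x) \<le> C * (1 + norm x) ^ k"
proof (induction rule: complex_polynomial.induct)
  case (const c)
  show ?case by (intro exI[of _ "norm c"] conjI exI[of _ 0]) auto
next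
  case (inner v)
  have "norm (complex_of_real (x \<bullet> v)) \<le> norm v * (1 + norm x) ^ 1" for x
    using Cauchy_Schwarz_ineq2[of x v] by (simp add: algebra_simps) (metis add_increasing norm_ge_zero)
  then show ?case by (intro exI[of _ "norm v"] conjI exI[of _ 1]) auto
next
  case (add p q)
  then obtain C k C' k' where *: "C \<ge> 0" "C' \<ge> 0" "\<And>x. norm (p x) \<le> C * (1 + norm x) ^ k" "\<And>x. norm (q x) \<le> C' * (1 + norm x) ^ k'"
    by blast
  have "norm (p x + q x) \<le> (C + C') * (1 + norm x) ^ (k + k')" for x
  proof -
    have "norm (p x + q x) \<le> C * (1 + norm x) ^ k + C' * (1 + norm x) ^ k'"
      using norm_triangle_ineq[of "p x" "q x"] *(3,4)[of x] by linarith
    also have "\<dots> \<le> C * (1 + norm x) ^ (k + k') + C' * (1 + norm x) ^ (k + k')"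
      using *(1,2) by (intro add_mono mult_left_mono power_increasing) auto
    finally show ?thesis by (simp add: distrib_right)
  qed
  then show ?case using * by (intro exI[of _ "C + C'"] conjI exI[of _ "k + k'"]) auto
next
  case (mult p q)
  then obtain C k C' k' where *: "C \<ge> 0" "C' \<ge> 0" "\<And>x. norm (p x) \<le> C * (1 + norm x) ^ k" "\<And>x. norm (q x) \<le> C' * (1 + norm x) ^ k'"
    by blast
  have "norm (p x * q x) \<le> (C * C') * (1 + norm x) ^ (k + k')" for x
  proof -
    have "norm (p x * q x) \<le> (C * (1 + norm x) ^ k) * (C' * (1 + norm x) ^ k')"
      unfolding norm_mult using * by (intro mult_mono) auto
    then show ?thesis by (simp add: power_add mult_ac)
  qed
  then show ?case using * by (intro exI[of _ "C * C'"] conjI exI[of _ "k + k'"]) auto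
qed

text \<open>Up to a constant factor \<open>u\<close> translates the Gaussian and \<open>v\<close>
  modulates it, so one family covers both kinds of test functions that uniqueness requires.\<close>

definition gauss_exp :: "'a::euclidean_space \<Rightarrow> 'a \<Rightarrow> 'a \<Rightarrow> complex" where
  "gauss_exp u v x = exp (complex_of_real (x \<bullet> u - (x \<bullet> x) / 2) + \<i> * complex_of_real (x \<bullet> v))"

text \<open>Polynomial multiples of a fixed \<open>gauss_exp u v\<close> are stable under
  directional derivatives, so every iterated derivative has this shape, and the quadratic exponent
  beats every power of the norm.\<close>

lemma schwartz_gauss_exp:
  assumes "complex_polynomial p"
  shows "schwartz (\<lambda>x. p x * gauss_exp u v x)"
proof -
  have deriv: "\<exists>q'. (\<forall>x. ((\<lambda>x. q x * gauss_exp u v x) has_derivative (\<lambda>w. q' x w * gauss_exp u v x)) (at x)) \<and> (\<forall>w. complex_polynomial (\<lambda>x. q' x w))"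
    if q: "complex_polynomial q" for q
  proof -
    obtain q' where q': "\<And>x. (q has_derivative q' x) (at x)" "\<And>w. complex_polynomial (\<lambda>x. q' x w)"
      using complex_polynomial_derivative[OF q] by blast
    define l where "l x w = complex_of_real (w \<bullet> u) + (- 1) * complex_of_real (x \<bullet> w) + \<i> * complex_of_real (w \<bullet> v)" for x w
    have "(gauss_exp u v has_derivative (\<lambda>w. l x w * gauss_exp u v x)) (at x)" for x
    proof -
      define g where "g x = complex_of_real (x \<bullet> u - (x \<bullet> x) / 2) + \<i> * complex_of_real (x \<bullet> v)" for x
      have "((\<lambda>x. x \<bullet> u - (x \<bullet> x) / 2) has_derivative (\<lambda>w. w \<bullet> u - x \<bullet> w)) (at x)"
        by (auto intro!: derivative_eq_intros simp: inner_commute)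
      then have "((\<lambda>x. complex_of_real (x \<bullet> u - (x \<bullet> x) / 2)) has_derivative (\<lambda>w. complex_of_real (w \<bullet> u - x \<bullet> w))) (at x)"
        by (rule has_derivative_of_real)
      moreover have "((\<lambda>x. complex_of_real (x \<bullet> v)) has_derivative (\<lambda>w. complex_of_real (w \<bullet> v))) (at x)"
        by (rule has_derivative_of_real) (auto intro!: derivative_eq_intros)
      ultimately have "(g has_derivative (\<lambda>w. complex_of_real (w \<bullet> u - x \<bullet> w) + \<i> * complex_of_real (w \<bullet> v))) (at x)"
        unfolding g_def[abs_def] by (intro has_derivative_add has_derivative_mult_right)
      then have "(g has_derivative l x) (at x)" unfolding l_def by (simp add: of_real_diff)
      from has_derivative_compose[OF this DERIV_exp[THEN has_field_derivative_imp_has_derivative]]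
      show ?thesis unfolding g_def gauss_exp_def[abs_def] by (simp add: mult.commute)
    qed
    then have "((\<lambda>x. q x * gauss_exp u v x) has_derivative (\<lambda>w. (q' x w + q x * l x w) * gauss_exp u v x)) (at x)" for x
      using q'(1)[of x] by (auto intro!: derivative_eq_intros simp: algebra_simps)
    moreover have "complex_polynomial (\<lambda>x. q' x w + q x * l x w)" for w
      unfolding l_def by (intro complex_polynomial.intros q' q)
    ultimately show ?thesis by (intro exI[of _ "\<lambda>x w. q' x w + q x * l x w"]) auto
  qed
  have iter: "\<exists>q. complex_polynomial q \<and> foldr dir_deriv vs (\<lambda>x. p x * gauss_exp u v x) = (\<lambda>x. q x * gauss_exp u v x)" for vs
  proof (induction vs)
    case Nil
    then show ?case using assms by auto
  next
    case (Cons w vs)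
    then obtain q where q: "complex_polynomial q" "foldr dir_deriv vs (\<lambda>x. p x * gauss_exp u v x) = (\<lambda>x. q x * gauss_exp u v x)" by blast
    obtain q' where q': "\<And>x. ((\<lambda>x. q x * gauss_exp u v x) has_derivative (\<lambda>w. q' x w * gauss_exp u v x)) (at x)" "\<And>w. complex_polynomial (\<lambda>x. q' x w)"
      using deriv[OF q(1)] by blast
    have "dir_deriv w (\<lambda>x. q x * gauss_exp u v x) = (\<lambda>x. q' x w * gauss_exp u v x)"
      unfolding dir_deriv_def by (intro ext) (simp add: frechet_derivative_at[OF q'(1), symmetric])
    then show ?case using q q'(2) by auto
  qed
  have diff: "(\<lambda>x. q x * gauss_exp u v x) differentiable_on UNIV" if "complex_polynomial q" for q
    using deriv[OF that] unfolding differentiable_on_def by (auto simp: differentiable_def)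
  have bound: "\<exists>B. \<forall>x. norm x ^ k * norm (q x * gauss_exp u v x) \<le> B" if q: "complex_polynomial q" for q k
  proof -
    obtain C m where C: "C \<ge> 0" "\<And>x. norm (q x) \<le> C * (1 + norm x) ^ m"
      using complex_polynomial_bound[OF q] by blast
    \<comment> \<open>\<open>real (k + m)\<close> is the exponential rate that bounds the polynomial
      factors, \<open>norm u\<close> the rate of the linear term; completing the square in
      \<open>a * r - r\<^sup>2 / 2\<close> gives the constant \<open>a\<^sup>2 / 2\<close>.\<close>
    define a where "a = real (k + m) + norm u"
    have "norm x ^ k * norm (q x * gauss_exp u v x) \<le> C * exp (a\<^sup>2 / 2)" for x
    proof -
      define r where "r = norm x"
      have r: "r \<ge> 0" by (simp add: r_def)
      have "norm (gauss_exp u v x) = exp (x \<bullet> u - r\<^sup>2 / 2)"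
        by (simp add: gauss_exp_def r_def power2_norm_eq_inner)
      also have "\<dots> \<le> exp (r * norm u - r\<^sup>2 / 2)"
        using norm_cauchy_schwarz[of x u] by (simp add: r_def)
      finally have 1: "norm (gauss_exp u v x) \<le> exp (r * norm u - r\<^sup>2 / 2)" .
      have 2: "norm x ^ k * norm (q x) \<le> C * exp (real (k + m) * r)"
      proof -
        have "norm x ^ k * norm (q x) \<le> (1 + r) ^ k * (C * (1 + r) ^ m)"
          unfolding r_def by (intro mult_mono C power_mono) auto
        also have "\<dots> = C * (1 + r) ^ (k + m)" by (simp add: power_add)
        also have "\<dots> \<le> C * exp r ^ (k + m)"
          using r C(1) exp_ge_add_one_self[of r] by (intro mult_left_mono power_mono) auto
        also have "exp r ^ (k + m) = exp (real (k + m) * r)" by (rule exp_of_nat_mult[symmetric])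
        finally show ?thesis .
      qed
      have "norm x ^ k * norm (q x * gauss_exp u v x) = (norm x ^ k * norm (q x)) * norm (gauss_exp u v x)"
        by (simp add: norm_mult)
      also have "\<dots> \<le> (C * exp (real (k + m) * r)) * exp (r * norm u - r\<^sup>2 / 2)"
        using C(1) by (intro mult_mono 1 2) auto
      also have "\<dots> = C * exp (a * r - r\<^sup>2 / 2)"
        unfolding a_def by (simp add: exp_add[symmetric] algebra_simps)
      also have "\<dots> \<le> C * exp (a\<^sup>2 / 2)"
      proof -
        have "0 \<le> (a - r)\<^sup>2" by simp
        then have "a * r - r\<^sup>2 / 2 \<le> a\<^sup>2 / 2" by (simp add: power2_diff)
        then show ?thesis using C(1) by (intro mult_left_mono) auto
      qed
      finally show ?thesis .
    qed
    then show ?thesis by blast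
  qed
  show ?thesis unfolding schwartz_def
  proof (intro allI conjI)
    fix vs
    obtain q where q: "complex_polynomial q" "foldr dir_deriv vs (\<lambda>x. p x * gauss_exp u v x) = (\<lambda>x. q x * gauss_exp u v x)"
      using iter by blast
    show "foldr dir_deriv vs (\<lambda>x. p x * gauss_exp u v x) differentiable_on UNIV" unfolding q(2) by (rule diff[OF q(1)])
    show "\<exists>B. \<forall>x. norm x ^ k * norm (foldr dir_deriv vs (\<lambda>x. p x * gauss_exp u v x) x) \<le> B" for k :: nat
      unfolding q(2) by (rule bound[OF q(1)])
  qed
qed

section \<open>Uniqueness of distributional transforms\<close>

lemma schwartz_gauss_modulated: "schwartz (\<lambda>x. exp (- (\<i> * complex_of_real (x \<bullet> c))) * complex_of_real (gauss x))"
proof -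
  have "(\<lambda>x. exp (- (\<i> * complex_of_real (x \<bullet> c))) * complex_of_real (gauss x)) = (\<lambda>x. 1 * gauss_exp 0 (- c) x)"
    by (auto simp: gauss_exp_def gauss_def exp_of_real[symmetric] exp_add[symmetric] power2_norm_eq_inner algebra_simps)
  then show ?thesis by (simp only: schwartz_gauss_exp complex_polynomial.const)
qed

lemma schwartz_gauss_translated: "schwartz (\<lambda>x. complex_of_real (gauss (- c + x)))"
proof -
  have "gauss (- c + x) = exp (- (c \<bullet> c) / 2) * exp (x \<bullet> c - (x \<bullet> x) / 2)" for x
    unfolding gauss_def power2_norm_eq_inner exp_add[symmetric]
    by (simp add: inner_simps inner_commute field_simps)
  then have "(\<lambda>x. complex_of_real (gauss (- c + x))) = (\<lambda>x. complex_of_real (exp (- (c \<bullet> c) / 2)) * gauss_exp c 0 x)"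
    by (auto simp: gauss_exp_def exp_of_real simp del: of_real_diff of_real_divide)
  then show ?thesis by (simp only: schwartz_gauss_exp complex_polynomial.const)
qed

text \<open>Pairing a function with the Gaussian modulated by \<open>c\<close> is the ordinary
  transform at \<open>c\<close> of the function times \<open>gauss\<close>, which is integrable. So
  the difference of the two candidates, damped by \<open>gauss\<close>, has vanishing
  transform.\<close>

lemma has_fourier_transform_unique:
  assumes "has_fourier_transform F \<Phi>" "has_fourier_transform F \<Phi>'"
  shows "AE p in lborel. \<Phi> p = \<Phi>' p"
proof -
  note 1 = assms[unfolded has_fourier_transform_def]
  define e where "e c p = exp (- (\<i> * complex_of_real (p \<bullet> c))) * complex_of_real (gauss p)" for c p :: 'a
  have e: "schwartz (e c)" for c unfolding e_def[abs_def] by (rule schwartz_gauss_modulated)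
  define K where "K p = (\<Phi> p - \<Phi>' p) * complex_of_real (gauss p)" for p
  have i: "integrable lborel (\<lambda>p. \<Phi> p * e c p)" "integrable lborel (\<lambda>p. \<Phi>' p * e c p)"
    and eq: "(LINT p|lborel. \<Phi> p * e c p) = (LINT p|lborel. \<Phi>' p * e c p)" for c
    using 1 e by metis+
  have K: "integrable lborel K"
    using Bochner_Integration.integrable_diff[OF i(1)[of 0] i(2)[of 0]] unfolding K_def[abs_def] e_def by (simp add: left_diff_distrib)
  have "fourier K c = (LINT p|lborel. \<Phi> p * e c p - \<Phi>' p * e c p)" for c
    unfolding fourier_def[of K] K_def e_def by (simp add: left_diff_distrib right_diff_distrib mult_ac)
  also have "\<dots> c = 0" for c using Bochner_Integration.integral_diff[OF i] eq by simp
  finally have "AE p in lborel. K p = 0" by (intro fourier_eq_0_imp_AE_eq_0 K)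
  then show ?thesis
  proof eventually_elim
    case (elim p)
    then show ?case using gauss_pos[of p] by (simp add: K_def)
  qed
qed

text \<open>The same argument on the other side of the duality, since translated Gaussians have
  modulated Gaussians as transforms.\<close>

lemma has_fourier_transform_unique_left:
  assumes "has_fourier_transform F \<Phi>" "has_fourier_transform F' \<Phi>"
  shows "AE p in lborel. F p = F' p"
proof -
  note 1 = assms[unfolded has_fourier_transform_def]
  define t where "t c p = complex_of_real (gauss (- c + p))" for c p :: 'a
  have t: "schwartz (t c)" for c unfolding t_def[abs_def] by (rule schwartz_gauss_translated)
  define k where "k = complex_of_real (sqrt (2 * pi) ^ DIM('a))"
  have k: "k \<noteq> 0" by (simp add: k_def)
  have ft: "fourier (t c) \<xi> = exp (- (\<i> * complex_of_real (\<xi> \<bullet> c))) * (k * complex_of_real (gauss \<xi>))" for c \<xi>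
    unfolding t_def[abs_def]
    by (subst fourier_translate) (simp_all add: fourier_gauss k_def inner_commute)
  define K where "K p = (F p - F' p) * (k * complex_of_real (gauss p))" for p
  have i: "integrable lborel (\<lambda>p. F p * fourier (t c) p)" "integrable lborel (\<lambda>p. F' p * fourier (t c) p)"
    and eq: "(LINT p|lborel. F p * fourier (t c) p) = (LINT p|lborel. F' p * fourier (t c) p)" for c
    using 1 t by metis+
  have K: "integrable lborel K"
    using Bochner_Integration.integrable_diff[OF i(1)[of 0] i(2)[of 0]] unfolding K_def[abs_def] ft by (simp add: left_diff_distrib)
  have "fourier K c = (LINT p|lborel. F p * fourier (t c) p - F' p * fourier (t c) p)" for c
    unfolding fourier_def[of K] K_def ft by (simp add: left_diff_distrib right_diff_distrib mult_ac)
  also have "\<dots> c = 0" for c using Bochner_Integration.integral_diff[OF i] eq by simp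
  finally have "AE p in lborel. K p = 0" by (intro fourier_eq_0_imp_AE_eq_0 K)
  then show ?thesis
  proof eventually_elim
    case (elim p)
    then show ?case using gauss_pos[of p] k by (simp add: K_def)
  qed
qed

section \<open>Substitution, slicing and polar coordinates\<close>

lemma nn_integral_indicator_incseq_LIMSEQ:
  fixes f :: "'a::euclidean_space \<Rightarrow> ennreal"
  assumes [measurable]: "f \<in> borel_measurable borel" "\<And>n. A n \<in> sets borel" and inc: "incseq A"
  shows "(\<lambda>n. \<integral>\<^sup>+x. f x * indicator (A n) x \<partial>lborel) \<longlonglongrightarrow> (\<integral>\<^sup>+x. f x * indicator (\<Union>n. A n) x \<partial>lborel)"
proof (rule nn_integral_LIMSEQ)
  show "incseq (\<lambda>n x. f x * indicator (A n) x)"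
    using inc by (auto simp: incseq_def le_fun_def split: split_indicator)
  fix x
  show "(\<lambda>n. f x * indicator (A n) x) \<longlonglongrightarrow> f x * indicator (\<Union>n. A n) x"
  proof (cases "x \<in> (\<Union>n. A n)")
    case True
    then obtain m where m: "x \<in> A m" by blast
    have "eventually (\<lambda>n. f x * indicator (A n) x = f x * indicator (\<Union>n. A n) x) sequentially"
      using eventually_ge_at_top[of m]
    proof eventually_elim
      case (elim n)
      then have "x \<in> A n" using inc m by (auto simp: incseq_def)
      then show ?case using True by simp
    qed
    then show ?thesis by (rule tendsto_eventually)
  next
    case False
    then have "f x * indicator (A n) x = 0" for n by simp
    with False show ?thesis by simp
  qed
qed measurable

text \<open>The change of variables on compact intervals, carried to their union by monotone
  convergence. Stated for unions, it serves the whole line, a closed half-line, and a map of the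
  line onto an open half-line.\<close>

lemma nn_integral_substitution_exhaustion:
  fixes g g' :: "real \<Rightarrow> real" and h :: "real \<Rightarrow> ennreal" and a b :: "nat \<Rightarrow> real"
  assumes h [measurable]: "h \<in> borel_measurable borel"
    and ab: "\<And>n. a n < b n" "decseq a" "incseq b"
    and D: "\<And>n x. x \<in> {a n..b n} \<Longrightarrow> (g has_real_derivative g' x) (at x)"
    and C: "continuous_on UNIV g'"
    and P: "\<And>n x. x \<in> {a n..b n} \<Longrightarrow> g' x \<ge> 0"
  shows "(\<integral>\<^sup>+x. h x * indicator (\<Union>n. {g (a n)..g (b n)}) x \<partial>lborel) =
         (\<integral>\<^sup>+x. h (g x) * ennreal (g' x) * indicator (\<Union>n. {a n..b n}) x \<partial>lborel)"
proof -
  have mono: "g x \<le> g y" if "x \<in> {a n..b n}" "y \<in> {a n..b n}" "x \<le> y" for n x y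
  proof (rule DERIV_nonneg_imp_nondecreasing[OF \<open>x \<le> y\<close>])
    fix z assume "x \<le> z" "z \<le> y"
    with that have "z \<in> {a n..b n}" by auto
    then show "\<exists>w. (g has_real_derivative w) (at z) \<and> 0 \<le> w" using D P by blast
  qed
  have le: "a n \<le> a m" "b m \<le> b n" if "m \<le> n" for m n
    using ab that by (auto simp: decseq_def incseq_def)
  have inc1: "incseq (\<lambda>n. {a n..b n})" using le by (fastforce simp: incseq_def)
  have inc2: "incseq (\<lambda>n. {g (a n)..g (b n)})"
  proof (rule incseq_SucI)
    fix n
    have "a (Suc n) \<le> a n" "b n \<le> b (Suc n)" "a n < b n" "a (Suc n) < b (Suc n)" using le ab by auto
    then have "g (a (Suc n)) \<le> g (a n)" "g (b n) \<le> g (b (Suc n))"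
      using mono[of "a (Suc n)" "Suc n" "a n"] mono[of "b n" "Suc n" "b (Suc n)"] by auto
    then show "{g (a n)..g (b n)} \<subseteq> {g (a (Suc n))..g (b (Suc n))}" by auto
  qed
  define I where "I = (\<Union>n. {a n..b n})"
  \<comment> \<open>Nothing is known about \<open>g\<close> outside \<open>I\<close>; the cut-off
    function is measurable on the whole line.\<close>
  define G where "G x = (if x \<in> I then g x else 0)" for x
  have Im [measurable]: "I \<in> sets borel" by (auto simp: I_def)
  have "continuous_on I g"
    unfolding I_def by (intro continuous_at_imp_continuous_on ballI) (use D in \<open>auto intro: DERIV_isCont\<close>)
  then have Gm [measurable]: "G \<in> borel_measurable borel"
    using Im unfolding G_def
    by (intro borel_measurable_continuous_on_if) auto
  have g'm [measurable]: "g' \<in> borel_measurable borel" using C by (rule borel_measurable_continuous_onI)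
  have L1: "(\<lambda>n. \<integral>\<^sup>+x. h x * indicator {g (a n)..g (b n)} x \<partial>lborel) \<longlonglongrightarrow> (\<integral>\<^sup>+x. h x * indicator (\<Union>n. {g (a n)..g (b n)}) x \<partial>lborel)"
    by (rule nn_integral_indicator_incseq_LIMSEQ[OF _ _ inc2]) auto
  have L2: "(\<lambda>n. \<integral>\<^sup>+x. (h (G x) * ennreal (g' x)) * indicator {a n..b n} x \<partial>lborel) \<longlonglongrightarrow> (\<integral>\<^sup>+x. (h (G x) * ennreal (g' x)) * indicator (\<Union>n. {a n..b n}) x \<partial>lborel)"
    by (rule nn_integral_indicator_incseq_LIMSEQ[OF _ _ inc1]) auto
  have "(\<integral>\<^sup>+x. h x * indicator {g (a n)..g (b n)} x \<partial>lborel) = (\<integral>\<^sup>+x. (h (G x) * ennreal (g' x)) * indicator {a n..b n} x \<partial>lborel)" for n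
  proof -
    have "(\<integral>\<^sup>+x. h x * indicator {g (a n)..g (b n)} x \<partial>lborel) = (\<integral>\<^sup>+x. h (g x) * g' x * indicator {a n..b n} x \<partial>lborel)"
      by (rule nn_integral_substitution_aux) (use D P ab C in \<open>auto intro: continuous_on_subset\<close>)
    also have "\<dots> = (\<integral>\<^sup>+x. (h (G x) * ennreal (g' x)) * indicator {a n..b n} x \<partial>lborel)"
      by (intro nn_integral_cong) (auto simp: G_def I_def split: split_indicator)
    finally show ?thesis .
  qed
  with L1 L2 have "(\<integral>\<^sup>+x. h x * indicator (\<Union>n. {g (a n)..g (b n)}) x \<partial>lborel) = (\<integral>\<^sup>+x. (h (G x) * ennreal (g' x)) * indicator (\<Union>n. {a n..b n}) x \<partial>lborel)"
    using LIMSEQ_unique by auto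
  also have "\<dots> = (\<integral>\<^sup>+x. h (g x) * ennreal (g' x) * indicator (\<Union>n. {a n..b n}) x \<partial>lborel)"
    by (intro nn_integral_cong) (auto simp: G_def I_def split: split_indicator)
  finally show ?thesis .
qed

lemma nn_integral_substitution_UNIV:
  fixes g g' :: "real \<Rightarrow> real" and h :: "real \<Rightarrow> ennreal"
  assumes h [measurable]: "h \<in> borel_measurable borel"
    and D: "\<And>x. (g has_real_derivative g' x) (at x)"
    and C: "continuous_on UNIV g'" and P: "\<And>x. g' x \<ge> 0"
    and top: "filterlim g at_top at_top" and bot: "filterlim g at_bot at_bot"
  shows "(\<integral>\<^sup>+x. h x \<partial>lborel) = (\<integral>\<^sup>+x. h (g x) * ennreal (g' x) \<partial>lborel)"
proof -
  let ?a = "\<lambda>n. - real (Suc n)" and ?b = "\<lambda>n. real (Suc n)"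
  have 1: "(\<Union>n. {?a n..?b n}) = UNIV"
  proof (intro set_eqI iffI UNIV_I)
    fix x :: real
    obtain n :: nat where "\<bar>x\<bar> \<le> n" using real_arch_simple by blast
    then have "x \<in> {?a n..?b n}" by auto
    then show "x \<in> (\<Union>n. {?a n..?b n})" by blast
  qed
  have 2: "(\<Union>n. {g (?a n)..g (?b n)}) = UNIV"
  proof (intro set_eqI iffI UNIV_I)
    fix y :: real
    have "filterlim ?b at_top sequentially"
      by (rule filterlim_compose[OF filterlim_real_sequentially filterlim_Suc])
    then have T: "filterlim (\<lambda>n. g (?b n)) at_top sequentially" and B: "filterlim (\<lambda>n. g (?a n)) at_bot sequentially"
      using filterlim_compose[OF top, of ?b] filterlim_compose[OF bot, of ?a]
      unfolding filterlim_uminus_at_bot[of ?a] minus_minus by blast+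
    have "eventually (\<lambda>n. y \<in> {g (?a n)..g (?b n)}) sequentially"
      using T B unfolding filterlim_at_top filterlim_at_bot by (auto intro: eventually_conj)
    then show "y \<in> (\<Union>n. {g (?a n)..g (?b n)})" by (auto dest: eventually_happens)
  qed
  have "(\<integral>\<^sup>+x. h x * indicator (\<Union>n. {g (?a n)..g (?b n)}) x \<partial>lborel) =
         (\<integral>\<^sup>+x. h (g x) * ennreal (g' x) * indicator (\<Union>n. {?a n..?b n}) x \<partial>lborel)"
    by (rule nn_integral_substitution_exhaustion) (use D C P in \<open>auto simp: decseq_def incseq_def\<close>)
  then show ?thesis unfolding 1 2 by simp
qed

lemma nn_integral_substitution_halfline:
  fixes g g' :: "real \<Rightarrow> real" and h :: "real \<Rightarrow> ennreal"
  assumes h [measurable]: "h \<in> borel_measurable borel"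
    and D: "\<And>x. x \<ge> 0 \<Longrightarrow> (g has_real_derivative g' x) (at x)"
    and C: "continuous_on UNIV g'" and P: "\<And>x. x \<ge> 0 \<Longrightarrow> g' x \<ge> 0"
    and top: "filterlim g at_top at_top"
  shows "(\<integral>\<^sup>+x. h x * indicator {g 0..} x \<partial>lborel) = (\<integral>\<^sup>+x. h (g x) * ennreal (g' x) * indicator {0..} x \<partial>lborel)"
proof -
  let ?a = "\<lambda>n::nat. 0::real" and ?b = "\<lambda>n. real (Suc n)"
  have 1: "(\<Union>n. {?a n..?b n}) = {0..}"
  proof (intro set_eqI iffI)
    fix x :: real assume x: "x \<in> {0..}"
    obtain n :: nat where "\<bar>x\<bar> \<le> n" using real_arch_simple by blast
    then have "x \<in> {?a n..?b n}" using x by auto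
    then show "x \<in> (\<Union>n. {?a n..?b n})" by blast
  qed auto
  have 2: "(\<Union>n. {g (?a n)..g (?b n)}) = {g 0..}"
  proof (intro set_eqI iffI)
    fix y :: real assume y: "y \<in> {g 0..}"
    have "filterlim ?b at_top sequentially"
      by (rule filterlim_compose[OF filterlim_real_sequentially filterlim_Suc])
    then have T: "filterlim (\<lambda>n. g (?b n)) at_top sequentially" 
      using filterlim_compose[OF top, of ?b] by auto
    have "eventually (\<lambda>n. y \<in> {g (?a n)..g (?b n)}) sequentially"
      using T y unfolding filterlim_at_top by auto
    then show "y \<in> (\<Union>n. {g (?a n)..g (?b n)})" by (auto dest: eventually_happens)
  qed auto
  have "(\<integral>\<^sup>+x. h x * indicator (\<Union>n. {g (?a n)..g (?b n)}) x \<partial>lborel) =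
         (\<integral>\<^sup>+x. h (g x) * ennreal (g' x) * indicator (\<Union>n. {?a n..?b n}) x \<partial>lborel)"
    by (rule nn_integral_substitution_exhaustion) (use D C P in \<open>auto simp: decseq_def incseq_def\<close>)
  then show ?thesis unfolding 1 2 by simp
qed

text \<open>Fubini in the direction \<open>e\<close>, phrased as a comparison of two integrals so
  that no measure on the hyperplane orthogonal to \<open>e\<close> has to be named.\<close>

lemma nn_integral_lborel_slice_cong:
  fixes G1 G2 :: "'a::euclidean_space \<Rightarrow> ennreal"
  assumes [measurable]: "G1 \<in> borel_measurable borel" "G2 \<in> borel_measurable borel"
    and e: "e \<in> Basis"
    and eq: "\<And>x. x \<bullet> e = 0 \<Longrightarrow> (\<integral>\<^sup>+u. G1 (x + u *\<^sub>R e) \<partial>lborel) = (\<integral>\<^sup>+u. G2 (x + u *\<^sub>R e) \<partial>lborel)"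
  shows "(\<integral>\<^sup>+x. G1 x \<partial>lborel) = (\<integral>\<^sup>+x. G2 x \<partial>lborel)"
proof -
  interpret product_sigma_finite "\<lambda>_::'a. lborel :: real measure" by standard
  define B where "B = Basis - {e}"
  have B: "Basis = insert e B" "e \<notin> B" "finite B" using e by (auto simp: B_def)
  have split: "(\<integral>\<^sup>+x. G x \<partial>lborel) = (\<integral>\<^sup>+y. (\<integral>\<^sup>+u. G ((\<Sum>b\<in>B. y b *\<^sub>R b) + u *\<^sub>R e) \<partial>lborel) \<partial>Pi\<^sub>M B (\<lambda>_. lborel))"
    if [measurable]: "G \<in> borel_measurable borel" for G :: "'a \<Rightarrow> ennreal"
  proof -
    have "(\<integral>\<^sup>+x. G x \<partial>lborel) = (\<integral>\<^sup>+y. G (\<Sum>b\<in>Basis. y b *\<^sub>R b) \<partial>Pi\<^sub>M Basis (\<lambda>_. lborel))"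
      by (subst lborel_eq, subst nn_integral_distr) auto
    also have "\<dots> = (\<integral>\<^sup>+y. (\<integral>\<^sup>+u. G (\<Sum>b\<in>insert e B. (y(e:=u)) b *\<^sub>R b) \<partial>lborel) \<partial>Pi\<^sub>M B (\<lambda>_. lborel))"
      unfolding B(1) by (subst product_nn_integral_insert[OF B(3,2)]) auto
    also have "\<dots> = (\<integral>\<^sup>+y. (\<integral>\<^sup>+u. G ((\<Sum>b\<in>B. y b *\<^sub>R b) + u *\<^sub>R e) \<partial>lborel) \<partial>Pi\<^sub>M B (\<lambda>_. lborel))"
    proof (intro nn_integral_cong)
      fix y u
      have "(\<Sum>b\<in>B. (y(e:=u)) b *\<^sub>R b) = (\<Sum>b\<in>B. y b *\<^sub>R b)" using B(2) by (intro sum.cong) auto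
      then show "G (\<Sum>b\<in>insert e B. (y(e:=u)) b *\<^sub>R b) = G ((\<Sum>b\<in>B. y b *\<^sub>R b) + u *\<^sub>R e)"
        using B(2,3) by (simp add: add.commute)
    qed
    finally show ?thesis .
  qed
  have "(\<Sum>b\<in>B. y b *\<^sub>R b) \<bullet> e = 0" for y
    using e by (auto simp: inner_sum_left B_def inner_Basis intro!: sum.neutral)
  then show ?thesis by (simp add: split eq)
qed

lemma nn_integral_lborel_translate:
  fixes G :: "'a::euclidean_space \<Rightarrow> ennreal"
  assumes [measurable]: "G \<in> borel_measurable borel"
  shows "(\<integral>\<^sup>+x. G (c + x) \<partial>lborel) = (\<integral>\<^sup>+x. G x \<partial>lborel)"
proof -
  have "(\<integral>\<^sup>+x. G x \<partial>lborel) = (\<integral>\<^sup>+x. G x \<partial>distr lborel borel ((+) c))"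
    by (simp add: lborel_distr_plus)
  also have "\<dots> = (\<integral>\<^sup>+x. G (c + x) \<partial>lborel)" by (subst nn_integral_distr) auto
  finally show ?thesis ..
qed

text \<open>The argument for uniqueness of Haar measure: the double integral of
  \<open>G (R y + x)\<close> against a radial \<open>g\<close> is evaluated in both orders, using
  only translation invariance and that \<open>R\<close> preserves norms. The volume of the unit ball
  then cancels.\<close>

lemma nn_integral_lborel_orthogonal:
  fixes R :: "'a::euclidean_space \<Rightarrow> 'a" and G :: "'a \<Rightarrow> ennreal"
  assumes R: "orthogonal_transformation R" and [measurable]: "G \<in> borel_measurable borel"
  shows "(\<integral>\<^sup>+x. G (R x) \<partial>lborel) = (\<integral>\<^sup>+x. G x \<partial>lborel)"
proof -
  have lin: "linear R" using R by (rule orthogonal_transformation_linear)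
  have [measurable]: "R \<in> borel_measurable borel"
    using lin by (intro borel_measurable_continuous_onI linear_continuous_on) (simp add: linear_conv_bounded_linear)
  have nR: "norm (R x) = norm x" for x using R by (simp add: orthogonal_transformation_norm)
  have surj: "\<exists>c. R c = x" for x
    using orthogonal_transformation_surj[OF R] by (metis surjD)
  define g :: "'a \<Rightarrow> ennreal" where "g x = indicator (ball 0 1) x" for x
  have gm [measurable]: "g \<in> borel_measurable borel" unfolding g_def[abs_def] by (rule borel_measurable_indicator) simp
  have gnorm: "g x = g y" if "norm x = norm y" for x y using that by (auto simp: g_def split: split_indicator)
  define V where "V = (\<integral>\<^sup>+x. g x \<partial>lborel)"
  have V: "V = ennreal (unit_ball_vol DIM('a))" unfolding V_def g_def by (simp add: emeasure_ball)
  have "(\<integral>\<^sup>+x. G x \<partial>lborel) * V = (\<integral>\<^sup>+y. (\<integral>\<^sup>+x. G x \<partial>lborel) * g y \<partial>lborel)"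
    unfolding V_def by (subst nn_integral_cmult) auto
  also have "\<dots> = (\<integral>\<^sup>+y. (\<integral>\<^sup>+x. G (R y + x) * g y \<partial>lborel) \<partial>lborel)"
    by (subst nn_integral_multc) (auto simp: nn_integral_lborel_translate)
  also have "\<dots> = (\<integral>\<^sup>+x. (\<integral>\<^sup>+y. G (R y + x) * g y \<partial>lborel) \<partial>lborel)"
    by (rule lborel_pair.Fubini') measurable
  also have "\<dots> = (\<integral>\<^sup>+x. (\<integral>\<^sup>+y. G (R y) * g (R y - x) \<partial>lborel) \<partial>lborel)"
  proof (rule nn_integral_cong)
    fix x
    obtain c where c: "R c = x" using surj by blast
    have "(\<integral>\<^sup>+y. G (R y + x) * g y \<partial>lborel) = (\<integral>\<^sup>+y. G (R (- c + y) + x) * g (- c + y) \<partial>lborel)"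
      by (rule nn_integral_lborel_translate[symmetric]) measurable
    also have "\<dots> = (\<integral>\<^sup>+y. G (R y) * g (R y - x) \<partial>lborel)"
    proof (intro nn_integral_cong arg_cong2[where f="(*)"])
      fix y
      have "R (- c + y) = R y - x" using lin c by (simp add: linear_diff)
      then show "G (R (- c + y) + x) = G (R y)" "g (- c + y) = g (R y - x)"
        using gnorm[of "- c + y" "R y - x"] nR[of "- c + y"] by auto
    qed
    finally show "(\<integral>\<^sup>+y. G (R y + x) * g y \<partial>lborel) = (\<integral>\<^sup>+y. G (R y) * g (R y - x) \<partial>lborel)" .
  qed
  also have "\<dots> = (\<integral>\<^sup>+y. (\<integral>\<^sup>+x. G (R y) * g (R y - x) \<partial>lborel) \<partial>lborel)"
    by (rule lborel_pair.Fubini') measurable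
  also have "\<dots> = (\<integral>\<^sup>+y. G (R y) * V \<partial>lborel)"
  proof (intro nn_integral_cong)
    fix y
    have "(\<integral>\<^sup>+x. g (R y - x) \<partial>lborel) = (\<integral>\<^sup>+x. g (- R y + x) \<partial>lborel)"
      by (intro nn_integral_cong gnorm) (simp add: norm_minus_commute)
    also have "\<dots> = V" unfolding V_def by (rule nn_integral_lborel_translate) measurable
    finally show "(\<integral>\<^sup>+x. G (R y) * g (R y - x) \<partial>lborel) = G (R y) * V"
      by (subst nn_integral_cmult) auto
  qed
  also have "\<dots> = (\<integral>\<^sup>+y. G (R y) \<partial>lborel) * V" by (rule nn_integral_multc) measurable
  finally have *: "V * (\<integral>\<^sup>+x. G x \<partial>lborel) = V * (\<integral>\<^sup>+x. G (R x) \<partial>lborel)" by (simp add: mult.commute)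
  have "V \<noteq> 0" "V \<noteq> top" using V unit_ball_vol_pos[of "real DIM('a)"] by (auto simp: ennreal_eq_0_iff not_le[symmetric] simp del: unit_ball_vol_pos)
  with * show ?thesis by (auto simp: ennreal_mult_cancel_left)
qed

text \<open>The image of Lebesgue measure under the norm is determined by its values on half-lines,
  that is by the volumes of balls, and their derivative in the radius is the density.\<close>

lemma nn_integral_lborel_radial:
  fixes F :: "real \<Rightarrow> ennreal"
  assumes [measurable]: "F \<in> borel_measurable borel"
  shows "nn_integral lborel (\<lambda>x::'a::euclidean_space. F (norm x)) =
    (\<integral>\<^sup>+r. F r * ennreal (DIM('a) * unit_ball_vol DIM('a) * r ^ (DIM('a) - 1)) * indicator {0..} r \<partial>lborel)"
proof -
  define w where "w r = ennreal (DIM('a) * unit_ball_vol DIM('a) * r ^ (DIM('a) - 1)) * indicator {0..} r" for r :: real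
  have wm [measurable]: "w \<in> borel_measurable borel" unfolding w_def by measurable
  have "distr (lborel :: 'a measure) borel norm = density lborel w"
  proof (rule measure_eqI_generator_eq)
    let ?E = "range (\<lambda>r::real. {..r})"
    show "Int_stable ?E" by (auto simp: Int_stable_def)
    show "?E \<subseteq> Pow UNIV" by simp
    show "sets (distr (lborel :: 'a measure) borel norm) = sigma_sets UNIV ?E"
      using borel_eq_atMost by (metis sets_distr sets_measure_of top_greatest Pow_UNIV)
    show "sets (density lborel w) = sigma_sets UNIV ?E"
      using borel_eq_atMost by (metis sets_density sets_lborel sets_measure_of top_greatest Pow_UNIV)
    show "range (\<lambda>n::nat. {..real n}) \<subseteq> ?E" by auto
    show "(\<Union>n. {..real n}) = UNIV" using real_arch_simple by auto
    have vim: "norm -` {..r} = (cball 0 r :: 'a set)" for r by (auto simp: dist_norm)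
    show "emeasure (distr (lborel :: 'a measure) borel norm) {..real n} \<noteq> \<infinity>" for n
      by (subst emeasure_distr) (auto simp: vim emeasure_cball)
    fix X :: "real set" assume "X \<in> ?E"
    then obtain r where X: "X = {..r}" by auto
    show "emeasure (distr (lborel :: 'a measure) borel norm) X = emeasure (density lborel w) X"
    proof (cases "r \<ge> 0")
      case True
      have "emeasure (density lborel w) X = (\<integral>\<^sup>+x. ennreal (DIM('a) * unit_ball_vol DIM('a) * x ^ (DIM('a) - 1)) * indicator {0..r} x \<partial>lborel)"
        unfolding X by (subst emeasure_density) (auto simp: w_def intro!: nn_integral_cong split: split_indicator)
      also have "\<dots> = unit_ball_vol DIM('a) * r ^ DIM('a) - unit_ball_vol DIM('a) * 0 ^ DIM('a)"
        by (rule nn_integral_FTC_Icc) (use True in \<open>auto intro!: derivative_eq_intros mult_nonneg_nonneg\<close>)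
      also have "\<dots> = emeasure lborel (cball 0 r :: 'a set)" using True by (simp add: emeasure_cball)
      also have "\<dots> = emeasure (distr (lborel :: 'a measure) borel norm) X"
        unfolding X by (subst emeasure_distr) (auto simp: vim)
      finally show ?thesis by simp
    next
      case False
      then have "emeasure (density lborel w) X = 0"
        unfolding X by (subst emeasure_density) (auto simp: w_def nn_integral_0_iff_AE split: split_indicator)
      moreover have "emeasure (distr (lborel :: 'a measure) borel norm) X = 0"
        unfolding X using False by (subst emeasure_distr) (auto simp: vim)
      ultimately show ?thesis by simp
    qed
  qed
  then have "(\<integral>\<^sup>+r. F r \<partial>distr (lborel :: 'a measure) borel norm) = (\<integral>\<^sup>+r. F r \<partial>density lborel w)" by simp
  then show ?thesis
    by (subst (asm) nn_integral_distr, simp, simp, subst (asm) nn_integral_density) (auto simp: w_def mult_ac)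
qed

section \<open>The push-forward under energy and momentum\<close>

text \<open>The one-dimensional core. At mass \<open>c\<close>, the momenta \<open>u\<close> and
  \<open>l - u\<close> arise from \<open>k\<close> and \<open>- k\<close> in the centre-of-mass
  frame by the Lorentz boost that raises the total momentum from 0 to \<open>l\<close>. In that
  frame both energies are \<open>W k\<close>; the Lorentz factor of the boost is \<open>q k\<close>,
  and \<open>g k\<close> is the boosted momentum. The boost itself varies with
  \<open>k\<close>.\<close>

lemma two_particle_substitution:
  fixes c l :: real and h :: "real \<Rightarrow> ennreal"
  assumes c: "c > 0" and l: "l \<ge> 0" and [measurable]: "h \<in> borel_measurable borel"
  shows "(\<integral>\<^sup>+u. h (sqrt (c\<^sup>2 + u\<^sup>2) + sqrt (c\<^sup>2 + (l - u)\<^sup>2)) * ennreal (1 / (sqrt (c\<^sup>2 + u\<^sup>2) * sqrt (c\<^sup>2 + (l - u)\<^sup>2))) \<partial>lborel) =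
    (\<integral>\<^sup>+k. h (2 * sqrt (c\<^sup>2 + k\<^sup>2 + l\<^sup>2 / 4)) * ennreal (1 / (sqrt (c\<^sup>2 + k\<^sup>2) * sqrt (c\<^sup>2 + k\<^sup>2 + l\<^sup>2 / 4))) \<partial>lborel)"
proof -
  define m where "m k = c\<^sup>2 + k\<^sup>2" for k
  define q where "q k = sqrt (1 + l\<^sup>2 / (4 * m k))" for k
  define g where "g k = l / 2 + k * q k" for k
  define g' where "g' k = q k - l\<^sup>2 * k\<^sup>2 / (4 * (m k)\<^sup>2 * q k)" for k
  have m: "m k > 0" for k using c by (simp add: m_def add_pos_nonneg)
  have q1: "1 + l\<^sup>2 / (4 * m k) > 0" for k using m[of k] by (intro add_pos_nonneg) auto
  have q: "q k \<ge> 1" and q2: "(q k)\<^sup>2 = 1 + l\<^sup>2 / (4 * m k)" for k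
    using m[of k] q1[of k] by (auto simp: q_def)
  have q0: "q k > 0" for k using q[of k] by linarith
  define W where "W k = sqrt (m k)" for k
  have W: "W k > 0" "(W k)\<^sup>2 = m k" for k using m[of k] by (auto simp: W_def)
  have Wq: "W k * q k = sqrt (c\<^sup>2 + k\<^sup>2 + l\<^sup>2 / 4)" for k
  proof -
    have "W k * q k = sqrt (m k * (1 + l\<^sup>2 / (4 * m k)))" unfolding W_def q_def by (simp add: real_sqrt_mult)
    also have "m k * (1 + l\<^sup>2 / (4 * m k)) = c\<^sup>2 + k\<^sup>2 + l\<^sup>2 / 4"
      using m[of k] by (simp add: distrib_left) (simp add: m_def)
    finally show ?thesis .
  qed
  have bound: "\<bar>l * k / (2 * W k)\<bar> \<le> W k * q k" for k
  proof (rule power2_le_imp_le)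
    have "\<bar>l * k / (2 * W k)\<bar>\<^sup>2 = l\<^sup>2 * (k\<^sup>2 / m k) / 4"
      using W[of k] by (simp add: power_divide power_mult_distrib)
    also have "\<dots> \<le> l\<^sup>2 * 1 / 4"
      using m[of k] by (intro divide_right_mono mult_left_mono) (auto simp: m_def divide_le_eq_1)
    also have "\<dots> \<le> c\<^sup>2 + k\<^sup>2 + l\<^sup>2 / 4" by simp
    also have "\<dots> = (W k * q k)\<^sup>2" unfolding Wq by simp
    finally show "\<bar>l * k / (2 * W k)\<bar>\<^sup>2 \<le> (W k * q k)\<^sup>2" .
    show "0 \<le> W k * q k" using W[of k] q[of k] by simp
  qed
  \<comment> \<open>The boosted energies. By \<open>bound\<close> both are nonnegative, so the
    square roots of their squares can be opened.\<close>
  have E: "sqrt (c\<^sup>2 + (g k)\<^sup>2) = W k * q k + l * k / (2 * W k)"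
    "sqrt (c\<^sup>2 + (l - g k)\<^sup>2) = W k * q k - l * k / (2 * W k)" for k
  proof -
    have *: "(W k * q k)\<^sup>2 + (l * k / (2 * W k))\<^sup>2 = c\<^sup>2 + l\<^sup>2 / 4 + k\<^sup>2 * (q k)\<^sup>2"
      using m[of k] unfolding power_mult_distrib power_divide W(2) q2
      by (simp add: distrib_left) (simp add: m_def)
    have **: "2 * (W k * q k) * (l * k / (2 * W k)) = l * k * q k" using W(1)[of k] by simp
    have "c\<^sup>2 + (g k)\<^sup>2 = (W k * q k + l * k / (2 * W k))\<^sup>2"
      unfolding power2_sum[of "W k * q k"] ** using * by (simp add: g_def power2_eq_square algebra_simps)
    moreover have "c\<^sup>2 + (l - g k)\<^sup>2 = (W k * q k - l * k / (2 * W k))\<^sup>2"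
      unfolding power2_diff[of "W k * q k"] ** using * by (simp add: g_def power2_eq_square algebra_simps)
    ultimately show "sqrt (c\<^sup>2 + (g k)\<^sup>2) = W k * q k + l * k / (2 * W k)"
      "sqrt (c\<^sup>2 + (l - g k)\<^sup>2) = W k * q k - l * k / (2 * W k)"
      using abs_le_D1[OF bound[of k]] abs_le_D2[OF bound[of k]] by simp_all
  qed
  \<comment> \<open>The product of the energies contains the Jacobian \<open>g'\<close> as a factor,
    so the invariant density absorbs it. Positivity of \<open>g'\<close> is read off from the same
    identity.\<close>
  have EE: "sqrt (c\<^sup>2 + (g k)\<^sup>2) * sqrt (c\<^sup>2 + (l - g k)\<^sup>2) = m k * q k * g' k" for k
  proof -
    have "sqrt (c\<^sup>2 + (g k)\<^sup>2) * sqrt (c\<^sup>2 + (l - g k)\<^sup>2) = (W k)\<^sup>2 * (q k)\<^sup>2 - l\<^sup>2 * k\<^sup>2 / (4 * (W k)\<^sup>2)"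
      unfolding E by (simp add: square_diff_square_factored[symmetric] power2_eq_square algebra_simps)
    also have "\<dots> = m k * q k * g' k"
      unfolding W(2) g'_def using m[of k] q0[of k] by (simp add: field_simps power2_eq_square)
    finally show ?thesis .
  qed
  have pos: "sqrt (c\<^sup>2 + (g k)\<^sup>2) * sqrt (c\<^sup>2 + (l - g k)\<^sup>2) > 0" for k
    using c by (intro mult_pos_pos) (auto simp: add_pos_nonneg)
  have g'pos: "g' k > 0" for k
    using zero_less_mult_pos[OF pos[of k, unfolded EE]] m[of k] q0[of k] by simp
  have D: "(g has_real_derivative g' k) (at k)" for k
  proof -
    have "(q has_real_derivative (- (l\<^sup>2 * (4 * (2 * k))) / (4 * m k)\<^sup>2) * (inverse (q k) / 2)) (at k)"
      unfolding q_def using m[of k] q1[of k]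
      by (auto intro!: derivative_eq_intros simp: m_def power2_eq_square field_simps)
    then have "(g has_real_derivative 1 * q k + k * ((- (l\<^sup>2 * (4 * (2 * k))) / (4 * m k)\<^sup>2) * (inverse (q k) / 2))) (at k)"
      unfolding g_def by (auto intro!: derivative_eq_intros)
    also have "1 * q k + k * ((- (l\<^sup>2 * (4 * (2 * k))) / (4 * m k)\<^sup>2) * (inverse (q k) / 2)) = g' k"
      unfolding g'_def using m[of k] q0[of k] by (simp add: field_simps power2_eq_square)
    finally show ?thesis .
  qed
  have qcont: "continuous_on UNIV q" unfolding q_def m_def
    using c by (intro continuous_intros) (auto simp: add_nonneg_eq_0_iff)
  have mcont: "continuous_on UNIV m" unfolding m_def by (intro continuous_intros)
  have nz: "4 * (m k)\<^sup>2 * q k \<noteq> 0" for k using m[of k] q0[of k] by simp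
  have "continuous_on UNIV g'"
    unfolding g'_def by (intro continuous_intros qcont mcont) (use nz in blast)
  moreover have "filterlim g at_top at_top"
  proof (rule filterlim_at_top_mono)
    show "filterlim (\<lambda>k. k) at_top (at_top :: real filter)" by (rule filterlim_ident)
    show "eventually (\<lambda>k. k \<le> g k) at_top"
      using eventually_ge_at_top[of 0]
    proof eventually_elim
      case (elim k)
      then have "k * 1 \<le> k * q k" using q[of k] by (intro mult_left_mono) auto
      then show ?case using l by (simp add: g_def)
    qed
  qed
  moreover have "filterlim g at_bot at_bot"
  proof (rule filterlim_at_bot_mono)
    show "filterlim (\<lambda>k. l / 2 + k) at_bot (at_bot :: real filter)"
      unfolding filterlim_at_bot
    proof
      fix Z
      show "eventually (\<lambda>k. l / 2 + k \<le> Z) at_bot"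
        using eventually_le_at_bot[of "Z - l / 2"] by eventually_elim simp
    qed
    show "eventually (\<lambda>k. g k \<le> l / 2 + k) at_bot"
      using eventually_le_at_bot[of 0]
    proof eventually_elim
      case (elim k)
      then have "k * q k \<le> k * 1" using q[of k] by (intro mult_left_mono_neg) auto
      then show ?case using l by (simp add: g_def)
    qed
  qed
  ultimately have "(\<integral>\<^sup>+u. h (sqrt (c\<^sup>2 + u\<^sup>2) + sqrt (c\<^sup>2 + (l - u)\<^sup>2)) * ennreal (1 / (sqrt (c\<^sup>2 + u\<^sup>2) * sqrt (c\<^sup>2 + (l - u)\<^sup>2))) \<partial>lborel) =
    (\<integral>\<^sup>+k. (h (sqrt (c\<^sup>2 + (g k)\<^sup>2) + sqrt (c\<^sup>2 + (l - g k)\<^sup>2)) * ennreal (1 / (sqrt (c\<^sup>2 + (g k)\<^sup>2) * sqrt (c\<^sup>2 + (l - g k)\<^sup>2)))) * ennreal (g' k) \<partial>lborel)"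
    using D g'pos by (intro nn_integral_substitution_UNIV) (auto intro: less_imp_le)
  also have "\<dots> = (\<integral>\<^sup>+k. h (2 * sqrt (c\<^sup>2 + k\<^sup>2 + l\<^sup>2 / 4)) * ennreal (1 / (sqrt (c\<^sup>2 + k\<^sup>2) * sqrt (c\<^sup>2 + k\<^sup>2 + l\<^sup>2 / 4))) \<partial>lborel)"
  proof (intro nn_integral_cong)
    fix k
    have 1: "sqrt (c\<^sup>2 + (g k)\<^sup>2) + sqrt (c\<^sup>2 + (l - g k)\<^sup>2) = 2 * sqrt (c\<^sup>2 + k\<^sup>2 + l\<^sup>2 / 4)"
      unfolding E Wq[symmetric] by simp
    have "1 / (sqrt (c\<^sup>2 + (g k)\<^sup>2) * sqrt (c\<^sup>2 + (l - g k)\<^sup>2)) * g' k = 1 / (W k * (W k * q k))"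
      unfolding EE W(2)[symmetric] using g'pos[of k] by (simp add: power2_eq_square)
    also have "\<dots> = 1 / (sqrt (c\<^sup>2 + k\<^sup>2) * sqrt (c\<^sup>2 + k\<^sup>2 + l\<^sup>2 / 4))"
      unfolding Wq by (simp add: W_def m_def)
    finally have 2: "1 / (sqrt (c\<^sup>2 + (g k)\<^sup>2) * sqrt (c\<^sup>2 + (l - g k)\<^sup>2)) * g' k =
      1 / (sqrt (c\<^sup>2 + k\<^sup>2) * sqrt (c\<^sup>2 + k\<^sup>2 + l\<^sup>2 / 4))" .
    show "(h (sqrt (c\<^sup>2 + (g k)\<^sup>2) + sqrt (c\<^sup>2 + (l - g k)\<^sup>2)) * ennreal (1 / (sqrt (c\<^sup>2 + (g k)\<^sup>2) * sqrt (c\<^sup>2 + (l - g k)\<^sup>2)))) * ennreal (g' k) =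
       h (2 * sqrt (c\<^sup>2 + k\<^sup>2 + l\<^sup>2 / 4)) * ennreal (1 / (sqrt (c\<^sup>2 + k\<^sup>2) * sqrt (c\<^sup>2 + k\<^sup>2 + l\<^sup>2 / 4)))"
      unfolding mult.assoc ennreal_mult''[OF less_imp_le[OF g'pos], symmetric] 2 1 ..
  qed
  finally show ?thesis .
qed

text \<open>The two-body phase space density. \<open>\<tau>\<^sup>2 - (norm \<xi>)\<^sup>2\<close>
  is the squared invariant mass of the pair, and a quarter of its excess over
  \<open>(2 * s)\<^sup>2\<close> is the squared momentum of either particle in the centre-of-mass
  frame. The leading factor is the area of the unit sphere; below the threshold there are no
  pairs.\<close>

definition fibre_mass :: "real \<Rightarrow> real \<times> 'a::euclidean_space \<Rightarrow> real" where
  "fibre_mass s = (\<lambda>(\<tau>, \<xi>). if \<tau> > sqrt (4 * s\<^sup>2 + (norm \<xi>)\<^sup>2)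
     then DIM('a) * unit_ball_vol DIM('a) * ((\<tau>\<^sup>2 - (norm \<xi>)\<^sup>2 - (2 * s)\<^sup>2) / 4) powr ((real DIM('a) - 2) / 2)
       / sqrt (\<tau>\<^sup>2 - (norm \<xi>)\<^sup>2)
     else 0)"

lemma borel_measurable_phi [measurable (raw)]:
  "f \<in> borel_measurable M \<Longrightarrow> (\<lambda>x. phi s (f x)) \<in> borel_measurable M"
  unfolding phi_def by measurable

lemma borel_measurable_fibre_mass [measurable]:
  "fibre_mass s \<in> borel_measurable (borel :: (real \<times> 'a::euclidean_space) measure)"
  unfolding fibre_mass_def borel_prod[symmetric] by measurable

lemma phi_pos: "s > 0 \<Longrightarrow> phi s r > 0"
  by (simp add: phi_def add_pos_nonneg)

text \<open>Polar coordinates in \<open>k\<close>, and then the energy \<open>t r\<close> as the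
  variable. One power of \<open>r\<close> goes into the Jacobian \<open>4 * r / t r\<close>, and
  \<open>2 * sqrt (s\<^sup>2 + r\<^sup>2)\<close> is the invariant mass.\<close>

lemma two_particle_fibre_radial:
  fixes h :: "real \<Rightarrow> ennreal" and \<xi> :: "'a::euclidean_space"
  assumes s: "s > 0" and d: "DIM('a) \<ge> 2" and [measurable]: "h \<in> borel_measurable borel"
  shows "nn_integral lborel (\<lambda>k::'a. h (2 * sqrt (s\<^sup>2 + (norm k)\<^sup>2 + (norm \<xi>)\<^sup>2 / 4)) * ennreal (1 / (sqrt (s\<^sup>2 + (norm k)\<^sup>2) * sqrt (s\<^sup>2 + (norm k)\<^sup>2 + (norm \<xi>)\<^sup>2 / 4))))
    = (\<integral>\<^sup>+\<tau>. h \<tau> * ennreal (fibre_mass s (\<tau>, \<xi>)) \<partial>lborel)"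
proof -
  define l where "l = norm \<xi>"
  define S where "S = DIM('a) * unit_ball_vol DIM('a)"
  have S: "S \<ge> 0" by (simp add: S_def)
  define t where "t r = 2 * sqrt (s\<^sup>2 + r\<^sup>2 + l\<^sup>2 / 4)" for r :: real
  have t0: "s\<^sup>2 + r\<^sup>2 + l\<^sup>2 / 4 > 0" for r using s by (simp add: add_pos_nonneg)
  have tpos: "t r > 0" for r using t0[of r] by (simp add: t_def)
  have tsq: "(t r)\<^sup>2 = 4 * s\<^sup>2 + 4 * r\<^sup>2 + l\<^sup>2" for r using t0[of r] by (simp add: t_def power_mult_distrib)
  have t00: "t 0 = sqrt (4 * s\<^sup>2 + l\<^sup>2)"
    using tpos[of 0] tsq[of 0] by (metis abs_of_pos add.right_neutral mult_zero_right power_zero_numeral real_sqrt_abs)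
  have D: "(t has_real_derivative 4 * r / t r) (at r)" for r
    unfolding t_def using t0[of r] by (auto intro!: derivative_eq_intros simp: field_simps)
  have C: "continuous_on UNIV (\<lambda>r. 4 * r / t r)"
    using tpos unfolding t_def by (intro continuous_intros) (auto, metis less_irrefl)
  have top: "filterlim t at_top at_top"
  proof (rule filterlim_at_top_mono)
    show "filterlim (\<lambda>k. k) at_top (at_top :: real filter)" by (rule filterlim_ident)
    show "eventually (\<lambda>k. k \<le> t k) at_top"
      using eventually_ge_at_top[of 0]
    proof eventually_elim
      case (elim k)
      have "k\<^sup>2 \<le> (t k)\<^sup>2" unfolding tsq by simp
      then show ?case using tpos[of k] by (metis less_imp_le power2_le_imp_le)
    qed
  qed
  have "(\<integral>\<^sup>+k. h (2 * sqrt (s\<^sup>2 + (norm k)\<^sup>2 + l\<^sup>2 / 4)) * ennreal (1 / (sqrt (s\<^sup>2 + (norm k)\<^sup>2) * sqrt (s\<^sup>2 + (norm k)\<^sup>2 + l\<^sup>2 / 4))) \<partial>(lborel :: 'a measure))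
    = (\<integral>\<^sup>+r. (h (t r) * ennreal (1 / (sqrt (s\<^sup>2 + r\<^sup>2) * (t r / 2)))) * ennreal (S * r ^ (DIM('a) - 1)) * indicator {0..} r \<partial>lborel)"
    unfolding S_def t_def
    by (subst nn_integral_lborel_radial[where F="\<lambda>r. h (2 * sqrt (s\<^sup>2 + r\<^sup>2 + l\<^sup>2 / 4)) * ennreal (1 / (sqrt (s\<^sup>2 + r\<^sup>2) * sqrt (s\<^sup>2 + r\<^sup>2 + l\<^sup>2 / 4)))"]) auto
  also have "\<dots> = (\<integral>\<^sup>+r. (h (t r) * ennreal (fibre_mass s (t r, \<xi>))) * ennreal (4 * r / t r) * indicator {0..} r \<partial>lborel)"
  proof (intro nn_integral_cong)
    fix r :: real
    show "(h (t r) * ennreal (1 / (sqrt (s\<^sup>2 + r\<^sup>2) * (t r / 2)))) * ennreal (S * r ^ (DIM('a) - 1)) * indicator {0..} r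
      = (h (t r) * ennreal (fibre_mass s (t r, \<xi>))) * ennreal (4 * r / t r) * indicator {0..} r"
    proof (cases "r > 0")
      case True
      have gt: "t r > sqrt (4 * s\<^sup>2 + (norm \<xi>)\<^sup>2)"
        using tsq[of r] tpos[of r] True by (intro real_less_lsqrt[of _ "_"] real_sqrt_less_mono[THEN less_le_trans[of _ "sqrt ((t r)\<^sup>2)"]]) (auto simp: l_def)
      obtain n where n: "DIM('a) = n + 2" using d by (metis add.commute le_Suc_ex)
      have "(r\<^sup>2) powr ((real DIM('a) - 2) / 2) = (r powr 2) powr ((real DIM('a) - 2) / 2)"
        using True by (simp add: powr_numeral)
      also have "\<dots> = r powr (real n)" unfolding powr_powr n by simp
      also have "\<dots> = r ^ n" using True by (simp add: powr_realpow)
      finally have pw: "(r\<^sup>2) powr ((real DIM('a) - 2) / 2) = r ^ n" .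
      have sq: "sqrt (4 * s\<^sup>2 + 4 * r\<^sup>2) = 2 * sqrt (s\<^sup>2 + r\<^sup>2)"
        using real_sqrt_mult[of 4 "s\<^sup>2 + r\<^sup>2"] by (simp add: distrib_left)
      have "fibre_mass s (t r, \<xi>) = S * r ^ n / (2 * sqrt (s\<^sup>2 + r\<^sup>2))"
        using gt pw sq by (simp add: fibre_mass_def tsq S_def[symmetric] l_def[symmetric])
      then have eq: "fibre_mass s (t r, \<xi>) * (4 * r / t r) = 1 / (sqrt (s\<^sup>2 + r\<^sup>2) * (t r / 2)) * (S * r ^ (DIM('a) - 1))"
        by (simp add: n field_simps)
      have "ennreal (fibre_mass s (t r, \<xi>)) * ennreal (4 * r / t r) = ennreal (1 / (sqrt (s\<^sup>2 + r\<^sup>2) * (t r / 2))) * ennreal (S * r ^ (DIM('a) - 1))"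
        using S tpos[of r] True eq by (metis (no_types, lifting) divide_nonneg_pos ennreal_mult'' less_imp_le mult_nonneg_nonneg zero_le_numeral zero_le_power)
      then show ?thesis by (simp add: mult.assoc)
    next
      case False
      \<comment> \<open>At \<open>r = 0\<close> the left side vanishes because
        \<open>DIM('a) - 1\<close> is positive, the right side through its Jacobian; negative
        \<open>r\<close> are removed by the indicator.\<close>
      then show ?thesis using d by (cases "r = 0") (auto simp: zero_power)
    qed
  qed
  also have "\<dots> = (\<integral>\<^sup>+\<tau>. h \<tau> * ennreal (fibre_mass s (\<tau>, \<xi>)) * indicator {t 0..} \<tau> \<partial>lborel)"
    using D C top tpos by (subst nn_integral_substitution_halfline[where g=t and g'="\<lambda>r. 4 * r / t r"])
      (auto simp: less_imp_le)
  also have "\<dots> = (\<integral>\<^sup>+\<tau>. h \<tau> * ennreal (fibre_mass s (\<tau>, \<xi>)) \<partial>lborel)"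
    unfolding t00 by (intro nn_integral_cong) (auto simp: fibre_mass_def l_def split: split_indicator)
  finally show ?thesis unfolding l_def .
qed

text \<open>After a rotation \<open>\<xi>\<close> points along \<open>e\<close>. On a line parallel
  to \<open>e\<close> through \<open>x\<close>, the transverse part \<open>x\<close> enters only
  through the mass \<open>c = sqrt (s\<^sup>2 + (norm x)\<^sup>2)\<close>, so the one-dimensional
  substitution applies. Its result is again the slice of a function on the whole space, now a radial
  one, and the slices can be put together.\<close>

lemma two_particle_fibre:
  fixes h :: "real \<Rightarrow> ennreal" and \<xi> :: "real ^ 'n"
  assumes s: "s > 0" and d: "CARD('n) \<ge> 2" and [measurable]: "h \<in> borel_measurable borel"
  shows "(\<integral>\<^sup>+\<eta>. h (phi s (norm \<eta>) + phi s (norm (\<xi> - \<eta>))) * ennreal (1 / (phi s (norm \<eta>) * phi s (norm (\<xi> - \<eta>)))) \<partial>lborel)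
    = (\<integral>\<^sup>+\<tau>. h \<tau> * ennreal (fibre_mass s (\<tau>, \<xi>)) \<partial>lborel)"
proof -
  define l where "l = norm \<xi>"
  obtain e :: "real ^ 'n" where e: "e \<in> Basis" using nonempty_Basis by blast
  define G where "G \<xi> \<eta> = h (phi s (norm \<eta>) + phi s (norm (\<xi> - \<eta>))) * ennreal (1 / (phi s (norm \<eta>) * phi s (norm (\<xi> - \<eta>))))" for \<xi> \<eta> :: "real ^ 'n"
  have Gm [measurable]: "G \<xi> \<in> borel_measurable borel" for \<xi> unfolding G_def[abs_def] by measurable
  have "norm (l *\<^sub>R e) = norm \<xi>" using e by (simp add: l_def)
  then obtain R where R: "orthogonal_transformation R" "R (l *\<^sub>R e) = \<xi>"
    by (rule orthogonal_transformation_exists)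
  have lin: "linear R" using R(1) by (rule orthogonal_transformation_linear)
  have "(\<integral>\<^sup>+\<eta>. G \<xi> \<eta> \<partial>lborel) = (\<integral>\<^sup>+\<eta>. G \<xi> (R \<eta>) \<partial>lborel)"
    by (rule nn_integral_lborel_orthogonal[OF R(1), symmetric]) measurable
  also have "\<dots> = (\<integral>\<^sup>+\<eta>. G (l *\<^sub>R e) \<eta> \<partial>lborel)"
  proof (intro nn_integral_cong)
    fix \<eta>
    have "\<xi> - R \<eta> = R (l *\<^sub>R e - \<eta>)" using R(2) lin by (simp add: linear_diff)
    then show "G \<xi> (R \<eta>) = G (l *\<^sub>R e) \<eta>"
      by (simp add: G_def orthogonal_transformation_norm[OF R(1)])
  qed
  also have "\<dots> = nn_integral lborel (\<lambda>k::real^'n. h (2 * sqrt (s\<^sup>2 + (norm k)\<^sup>2 + l\<^sup>2 / 4)) * ennreal (1 / (sqrt (s\<^sup>2 + (norm k)\<^sup>2) * sqrt (s\<^sup>2 + (norm k)\<^sup>2 + l\<^sup>2 / 4))))"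
  proof (rule nn_integral_lborel_slice_cong[OF _ _ e])
    fix x :: "real ^ 'n" assume x: "x \<bullet> e = 0"
    define c where "c = sqrt (s\<^sup>2 + (norm x)\<^sup>2)"
    have c: "c > 0" "c\<^sup>2 = s\<^sup>2 + (norm x)\<^sup>2" using s by (auto simp: c_def add_pos_nonneg)
    have n: "(norm (x + u *\<^sub>R e))\<^sup>2 = (norm x)\<^sup>2 + u\<^sup>2" for u
      unfolding power2_norm_eq_inner using x e by (simp add: inner_simps inner_commute power2_eq_square)
    have "norm (l *\<^sub>R e - (x + u *\<^sub>R e)) = norm (x + (u - l) *\<^sub>R e)" for u
      by (metis (no_types, opaque_lifting) add_diff_cancel_left' add_diff_eq diff_add_eq norm_minus_commute scaleR_left_diff_distrib)
    then have n2: "(norm (l *\<^sub>R e - (x + u *\<^sub>R e)))\<^sup>2 = (norm x)\<^sup>2 + (l - u)\<^sup>2" for u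
      by (simp add: n power2_commute)
    have "(\<integral>\<^sup>+u. G (l *\<^sub>R e) (x + u *\<^sub>R e) \<partial>lborel) =
      (\<integral>\<^sup>+u. h (sqrt (c\<^sup>2 + u\<^sup>2) + sqrt (c\<^sup>2 + (l - u)\<^sup>2)) * ennreal (1 / (sqrt (c\<^sup>2 + u\<^sup>2) * sqrt (c\<^sup>2 + (l - u)\<^sup>2))) \<partial>lborel)"
      by (simp add: G_def phi_def n n2 c(2) add.assoc)
    also have "\<dots> = (\<integral>\<^sup>+k. h (2 * sqrt (c\<^sup>2 + k\<^sup>2 + l\<^sup>2 / 4)) * ennreal (1 / (sqrt (c\<^sup>2 + k\<^sup>2) * sqrt (c\<^sup>2 + k\<^sup>2 + l\<^sup>2 / 4))) \<partial>lborel)"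
      by (rule two_particle_substitution) (auto simp: c l_def)
    also have "\<dots> = (\<integral>\<^sup>+u. h (2 * sqrt (s\<^sup>2 + (norm (x + u *\<^sub>R e))\<^sup>2 + l\<^sup>2 / 4)) * ennreal (1 / (sqrt (s\<^sup>2 + (norm (x + u *\<^sub>R e))\<^sup>2) * sqrt (s\<^sup>2 + (norm (x + u *\<^sub>R e))\<^sup>2 + l\<^sup>2 / 4))) \<partial>lborel)"
      by (simp add: n c(2) add.assoc)
    finally show "(\<integral>\<^sup>+u. G (l *\<^sub>R e) (x + u *\<^sub>R e) \<partial>lborel) = \<dots>" .
  qed measurable
  also have "\<dots> = (\<integral>\<^sup>+\<tau>. h \<tau> * ennreal (fibre_mass s (\<tau>, \<xi>)) \<partial>lborel)"
    unfolding l_def by (rule two_particle_fibre_radial) (use s d in auto)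
  finally show ?thesis unfolding G_def .
qed

definition energy_momentum :: "real \<Rightarrow> (real ^ 'n) \<times> (real ^ 'n) \<Rightarrow> real \<times> (real ^ 'n)" where
  "energy_momentum s = (\<lambda>(\<eta>1, \<eta>2). (phi s (norm \<eta>1) + phi s (norm \<eta>2), \<eta>1 + \<eta>2))"

lemma borel_measurable_energy_momentum [measurable]: "energy_momentum s \<in> borel \<rightarrow>\<^sub>M borel"
  unfolding energy_momentum_def borel_prod[symmetric] by measurable

lemma borel_measurable_energy_momentum_pair [measurable]:
  "energy_momentum s \<in> borel \<Otimes>\<^sub>M borel \<rightarrow>\<^sub>M borel"
  using borel_measurable_energy_momentum[of s] by (simp add: borel_prod)

text \<open>For fixed \<open>\<eta>1\<close>, replacing \<open>\<eta>2\<close> by the total momentum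
  is a translation; for fixed total momentum the fibre formula then carries out the integral over
  \<open>\<eta>1\<close>.\<close>

lemma nn_integral_energy_momentum:
  fixes h :: "real \<times> (real ^ 'n) \<Rightarrow> ennreal"
  assumes s: "s > 0" and d: "CARD('n) \<ge> 2" and h [measurable]: "h \<in> borel_measurable borel"
  shows "(\<integral>\<^sup>+z. h (energy_momentum s z) * ennreal (1 / (phi s (norm (fst z)) * phi s (norm (snd z)))) \<partial>lborel)
    = (\<integral>\<^sup>+q. h q * ennreal (fibre_mass s q) \<partial>lborel)"
proof -
  have hm [measurable]: "h \<in> borel_measurable (borel \<Otimes>\<^sub>M borel)" using h by (simp add: borel_prod)
  define G where "G \<eta> \<xi> = h (phi s (norm \<eta>) + phi s (norm (\<xi> - \<eta>)), \<xi>) * ennreal (1 / (phi s (norm \<eta>) * phi s (norm (\<xi> - \<eta>))))" for \<xi> \<eta> :: "real ^ 'n"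
  have "(\<integral>\<^sup>+z. h (energy_momentum s z) * ennreal (1 / (phi s (norm (fst z)) * phi s (norm (snd z)))) \<partial>lborel)
     = (\<integral>\<^sup>+\<eta>1. \<integral>\<^sup>+\<eta>2. h (energy_momentum s (\<eta>1, \<eta>2)) * ennreal (1 / (phi s (norm \<eta>1) * phi s (norm \<eta>2))) \<partial>lborel \<partial>lborel)"
    unfolding lborel_prod[symmetric]
  proof (subst lborel.nn_integral_fst[symmetric])
    have "(\<lambda>z. h (energy_momentum s z) * ennreal (1 / (phi s (norm (fst z)) * phi s (norm (snd z))))) \<in> borel_measurable borel"
      unfolding borel_prod[symmetric] by measurable
    then show "(\<lambda>z. h (energy_momentum s z) * ennreal (1 / (phi s (norm (fst z)) * phi s (norm (snd z))))) \<in> borel_measurable (lborel \<Otimes>\<^sub>M lborel)"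
      by (simp add: lborel_prod)
  qed simp
  also have "\<dots> = (\<integral>\<^sup>+\<eta>1. \<integral>\<^sup>+\<xi>. h (energy_momentum s (\<eta>1, - \<eta>1 + \<xi>)) * ennreal (1 / (phi s (norm \<eta>1) * phi s (norm (- \<eta>1 + \<xi>)))) \<partial>lborel \<partial>lborel)"
  proof (rule nn_integral_cong)
    fix \<eta>1 :: "real ^ 'n"
    show "(\<integral>\<^sup>+\<eta>2. h (energy_momentum s (\<eta>1, \<eta>2)) * ennreal (1 / (phi s (norm \<eta>1) * phi s (norm \<eta>2))) \<partial>lborel)
      = (\<integral>\<^sup>+\<xi>. h (energy_momentum s (\<eta>1, - \<eta>1 + \<xi>)) * ennreal (1 / (phi s (norm \<eta>1) * phi s (norm (- \<eta>1 + \<xi>)))) \<partial>lborel)"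
      unfolding energy_momentum_def case_prod_conv
      by (rule nn_integral_lborel_translate[symmetric, where G="\<lambda>\<eta>2. h (phi s (norm \<eta>1) + phi s (norm \<eta>2), \<eta>1 + \<eta>2) * ennreal (1 / (phi s (norm \<eta>1) * phi s (norm \<eta>2)))"]) measurable
  qed
  also have "\<dots> = (\<integral>\<^sup>+\<eta>. \<integral>\<^sup>+\<xi>. G \<eta> \<xi> \<partial>lborel \<partial>lborel)"
    by (simp add: energy_momentum_def G_def)
  also have "\<dots> = (\<integral>\<^sup>+\<xi>. \<integral>\<^sup>+\<eta>. G \<eta> \<xi> \<partial>lborel \<partial>lborel)"
    unfolding G_def by (rule lborel_pair.Fubini') measurable
  also have "\<dots> = (\<integral>\<^sup>+\<xi>. \<integral>\<^sup>+\<tau>. h (\<tau>, \<xi>) * ennreal (fibre_mass s (\<tau>, \<xi>)) \<partial>lborel \<partial>lborel)"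
    unfolding G_def by (intro nn_integral_cong two_particle_fibre s d) measurable
  also have "\<dots> = (\<integral>\<^sup>+q. h q * ennreal (fibre_mass s q) \<partial>lborel)"
    unfolding lborel_prod[symmetric]
    by (subst lborel_pair.nn_integral_snd) (auto simp: lborel_prod)
  finally show ?thesis .
qed

section \<open>Plancherel and push-forward densities\<close>

lemma has_fourier_transformI_test_function:
  assumes "F \<in> borel_measurable borel" "\<Phi> \<in> borel_measurable borel"
    and "\<And>\<psi>. test_function \<psi> \<Longrightarrow> integrable lborel (\<lambda>p. F p * fourier \<psi> p) \<and> integrable lborel (\<lambda>p. \<Phi> p * \<psi> p) \<and>
      (LINT p|lborel. F p * fourier \<psi> p) = (LINT p|lborel. \<Phi> p * \<psi> p)"
  shows "has_fourier_transform F \<Phi>"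
  unfolding has_fourier_transform_def by (intro conjI allI impI assms(1,2) assms(3)[OF schwartz_imp_test_function, THEN conjunct1]
    assms(3)[OF schwartz_imp_test_function, THEN conjunct2, THEN conjunct1] assms(3)[OF schwartz_imp_test_function, THEN conjunct2, THEN conjunct2])

lemma has_fourier_transform_scale:
  assumes "has_fourier_transform F \<Phi>"
  shows "has_fourier_transform (\<lambda>p. c * F p) (\<lambda>p. c * \<Phi> p)"
  using assms unfolding has_fourier_transform_def by (auto simp: mult.assoc)

lemma has_fourier_transform_cong_AE:
  assumes "has_fourier_transform F \<Phi>" "AE p in lborel. \<Phi> p = \<Phi>' p" "\<Phi>' \<in> borel_measurable borel"
  shows "has_fourier_transform F \<Phi>'"
  unfolding has_fourier_transform_def
proof (intro conjI allI impI)
  have m [measurable]: "F \<in> borel_measurable borel" "\<Phi> \<in> borel_measurable borel" "\<Phi>' \<in> borel_measurable borel"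
    using assms unfolding has_fourier_transform_def by auto
  show "F \<in> borel_measurable borel" "\<Phi>' \<in> borel_measurable borel" by (rule m)+
  fix \<psi> :: "'a \<Rightarrow> complex" assume \<psi>: "schwartz \<psi>"
  have [measurable]: "\<psi> \<in> borel_measurable borel" by (rule schwartz_measurable[OF \<psi>])
  have ae: "AE p in lborel. \<Phi> p * \<psi> p = \<Phi>' p * \<psi> p" using assms(2) by eventually_elim simp
  note 1 = assms(1)[unfolded has_fourier_transform_def]
  show "integrable lborel (\<lambda>p. F p * fourier \<psi> p)" using 1 \<psi> by blast
  have "integrable lborel (\<lambda>p. \<Phi> p * \<psi> p) \<longleftrightarrow> integrable lborel (\<lambda>p. \<Phi>' p * \<psi> p)"
    by (rule integrable_cong_AE[OF _ _ ae]) measurable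
  then show "integrable lborel (\<lambda>p. \<Phi>' p * \<psi> p)" using 1 \<psi> by blast
  have "(LINT p|lborel. \<Phi> p * \<psi> p) = (LINT p|lborel. \<Phi>' p * \<psi> p)"
    by (rule integral_cong_AE[OF _ _ ae]) measurable
  then show "(LINT p|lborel. F p * fourier \<psi> p) = (LINT p|lborel. \<Phi>' p * \<psi> p)" using 1 \<psi> by metis
qed

lemma L2_norm_sq_cong_AE: "AE p in lborel. F p = G p \<Longrightarrow> L2_norm_sq F = L2_norm_sq G"
  unfolding L2_norm_sq_def by (rule nn_integral_cong_AE, erule eventually_mono) simp

text \<open>This is how the product of two waves gets its transform although it need not be
  integrable: it is, up to a constant, the reflected transform of an integrable density.\<close>

lemma has_fourier_transform_inverse:
  fixes \<Phi> :: "'a::euclidean_space \<Rightarrow> complex"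
  assumes int: "integrable lborel \<Phi>"
  shows "has_fourier_transform (\<lambda>p. fourier \<Phi> (- p)) (\<lambda>q. complex_of_real ((2 * pi) ^ DIM('a)) * \<Phi> q)"
proof (rule has_fourier_transformI_test_function)
  have [measurable]: "\<Phi> \<in> borel_measurable borel" using int by (auto dest: borel_measurable_integrable)
  show "(\<lambda>p. fourier \<Phi> (- p)) \<in> borel_measurable borel" by measurable
  show "(\<lambda>q. complex_of_real ((2 * pi) ^ DIM('a)) * \<Phi> q) \<in> borel_measurable borel" by measurable
  fix \<psi> :: "'a \<Rightarrow> complex" assume \<psi>: "test_function \<psi>"
  have [measurable]: "\<psi> \<in> borel_measurable borel" using \<psi> by (auto simp: test_function_def dest: borel_measurable_integrable)
  obtain B where B: "\<And>x. norm (\<psi> x) \<le> B" using \<psi> by (auto simp: test_function_def)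
  have i\<psi>: "integrable lborel (\<lambda>p. fourier \<psi> (- p))"
    using \<psi> by (intro lborel_integrable_uminus) (simp add: test_function_def)
  have 1: "integrable lborel (\<lambda>p. fourier \<Phi> (- p) * fourier \<psi> p)"
  proof (rule Bochner_Integration.integrable_bound)
    show "integrable lborel (\<lambda>p. (LINT x|lborel. norm (\<Phi> x)) * norm (fourier \<psi> p))"
      using \<psi> by (auto simp: test_function_def)
    show "AE p in lborel. norm (fourier \<Phi> (- p) * fourier \<psi> p) \<le> norm ((LINT x|lborel. norm (\<Phi> x)) * norm (fourier \<psi> p))"
      by (intro AE_I2) (auto simp: norm_mult abs_mult intro!: mult_right_mono norm_fourier_le)
  qed measurable
  have 2: "integrable lborel (\<lambda>q. complex_of_real ((2 * pi) ^ DIM('a)) * \<Phi> q * \<psi> q)"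
  proof (rule Bochner_Integration.integrable_bound)
    show "integrable lborel (\<lambda>q. (2 * pi) ^ DIM('a) * B * norm (\<Phi> q))" using int by simp
    have "norm (complex_of_real ((2 * pi) ^ DIM('a)) * \<Phi> q * \<psi> q) \<le> (2 * pi) ^ DIM('a) * B * norm (\<Phi> q)" for q
    proof -
      have "norm (complex_of_real ((2 * pi) ^ DIM('a)) * \<Phi> q * \<psi> q) = ((2 * pi) ^ DIM('a) * norm (\<Phi> q)) * norm (\<psi> q)"
        unfolding norm_mult norm_of_real by simp
      also have "\<dots> \<le> ((2 * pi) ^ DIM('a) * norm (\<Phi> q)) * B" by (intro mult_left_mono B) simp
      finally show ?thesis by (simp only: mult_ac)
    qed
    then show "AE q in lborel. norm (complex_of_real ((2 * pi) ^ DIM('a)) * \<Phi> q * \<psi> q) \<le> norm ((2 * pi) ^ DIM('a) * B * norm (\<Phi> q))"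
      by (intro AE_I2) (auto intro: order_trans[OF _ abs_ge_self])
  qed measurable
  have "(LINT p|lborel. fourier \<Phi> (- p) * fourier \<psi> p) = (LINT p|lborel. fourier \<Phi> p * fourier \<psi> (- p))"
    by (subst lborel_integral_uminus[symmetric]) auto
  also have "\<dots> = (LINT p|lborel. \<Phi> p * fourier (\<lambda>p. fourier \<psi> (- p)) p)"
    by (rule fourier_multiplication_formula[OF int i\<psi>, symmetric])
  also have "\<dots> = (LINT q|lborel. complex_of_real ((2 * pi) ^ DIM('a)) * \<Phi> q * \<psi> q)"
    unfolding test_function_double_fourier[OF \<psi>] by (simp only: mult_ac)
  finally show "integrable lborel (\<lambda>p. fourier \<Phi> (- p) * fourier \<psi> p) \<and> integrable lborel (\<lambda>q. complex_of_real ((2 * pi) ^ DIM('a)) * \<Phi> q * \<psi> q) \<and>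
    (LINT p|lborel. fourier \<Phi> (- p) * fourier \<psi> p) = (LINT q|lborel. complex_of_real ((2 * pi) ^ DIM('a)) * \<Phi> q * \<psi> q)"
    using 1 2 by blast
qed

lemma has_fourier_transform_L2_exists:
  fixes G :: "'a::euclidean_space \<Rightarrow> complex"
  assumes "G \<in> borel_measurable borel" "L2_norm_sq G < \<infinity>"
  shows "\<exists>H. has_fourier_transform H G \<and> ennreal ((2 * pi) ^ DIM('a)) * L2_norm_sq H \<le> L2_norm_sq G"
proof -
  obtain H where "H \<in> borel_measurable borel" "ennreal ((2 * pi) ^ DIM('a)) * L2_norm_sq H \<le> L2_norm_sq G"
    "\<And>\<psi>. test_function \<psi> \<Longrightarrow>
      integrable lborel (\<lambda>x. H x * fourier \<psi> x) \<and> integrable lborel (\<lambda>x. G x * \<psi> x) \<and>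
      (LINT x|lborel. H x * fourier \<psi> x) = (LINT x|lborel. G x * \<psi> x)"
    using L2_inverse_fourier_transform[OF assms] by blast
  then show ?thesis using assms(1) by (intro exI[of _ H] conjI has_fourier_transformI_test_function) auto
qed

text \<open>The existence statement gives one inequality for some function with transform
  \<open>G\<close>, and uniqueness on the left carries it to \<open>H\<close>. In particular
  \<open>H\<close> is square-integrable, so it has a forward transform, which uniqueness on the
  right identifies with \<open>G\<close>; this gives the other inequality.\<close>

theorem plancherel:
  fixes G :: "'a::euclidean_space \<Rightarrow> complex"
  assumes HG: "has_fourier_transform H G" and fin: "L2_norm_sq G < \<infinity>"
  shows "ennreal ((2 * pi) ^ DIM('a)) * L2_norm_sq H = L2_norm_sq G"
proof (rule antisym)
  have Gm: "G \<in> borel_measurable borel" using HG by (simp add: has_fourier_transform_def)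
  obtain H0 where H0: "has_fourier_transform H0 G" "ennreal ((2 * pi) ^ DIM('a)) * L2_norm_sq H0 \<le> L2_norm_sq G"
    using has_fourier_transform_L2_exists[OF Gm fin] by blast
  have eq: "L2_norm_sq H = L2_norm_sq H0"
    by (rule L2_norm_sq_cong_AE[OF has_fourier_transform_unique_left[OF HG H0(1)]])
  show le: "ennreal ((2 * pi) ^ DIM('a)) * L2_norm_sq H \<le> L2_norm_sq G" unfolding eq by (rule H0(2))
  have Hm: "H \<in> borel_measurable borel" using HG by (simp add: has_fourier_transform_def)
  have "L2_norm_sq H \<noteq> \<infinity>"
  proof
    assume "L2_norm_sq H = \<infinity>"
    then have "ennreal ((2 * pi) ^ DIM('a)) * L2_norm_sq H = \<infinity>"
      by (simp add: ennreal_mult_eq_top_iff)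
    with le fin show False by simp
  qed
  then have "L2_norm_sq H < \<infinity>" by (simp add: less_top)
  from L2_fourier_transform[OF Hm this] obtain G' where
    G': "G' \<in> borel_measurable borel" "L2_norm_sq G' \<le> ennreal ((2 * pi) ^ DIM('a)) * L2_norm_sq H"
    "\<And>\<psi>. integrable lborel \<psi> \<Longrightarrow> L2_norm_sq \<psi> < \<infinity> \<Longrightarrow>
      integrable lborel (\<lambda>x. H x * fourier \<psi> x) \<and> integrable lborel (\<lambda>x. G' x * \<psi> x) \<and>
      (LINT x|lborel. H x * fourier \<psi> x) = (LINT x|lborel. G' x * \<psi> x)" by blast
  have "has_fourier_transform H G'"
  proof (rule has_fourier_transformI_test_function[OF Hm G'(1)])
    fix \<psi> :: "'a \<Rightarrow> complex" assume \<psi>: "test_function \<psi>"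
    then have "integrable lborel \<psi>" by (simp add: test_function_def)
    then show "integrable lborel (\<lambda>x. H x * fourier \<psi> x) \<and> integrable lborel (\<lambda>x. G' x * \<psi> x) \<and>
      (LINT x|lborel. H x * fourier \<psi> x) = (LINT x|lborel. G' x * \<psi> x)"
      using test_function_L2(1)[OF \<psi>] by (rule G'(3))
  qed
  from L2_norm_sq_cong_AE[OF has_fourier_transform_unique[OF HG this]] G'(2)
  show "L2_norm_sq G \<le> ennreal ((2 * pi) ^ DIM('a)) * L2_norm_sq H" by simp
qed

text \<open>Radon-Nikodym: the image of the measure with density \<open>A\<close> is finite, and it
  is absolutely continuous because preimages of null sets are null.\<close>

lemma pushforward_density_nonneg:
  fixes A :: "'a::euclidean_space \<Rightarrow> real" and T :: "'a \<Rightarrow> 'b::euclidean_space"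
  assumes int: "integrable lborel A" and nn: "\<And>z. A z \<ge> 0"
    and T [measurable]: "T \<in> borel \<rightarrow>\<^sub>M borel"
    and null: "\<And>N. N \<in> null_sets lborel \<Longrightarrow> AE z in lborel. T z \<notin> N"
  shows "\<exists>\<Phi>::'b \<Rightarrow> real. integrable lborel \<Phi> \<and> (\<forall>h::'b \<Rightarrow> complex. h \<in> borel_measurable borel \<longrightarrow>
    (LINT z|lborel. A z *\<^sub>R h (T z)) = (LINT q|lborel. \<Phi> q *\<^sub>R h q))"
proof -
  have Am [measurable]: "A \<in> borel_measurable borel" using int by (auto dest: borel_measurable_integrable)
  define \<mu> where "\<mu> = distr (density lborel (\<lambda>z. ennreal (A z))) borel T"
  have sets: "sets \<mu> = sets lborel" by (simp add: \<mu>_def)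
  have tot: "emeasure \<mu> UNIV < \<infinity>"
  proof -
    have "emeasure \<mu> UNIV = (\<integral>\<^sup>+z. ennreal (A z) \<partial>lborel)"
      unfolding \<mu>_def by (subst emeasure_distr) (auto simp: emeasure_density)
    also have "\<dots> < \<infinity>" using int nn by (simp add: integrable_iff_bounded)
    finally show ?thesis .
  qed
  have "absolutely_continuous lborel \<mu>"
    unfolding absolutely_continuous_def
  proof
    fix N :: "'b set" assume N: "N \<in> null_sets lborel"
    then have Nm [measurable]: "N \<in> sets borel" by auto
    have "emeasure \<mu> N = (\<integral>\<^sup>+z. ennreal (A z) * indicator (T -` N) z \<partial>lborel)"
      unfolding \<mu>_def using measurable_sets[OF T Nm] by (subst emeasure_distr) (auto simp: emeasure_density)
    also have "\<dots> = (\<integral>\<^sup>+z. 0 \<partial>(lborel :: 'a measure))"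
    proof (rule nn_integral_cong_AE)
      show "AE z in lborel. ennreal (A z) * indicator (T -` N) z = 0"
        using null[OF N] by eventually_elim simp
    qed
    finally show "N \<in> null_sets \<mu>" using N by (intro null_setsI) (auto simp: sets)
  qed
  then obtain f where fm: "f \<in> borel_measurable lborel" and f: "density lborel f = \<mu>"
    using sigma_finite_measure.Radon_Nikodym[OF sigma_finite_lborel _ sets] by blast
  have [measurable]: "f \<in> borel_measurable borel" using fm by simp
  have ftot: "(\<integral>\<^sup>+q. f q \<partial>lborel) < \<infinity>"
    using tot unfolding f[symmetric] by (subst (asm) emeasure_density) auto
  define \<Phi> where "\<Phi> q = enn2real (f q)" for q
  have [measurable]: "\<Phi> \<in> borel_measurable borel" unfolding \<Phi>_def[abs_def] by measurable
  have "AE q in lborel. f q \<noteq> \<infinity>" using ftot by (intro nn_integral_PInf_AE) auto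
  then have ae: "AE q in lborel. f q = ennreal (\<Phi> q)"
    by eventually_elim (simp add: \<Phi>_def less_top ennreal_enn2real)
  then have dens: "density lborel (\<lambda>q. ennreal (\<Phi> q)) = \<mu>"
    unfolding f[symmetric] by (intro density_cong) (auto elim: eventually_mono)
  have "(\<integral>\<^sup>+q. ennreal (\<Phi> q) \<partial>lborel) = (\<integral>\<^sup>+q. f q \<partial>lborel)"
    by (rule nn_integral_cong_AE) (use ae in \<open>auto elim: eventually_mono\<close>)
  then have "integrable lborel \<Phi>" using ftot by (auto simp: integrable_iff_bounded \<Phi>_def)
  moreover have "(LINT z|lborel. A z *\<^sub>R h (T z)) = (LINT q|lborel. \<Phi> q *\<^sub>R h q)"
    if [measurable]: "h \<in> borel_measurable borel" for h :: "'b \<Rightarrow> complex"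
  proof -
    have "(LINT z|lborel. A z *\<^sub>R h (T z)) = (LINT z|density lborel (\<lambda>z. ennreal (A z)). h (T z))"
      by (rule integral_density[symmetric]) (auto simp: nn)
    also have "\<dots> = (LINT q|\<mu>. h q)" unfolding \<mu>_def by (rule integral_distr[symmetric]) auto
    also have "\<dots> = (LINT q|lborel. \<Phi> q *\<^sub>R h q)"
      unfolding dens[symmetric] by (rule integral_density) (auto simp: \<Phi>_def)
    finally show ?thesis .
  qed
  ultimately show ?thesis by blast
qed

lemma integrable_mult_bounded:
  fixes F h :: "'a::euclidean_space \<Rightarrow> complex"
  assumes F: "integrable lborel F" and [measurable]: "h \<in> borel_measurable borel" and B: "\<And>q. norm (h q) \<le> B"
  shows "integrable lborel (\<lambda>q. F q * h q)"
proof (rule Bochner_Integration.integrable_bound)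
  have [measurable]: "F \<in> borel_measurable borel" using F by (auto dest: borel_measurable_integrable)
  show "(\<lambda>q. F q * h q) \<in> borel_measurable lborel" by measurable
  show "integrable lborel (\<lambda>q. B * norm (F q))" using F by simp
  show "AE q in lborel. norm (F q * h q) \<le> norm (B * norm (F q))"
  proof (rule AE_I2)
    fix q
    have "norm (F q * h q) \<le> B * norm (F q)"
      unfolding norm_mult by (subst mult.commute) (intro mult_right_mono B norm_ge_zero)
    then show "norm (F q * h q) \<le> norm (B * norm (F q))" by (rule order_trans) (simp add: abs_ge_self del: abs_mult)
  qed
qed

text \<open>The complex case, by splitting into four nonnegative parts. Boundedness of
  \<open>h\<close> makes all products integrable, so that the four identities may be added.\<close>

lemma pushforward_density:
  fixes A :: "'a::euclidean_space \<Rightarrow> complex" and T :: "'a \<Rightarrow> 'b::euclidean_space"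
  assumes int: "integrable lborel A" and T [measurable]: "T \<in> borel \<rightarrow>\<^sub>M borel"
    and null: "\<And>N. N \<in> null_sets lborel \<Longrightarrow> AE z in lborel. T z \<notin> N"
  shows "\<exists>\<Phi>::'b \<Rightarrow> complex. integrable lborel \<Phi> \<and> (\<forall>h B. h \<in> borel_measurable borel \<longrightarrow> (\<forall>q. norm (h q) \<le> B) \<longrightarrow>
    (LINT z|lborel. A z * h (T z)) = (LINT q|lborel. \<Phi> q * h q))"
proof -
  define good where "good A \<longleftrightarrow> integrable lborel A \<and> (\<exists>\<Phi>::'b \<Rightarrow> complex. integrable lborel \<Phi> \<and> (\<forall>h B. h \<in> borel_measurable borel \<longrightarrow> (\<forall>q. norm (h q) \<le> B) \<longrightarrow>
    (LINT z|lborel. A z * h (T z)) = (LINT q|lborel. \<Phi> q * h q)))" for A :: "'a \<Rightarrow> complex"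
  have real: "good (\<lambda>z. complex_of_real (a z))" if a: "integrable lborel a" "\<And>z. a z \<ge> 0" for a
  proof -
    obtain \<Phi> :: "'b \<Rightarrow> real" where "integrable lborel \<Phi>" "\<And>h :: 'b \<Rightarrow> complex. h \<in> borel_measurable borel \<Longrightarrow> (LINT z|lborel. a z *\<^sub>R h (T z)) = (LINT q|lborel. \<Phi> q *\<^sub>R h q)"
      using pushforward_density_nonneg[OF a T null] by blast
    then show ?thesis unfolding good_def using a(1)
      by (intro conjI exI[of _ "\<lambda>q. complex_of_real (\<Phi> q)"]) (auto simp: scaleR_conv_of_real)
  qed
  have lin: "good (\<lambda>z. A z + c * B z)" if AB: "good A" "good B" for A B c
  proof -
    obtain \<Phi> where \<Phi>: "integrable lborel \<Phi>" "\<And>h B. h \<in> borel_measurable borel \<Longrightarrow> (\<And>q. norm (h q) \<le> B) \<Longrightarrow> (LINT z|lborel. A z * h (T z)) = (LINT q|lborel. \<Phi> q * h q)"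
      using AB(1) unfolding good_def by blast
    obtain \<Psi> where \<Psi>: "integrable lborel \<Psi>" "\<And>h C. h \<in> borel_measurable borel \<Longrightarrow> (\<And>q. norm (h q) \<le> C) \<Longrightarrow> (LINT z|lborel. B z * h (T z)) = (LINT q|lborel. \<Psi> q * h q)"
      using AB(2) unfolding good_def by blast
    have iAB: "integrable lborel A" "integrable lborel B" using AB unfolding good_def by auto
    have "(LINT z|lborel. (A z + c * B z) * h (T z)) = (LINT q|lborel. (\<Phi> q + c * \<Psi> q) * h q)"
      if h [measurable]: "h \<in> borel_measurable borel" and K: "\<And>q. norm (h q) \<le> K" for h :: "'b \<Rightarrow> complex" and K
    proof -
      have "(LINT z|lborel. (A z + c * B z) * h (T z)) = (LINT z|lborel. A z * h (T z) + c * (B z * h (T z)))"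
        by (simp add: distrib_right mult.assoc)
      also have "\<dots> = (LINT z|lborel. A z * h (T z)) + c * (LINT z|lborel. B z * h (T z))"
        by (subst Bochner_Integration.integral_add) (auto intro!: integrable_mult_right integrable_mult_bounded[of _ _ K] iAB K)
      also have "\<dots> = (LINT q|lborel. \<Phi> q * h q) + c * (LINT q|lborel. \<Psi> q * h q)"
        using \<Phi>(2)[OF h K] \<Psi>(2)[OF h K] by simp
      also have "\<dots> = (LINT q|lborel. \<Phi> q * h q + c * (\<Psi> q * h q))"
        by (subst Bochner_Integration.integral_add) (auto intro!: integrable_mult_right integrable_mult_bounded[of _ _ K] \<Phi> \<Psi> K)
      also have "\<dots> = (LINT q|lborel. (\<Phi> q + c * \<Psi> q) * h q)"
        by (simp add: distrib_right mult.assoc)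
      finally show ?thesis .
    qed
    then show ?thesis unfolding good_def using iAB \<Phi>(1) \<Psi>(1)
      by (intro conjI exI[of _ "\<lambda>q. \<Phi> q + c * \<Psi> q"]) (auto intro!: Bochner_Integration.integrable_add integrable_mult_right)
  qed
  have Re: "integrable lborel (\<lambda>z. Re (A z))" and Im: "integrable lborel (\<lambda>z. Im (A z))" using int by auto
  have "good (\<lambda>z. ((complex_of_real (max 0 (Re (A z))) + (-1) * complex_of_real (max 0 (- Re (A z)))) + \<i> * complex_of_real (max 0 (Im (A z)))) + (- \<i>) * complex_of_real (max 0 (- Im (A z))))"
    by (intro lin real) (auto intro!: Re Im Bochner_Integration.integrable_max)
  moreover have "((complex_of_real (max 0 (Re w)) + (-1) * complex_of_real (max 0 (- Re w))) + \<i> * complex_of_real (max 0 (Im w))) + (- \<i>) * complex_of_real (max 0 (- Im w)) = w" for w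
    by (auto simp: complex_eq_iff max_def)
  ultimately have "good A" by (simp only:)
  then show ?thesis unfolding good_def by blast
qed

section \<open>Products of waves\<close>

text \<open>The reversed Cauchy-Schwarz inequality on the mass hyperboloid; it makes the base of the
  numerator in \<open>kg_kernel\<close> nonnegative.\<close>

lemma phi_mult_ge: "s\<^sup>2 + \<eta>1 \<bullet> \<eta>2 \<le> phi s (norm \<eta>1) * phi s (norm \<eta>2)"
proof -
  have "s\<^sup>2 + \<eta>1 \<bullet> \<eta>2 \<le> s\<^sup>2 + norm \<eta>1 * norm \<eta>2" using norm_cauchy_schwarz by simp
  also have "\<dots> \<le> sqrt ((s\<^sup>2 + (norm \<eta>1)\<^sup>2) * (s\<^sup>2 + (norm \<eta>2)\<^sup>2))"
  proof (rule real_le_rsqrt)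
    have "0 \<le> s\<^sup>2 * (norm \<eta>1 - norm \<eta>2)\<^sup>2" by simp
    then show "(s\<^sup>2 + norm \<eta>1 * norm \<eta>2)\<^sup>2 \<le> (s\<^sup>2 + (norm \<eta>1)\<^sup>2) * (s\<^sup>2 + (norm \<eta>2)\<^sup>2)"
      by (simp add: power2_eq_square algebra_simps)
  qed
  finally show ?thesis by (simp add: phi_def real_sqrt_mult)
qed

text \<open>The factor between the kernel and the density times the squared symbol. In its power of
  2, \<open>2 * \<beta>\<close> comes from the symbol, \<open>- (d - 2) / 2\<close> from the
  numerator of \<open>fibre_mass\<close> and \<open>- 1/2\<close> from the invariant mass.\<close>

definition kg_const :: "real \<Rightarrow> nat \<Rightarrow> real" where
  "kg_const \<beta> d = real d * unit_ball_vol (real d) * 2 powr (2 * \<beta> - (real d - 1) / 2)"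

text \<open>With \<open>Y\<close> and \<open>Z\<close> the two bases in the kernel, the squared
  invariant mass of the pair is \<open>2 * Z\<close> and its excess over
  \<open>(2 * s)\<^sup>2\<close> is \<open>2 * Y\<close>. So symbol and density are powers of
  \<open>Y\<close> and \<open>Z\<close>, and the exponents add up to those of the kernel.\<close>

lemma box_symbol_fibre_mass:
  fixes \<eta>1 \<eta>2 :: "real ^ 'n"
  assumes s: "s > 0"
  shows "(box_symbol s \<beta> (energy_momentum s (\<eta>1, \<eta>2)))\<^sup>2 * fibre_mass s (energy_momentum s (\<eta>1, \<eta>2)) =
    kg_const \<beta> CARD('n) * kg_kernel s (1/2) ((real CARD('n) - 2) / 2 + 2 * \<beta>) \<eta>1 \<eta>2"
proof -
  define p where "p = phi s (norm \<eta>1) * phi s (norm \<eta>2) - \<eta>1 \<bullet> \<eta>2"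
  define Y where "Y = p - s\<^sup>2"
  define Z where "Z = p + s\<^sup>2"
  define \<tau> where "\<tau> = phi s (norm \<eta>1) + phi s (norm \<eta>2)"
  define n where "n = (norm (\<eta>1 + \<eta>2))\<^sup>2"
  have Y: "Y \<ge> 0" using phi_mult_ge[of s \<eta>1 \<eta>2] by (simp add: Y_def p_def)
  have Z: "Z = Y + 2 * s\<^sup>2" by (simp add: Y_def Z_def)
  have Zpos: "Z > 0" using Y s by (simp add: Z add_nonneg_pos)
  have \<tau>pos: "\<tau> > 0" using phi_pos[OF s] by (simp add: \<tau>_def add_pos_pos)
  have ph: "(phi s r)\<^sup>2 = s\<^sup>2 + r\<^sup>2" for r by (simp add: phi_def)
  have \<tau>n: "\<tau>\<^sup>2 - n = 2 * Z"
    unfolding \<tau>_def n_def power2_sum ph power2_norm_eq_inner inner_add_left inner_add_right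
    by (simp add: Z_def p_def inner_commute)
  have X: "\<tau>\<^sup>2 - n - (2 * s)\<^sup>2 = 2 * Y" unfolding \<tau>n Z by (simp add: power_mult_distrib)
  define d where "d = real CARD('n)"
  have ker: "kg_kernel s (1/2) ((d - 2) / 2 + 2 * \<beta>) \<eta>1 \<eta>2 = Y powr ((d - 2) / 2 + 2 * \<beta>) / Z powr (1/2)"
    by (simp add: kg_kernel_def Y_def Z_def p_def)
  have box: "box_symbol s \<beta> (energy_momentum s (\<eta>1, \<eta>2)) = (2 * Y) powr \<beta>"
    using X Y by (simp add: box_symbol_def energy_momentum_def \<tau>_def n_def)
  show ?thesis
  proof (cases "Y = 0")
    case True
    \<comment> \<open>At the threshold both sides are 0, since \<open>0 powr b = 0\<close> for every
      \<open>b\<close>.\<close>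
    then show ?thesis using box ker by (simp add: d_def)
  next
    case False
    with Y have Ypos: "Y > 0" by simp
    have "sqrt (4 * s\<^sup>2 + n) < \<tau>"
    proof (rule real_less_lsqrt)
      show "4 * s\<^sup>2 + n < \<tau>\<^sup>2" using X Ypos by (simp add: power_mult_distrib)
    qed (use \<tau>pos in simp)
    then have fm: "fibre_mass s (energy_momentum s (\<eta>1, \<eta>2)) = d * unit_ball_vol d * ((2 * Y) / 4) powr ((d - 2) / 2) / sqrt (2 * Z)"
      unfolding fibre_mass_def energy_momentum_def case_prod_conv \<tau>_def[symmetric] n_def[symmetric] X
      unfolding \<tau>n by (simp add: d_def)
    have e1: "((2 * Y) powr \<beta>)\<^sup>2 = 2 powr (2 * \<beta>) * Y powr (2 * \<beta>)"
    proof -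
      have "((2 * Y) powr \<beta>)\<^sup>2 = (2 * Y) powr (2 * \<beta>)"
        unfolding power2_eq_square powr_add[symmetric] by simp
      then show ?thesis using Ypos by (simp add: powr_mult)
    qed
    have e2: "((2 * Y) / 4) powr ((d - 2) / 2) = Y powr ((d - 2) / 2) * 2 powr (- ((d - 2) / 2))"
    proof -
      have "(2 * Y) / 4 = Y / 2" by simp
      then show ?thesis using Ypos by (simp only: powr_divide[of Y 2]) (simp add: powr_minus_divide)
    qed
    have e3: "sqrt (2 * Z) = 2 powr (1/2) * Z powr (1/2)"
      using Zpos by (simp add: real_sqrt_mult powr_half_sqrt)
    have e4: "2 powr (2 * \<beta>) * 2 powr (- ((d - 2) / 2)) = 2 powr (1/2) * 2 powr (2 * \<beta> - (d - 1) / 2)"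
      unfolding powr_add[symmetric] by (rule arg_cong[where f="(powr) 2"]) (simp add: field_simps)
    have "(box_symbol s \<beta> (energy_momentum s (\<eta>1, \<eta>2)))\<^sup>2 * fibre_mass s (energy_momentum s (\<eta>1, \<eta>2)) =
       d * unit_ball_vol d * (2 powr (2 * \<beta>) * 2 powr (- ((d - 2) / 2))) * (Y powr (2 * \<beta>) * Y powr ((d - 2) / 2)) / (2 powr (1/2) * Z powr (1/2))"
      unfolding box fm e1 e2 e3 by simp
    also have "\<dots> = d * unit_ball_vol d * 2 powr (2 * \<beta> - (d - 1) / 2) * (Y powr ((d - 2) / 2 + 2 * \<beta>) / Z powr (1/2))"
      unfolding e4 by (simp add: powr_add)
    finally show ?thesis unfolding kg_const_def ker[unfolded d_def] d_def .
  qed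
qed

text \<open>The origin of the constant: the squared quotient comes from the transform of the product
  of waves, and \<open>(2 * pi) ^ (d + 1)\<close> on the right from Plancherel in space-time.
  Legendre's duplication formula converts \<open>Gamma (d / 2)\<close> in the volume of the ball
  into the quotient of gamma values in \<open>KG_pp\<close>.\<close>

lemma KG_pp_eq:
  assumes "d \<ge> 2"
  shows "((2 * pi) ^ (d + 1) / ((2 * pi) ^ d)\<^sup>2)\<^sup>2 * kg_const \<beta> d = (2 * pi) ^ (d + 1) * KG_pp \<beta> d"
proof -
  define x where "x = real d"
  have x: "x \<ge> 2" using assms by (simp add: x_def)
  have G: "Gamma (x / 2) > 0" "Gamma (x - 1) > 0" "Gamma ((x - 1) / 2) > 0" using x by (auto intro!: Gamma_real_pos)
  have dup: "Gamma ((x - 1) / 2) * Gamma (x / 2) = 2 powr (2 - x) * sqrt pi * Gamma (x - 1)"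
  proof -
    define z where "z = complex_of_real ((x - 1) / 2)"
    have z: "z + 1/2 = complex_of_real (x / 2)" "2 * z = complex_of_real (x - 1)" "1 - 2 * z = complex_of_real (2 - x)"
      by (simp_all add: z_def complex_eq_iff field_simps)
    have "complex_of_real y \<notin> \<int>\<^sub>\<le>\<^sub>0" if "y > 0" for y
      using that by (auto elim!: nonpos_Ints_cases simp: complex_eq_iff)
    from this[of "(x - 1) / 2"] this[of "x / 2"] have "z \<notin> \<int>\<^sub>\<le>\<^sub>0" "z + 1/2 \<notin> \<int>\<^sub>\<le>\<^sub>0"
      using x unfolding z(1) unfolding z_def by auto
    from Gamma_legendre_duplication[OF this]
    have "complex_of_real (Gamma ((x - 1) / 2) * Gamma (x / 2)) = complex_of_real (exp ((2 - x) * ln 2) * sqrt pi * Gamma (x - 1))"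
      unfolding z(1,3) unfolding z(2) unfolding z_def Gamma_complex_of_real of_real_mult[symmetric] exp_of_real .
    then show ?thesis by (simp only: of_real_eq_iff) (simp add: powr_def)
  qed
  have ratio: "Gamma ((x - 1) / 2) / Gamma (x - 1) = 2 powr (2 - x) * pi powr (1/2) / Gamma (x / 2)"
    using dup G by (simp add: field_simps powr_half_sqrt)
  have G1: "Gamma (x / 2 + 1) = x / 2 * Gamma (x / 2)" using x by (intro Gamma_plus1) (auto elim!: nonpos_Ints_cases)
  have ball: "x * unit_ball_vol x = 2 * pi powr (x / 2) / Gamma (x / 2)"
    unfolding unit_ball_vol_def G1 using x by (simp add: field_simps)
  have pw: "(2 * pi) ^ k = 2 powr (real k) * pi powr (real k)" for k
    by (simp add: powr_realpow[symmetric] powr_mult)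
  have c: "(2 * pi) ^ (d + 1) / ((2 * pi) ^ d)\<^sup>2 = 2 powr (1 - x) * pi powr (1 - x)"
  proof -
    have "(2 * pi) ^ (d + 1) / ((2 * pi) ^ d)\<^sup>2 = (2 powr (x + 1) / 2 powr (2 * x)) * (pi powr (x + 1) / pi powr (2 * x))"
    proof -
      have "((2 * pi) ^ d)\<^sup>2 = (2 * pi) ^ (2 * d)" by (simp only: power_mult[symmetric] mult.commute)
      then show ?thesis unfolding x_def by (simp only: pw) (simp add: add.commute)
    qed
    also have "\<dots> = 2 powr (1 - x) * pi powr (1 - x)"
      by (simp add: powr_diff[symmetric])
    finally show ?thesis .
  qed
  have "((2 * pi) ^ (d + 1) / ((2 * pi) ^ d)\<^sup>2)\<^sup>2 * kg_const \<beta> d =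
    (2 powr (1 - x) * 2 powr (1 - x) * 2 powr 1 * 2 powr (2 * \<beta> - (x - 1) / 2)) * (pi powr (1 - x) * pi powr (1 - x) * pi powr (x / 2)) / Gamma (x / 2)"
    unfolding c kg_const_def x_def[symmetric] ball by (simp add: power2_eq_square)
  also have "\<dots> = (2 powr (x + 1) * 2 powr ((- 5 * x + 1) / 2 + 2 * \<beta>) * 2 powr (2 - x)) * (pi powr (x + 1) * pi powr ((- 5 * x + 1) / 2) * pi powr (1/2)) / Gamma (x / 2)"
    unfolding powr_add[symmetric] by (simp add: field_simps)
  also have "\<dots> = (2 powr (x + 1) * pi powr (x + 1)) * (2 powr ((- 5 * x + 1) / 2 + 2 * \<beta>) * pi powr ((- 5 * x + 1) / 2) * (2 powr (2 - x) * pi powr (1/2) / Gamma (x / 2)))"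
    by simp
  also have "\<dots> = (2 * pi) ^ (d + 1) * KG_pp \<beta> d"
    unfolding ratio[symmetric] pw KG_pp_def by (simp add: x_def add.commute)
  finally show ?thesis .
qed

section \<open>Push-forward densities of pairs of data\<close>

lemma borel_measurable_phi_fst_snd [measurable]:
  "(\<lambda>z. phi s (norm (fst z))) \<in> borel_measurable (borel :: ((real ^ 'n) \<times> (real ^ 'n)) measure)"
  "(\<lambda>z. phi s (norm (snd z))) \<in> borel_measurable (borel :: ((real ^ 'n) \<times> (real ^ 'n)) measure)"
  unfolding borel_prod[symmetric] by measurable

text \<open>The invariant weight is positive everywhere, so the preimage of a null set, which has
  weight zero by the push-forward formula, is itself null.\<close>

lemma AE_energy_momentum_not_in_null:
  fixes N :: "(real \<times> (real ^ 'n)) set"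
  assumes s: "s > 0" and d: "CARD('n) \<ge> 2" and N: "N \<in> null_sets lborel"
  shows "AE z in lborel. energy_momentum s z \<notin> N"
proof -
  have [measurable]: "N \<in> sets borel" using N by auto
  have "(\<integral>\<^sup>+z. indicator N (energy_momentum s z) * ennreal (1 / (phi s (norm (fst z)) * phi s (norm (snd z)))) \<partial>lborel)
    = (\<integral>\<^sup>+q. indicator N q * ennreal (fibre_mass s q) \<partial>lborel)"
    by (rule nn_integral_energy_momentum[OF s d]) measurable
  also have "\<dots> = (\<integral>\<^sup>+q. 0 \<partial>(lborel :: (real \<times> (real ^ 'n)) measure))"
    by (rule nn_integral_cong_AE) (use AE_not_in[OF N] in eventually_elim, simp)
  finally have "AE z in lborel. indicator N (energy_momentum s z) * ennreal (1 / (phi s (norm (fst z)) * phi s (norm (snd z)))) = 0"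
    by (subst nn_integral_0_iff_AE[symmetric]) simp_all
  then show ?thesis
  proof eventually_elim
    case (elim z)
    have "ennreal (1 / (phi s (norm (fst z)) * phi s (norm (snd z)))) \<noteq> 0"
      using phi_pos[OF s] by (simp add: ennreal_eq_0_iff not_le)
    with elim show ?case by (auto split: split_indicator_asm)
  qed
qed

text \<open>Pairs that land where \<open>fibre_mass\<close> is not positive have no weight in the
  push-forward. This permits division by \<open>fibre_mass\<close> along the map.\<close>

lemma AE_fibre_mass_pos:
  assumes s: "s > 0" and d: "CARD('n) \<ge> 2"
  shows "AE z in lborel. fibre_mass s (energy_momentum s (z :: (real ^ 'n) \<times> (real ^ 'n))) > 0"
proof -
  define N where "N = {q :: real \<times> (real ^ 'n). fibre_mass s q \<le> 0}"
  have [measurable]: "N \<in> sets borel" unfolding N_def by measurable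
  have "(\<integral>\<^sup>+z. indicator N (energy_momentum s z) * ennreal (1 / (phi s (norm (fst z)) * phi s (norm (snd z)))) \<partial>lborel)
    = (\<integral>\<^sup>+q. indicator N q * ennreal (fibre_mass s q) \<partial>lborel)"
    by (rule nn_integral_energy_momentum[OF s d]) measurable
  also have "\<dots> = (\<integral>\<^sup>+q. 0 \<partial>(lborel :: (real \<times> (real ^ 'n)) measure))"
    by (intro nn_integral_cong) (auto simp: N_def ennreal_neg split: split_indicator)
  finally have "AE z in lborel. indicator N (energy_momentum s z) * ennreal (1 / (phi s (norm (fst z)) * phi s (norm (snd z)))) = 0"
    by (subst nn_integral_0_iff_AE[symmetric]) simp_all
  then show ?thesis
  proof eventually_elim
    case (elim z)
    have "ennreal (1 / (phi s (norm (fst z)) * phi s (norm (snd z)))) \<noteq> 0"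
      using phi_pos[OF s] by (simp add: ennreal_eq_0_iff not_le)
    with elim show ?case by (auto simp: N_def split: split_indicator_asm)
  qed
qed

text \<open>\<open>\<Phi>\<close> is the density of the complex measure \<open>A dz\<close> pushed
  forward by \<open>energy_momentum\<close>. Bounded \<open>h\<close> suffice, as only plane waves
  and truncated functions are tested.\<close>

definition wave_density :: "real \<Rightarrow> ((real ^ 'n) \<times> (real ^ 'n) \<Rightarrow> complex) \<Rightarrow> (real \<times> (real ^ 'n) \<Rightarrow> complex) \<Rightarrow> bool" where
  "wave_density s A \<Phi> \<longleftrightarrow> integrable lborel A \<and> integrable lborel \<Phi> \<and>
    (\<forall>h B. h \<in> borel_measurable borel \<longrightarrow> (\<forall>q. norm (h q) \<le> B) \<longrightarrow>
      (LINT z|lborel. A z * h (energy_momentum s z)) = (LINT q|lborel. \<Phi> q * h q))"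

lemma wave_density_exists:
  fixes A :: "(real ^ 'n) \<times> (real ^ 'n) \<Rightarrow> complex"
  assumes s: "s > 0" and d: "CARD('n) \<ge> 2" and A: "integrable lborel A"
  shows "\<exists>\<Phi>. wave_density s A \<Phi>"
  using pushforward_density[OF A borel_measurable_energy_momentum AE_energy_momentum_not_in_null[OF s d]] A
  unfolding wave_density_def by blast

lemma integrable_tensor:
  fixes f :: "'a::euclidean_space \<Rightarrow> complex" and g :: "'b::euclidean_space \<Rightarrow> complex"
  assumes "integrable lborel f" "integrable lborel g"
  shows "integrable lborel (\<lambda>z. f (fst z) * g (snd z))"
  using integrable_mult_pair_bounded[OF assms, of "\<lambda>x y. 1" 1] by (simp add: lborel_prod case_prod_beta')

lemma integral_tensor:
  fixes f :: "'a::euclidean_space \<Rightarrow> complex" and g :: "'b::euclidean_space \<Rightarrow> complex"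
  assumes f: "integrable lborel f" and g: "integrable lborel g"
  shows "(LINT z|lborel. f (fst z) * g (snd z)) = (LINT x|lborel. f x) * (LINT y|lborel. g y)"
proof -
  have "integrable (lborel \<Otimes>\<^sub>M lborel) (\<lambda>z. f (fst z) * g (snd z))"
    using integrable_tensor[OF assms] by (simp add: lborel_prod)
  from lborel_pair.integral_fst'[OF this]
  have "(LINT z|lborel. f (fst z) * g (snd z)) = (LINT x|lborel. LINT y|lborel. f x * g y)"
    by (simp add: lborel_prod)
  then show ?thesis by simp
qed

text \<open>The product of the two oscillatory integrals is one integral over pairs with phase
  \<open>p \<bullet> energy_momentum s z\<close>, hence the transform of \<open>\<Phi>\<close> at
  \<open>- p\<close>. The two propagators contribute the denominator of the constant, inversion in
  space-time its numerator.\<close>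

lemma has_fourier_transform_wave_product:
  fixes f g :: "real ^ 'n \<Rightarrow> complex"
  assumes f: "integrable lborel (fourier f)" and g: "integrable lborel (fourier g)"
    and \<Phi>: "wave_density s (\<lambda>z. fourier f (fst z) * fourier g (snd z)) \<Phi>"
  shows "has_fourier_transform (\<lambda>p. kg_propagator s f p * kg_propagator s g p)
    (\<lambda>q. complex_of_real ((2 * pi) ^ (CARD('n) + 1) / ((2 * pi) ^ CARD('n))\<^sup>2) * \<Phi> q)"
proof -
  define c where "c = (2 * pi) ^ CARD('n)"
  have \<Phi>i: "integrable lborel \<Phi>" using \<Phi> by (simp add: wave_density_def)
  have eq: "kg_propagator s f p * kg_propagator s g p = complex_of_real (1 / c\<^sup>2) * fourier \<Phi> (- p)" for p
  proof -
    obtain t x where p: "p = (t, x)" by (cases p)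
    define w where "w \<xi> = x \<bullet> \<xi> + t * phi s (norm \<xi>)" for \<xi>
    have [measurable]: "w \<in> borel_measurable borel" unfolding w_def[abs_def] by measurable
    have i: "integrable lborel (\<lambda>\<xi>. exp (\<i> * complex_of_real (w \<xi>)) * fourier f \<xi>)" "integrable lborel (\<lambda>\<xi>. exp (\<i> * complex_of_real (w \<xi>)) * fourier g \<xi>)"
      by (intro integrable_modulate f g; measurable)+
    have "kg_propagator s f p * kg_propagator s g p = complex_of_real (1 / c\<^sup>2) * ((LINT \<xi>|lborel. exp (\<i> * complex_of_real (w \<xi>)) * fourier f \<xi>) * (LINT \<xi>|lborel. exp (\<i> * complex_of_real (w \<xi>)) * fourier g \<xi>))"
      unfolding kg_propagator_def p c_def w_def by (simp add: power2_eq_square)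
    also have "(LINT \<xi>|lborel. exp (\<i> * complex_of_real (w \<xi>)) * fourier f \<xi>) * (LINT \<xi>|lborel. exp (\<i> * complex_of_real (w \<xi>)) * fourier g \<xi>)
      = (LINT z|lborel. (exp (\<i> * complex_of_real (w (fst z))) * fourier f (fst z)) * (exp (\<i> * complex_of_real (w (snd z))) * fourier g (snd z)))"
      by (rule integral_tensor[OF i, symmetric])
    also have "\<dots> = (LINT z|lborel. (fourier f (fst z) * fourier g (snd z)) * exp (\<i> * complex_of_real (p \<bullet> energy_momentum s z)))"
    proof (intro Bochner_Integration.integral_cong refl)
      fix z :: "(real ^ 'n) \<times> (real ^ 'n)"
      have "p \<bullet> energy_momentum s z = w (fst z) + w (snd z)"
        by (simp add: p energy_momentum_def w_def split_beta inner_Pair inner_add_right algebra_simps)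
      then have "exp (\<i> * complex_of_real (p \<bullet> energy_momentum s z)) = exp (\<i> * complex_of_real (w (fst z))) * exp (\<i> * complex_of_real (w (snd z)))"
        by (simp add: distrib_left exp_add)
      then show "(exp (\<i> * complex_of_real (w (fst z))) * fourier f (fst z)) * (exp (\<i> * complex_of_real (w (snd z))) * fourier g (snd z))
        = (fourier f (fst z) * fourier g (snd z)) * exp (\<i> * complex_of_real (p \<bullet> energy_momentum s z))"
        by (simp only: mult_ac)
    qed
    also have "\<dots> = (LINT q|lborel. \<Phi> q * exp (\<i> * complex_of_real (p \<bullet> q)))"
      using \<Phi> unfolding wave_density_def
      by (elim conjE, elim allE[of _ "\<lambda>q. exp (\<i> * complex_of_real (p \<bullet> q))"], elim allE[of _ 1]) auto
    also have "\<dots> = fourier \<Phi> (- p)" unfolding fourier_def by (simp add: mult.commute inner_commute)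
    finally show ?thesis .
  qed
  have "has_fourier_transform (\<lambda>p. complex_of_real (1 / c\<^sup>2) * fourier \<Phi> (- p)) (\<lambda>q. complex_of_real (1 / c\<^sup>2) * (complex_of_real ((2 * pi) ^ DIM(real \<times> (real ^ 'n))) * \<Phi> q))"
    by (intro has_fourier_transform_scale has_fourier_transform_inverse \<Phi>i)
  moreover have "complex_of_real (1 / c\<^sup>2) * (complex_of_real ((2 * pi) ^ DIM(real \<times> (real ^ 'n))) * \<Phi> q) = complex_of_real ((2 * pi) ^ (CARD('n) + 1) / c\<^sup>2) * \<Phi> q" for q
    by (simp add: add.commute)
  ultimately show ?thesis unfolding eq c_def by (simp only:)
qed

section \<open>The estimate\<close>

lemma borel_measurable_box_symbol [measurable]:
  "box_symbol s \<beta> \<in> borel_measurable (borel :: (real \<times> (real ^ 'n)) measure)"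
  unfolding box_symbol_def borel_prod[symmetric] by measurable

lemma above_mass_shell:
  fixes q :: "real \<times> 'a::euclidean_space"
  assumes "fst q > sqrt (4 * s\<^sup>2 + (norm (snd q))\<^sup>2)"
  shows "(fst q)\<^sup>2 - (norm (snd q))\<^sup>2 - (2 * s)\<^sup>2 > 0" "(fst q)\<^sup>2 - (norm (snd q))\<^sup>2 > 0"
proof -
  have "0 \<le> sqrt (4 * s\<^sup>2 + (norm (snd q))\<^sup>2)" by simp
  then have "(sqrt (4 * s\<^sup>2 + (norm (snd q))\<^sup>2))\<^sup>2 < (fst q)\<^sup>2" using assms by (intro power_strict_mono) auto
  then have 1: "4 * s\<^sup>2 + (norm (snd q))\<^sup>2 < (fst q)\<^sup>2" by simp
  then show "(fst q)\<^sup>2 - (norm (snd q))\<^sup>2 - (2 * s)\<^sup>2 > 0" by (simp add: power_mult_distrib)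
  have "0 \<le> 4 * s\<^sup>2" by simp
  then show "(fst q)\<^sup>2 - (norm (snd q))\<^sup>2 > 0" using 1 by linarith
qed

lemma fibre_mass_pos_iff:
  fixes q :: "real \<times> 'a::euclidean_space"
  shows "fibre_mass s q > 0 \<longleftrightarrow> fst q > sqrt (4 * s\<^sup>2 + (norm (snd q))\<^sup>2)"
proof (cases "fst q > sqrt (4 * s\<^sup>2 + (norm (snd q))\<^sup>2)")
  case True
  have "real DIM('a) * unit_ball_vol (real DIM('a)) * (((fst q)\<^sup>2 - (norm (snd q))\<^sup>2 - (2 * s)\<^sup>2) / 4) powr ((real DIM('a) - 2) / 2)
       / sqrt ((fst q)\<^sup>2 - (norm (snd q))\<^sup>2) > 0"
    using above_mass_shell[OF True] by (intro divide_pos_pos mult_pos_pos) auto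
  then show ?thesis using True by (simp only: fibre_mass_def split_beta if_True)
qed (simp add: fibre_mass_def split_beta)

lemma fibre_mass_nonneg: "fibre_mass s q \<ge> 0"
  using fibre_mass_pos_iff[of s q] by (cases "fst q > sqrt (4 * s\<^sup>2 + (norm (snd q))\<^sup>2)") (auto simp: fibre_mass_def split_beta)

lemma wave_densityD:
  assumes "wave_density s A \<Phi>" "h \<in> borel_measurable borel" "\<And>q. norm (h q) \<le> B"
  shows "(LINT z|lborel. A z * h (energy_momentum s z)) = (LINT q|lborel. \<Phi> q * h q)"
  using assms(1)[unfolded wave_density_def, THEN conjunct2, THEN conjunct2, rule_format, OF assms(2,3)] .

text \<open>Cauchy--Schwarz on the fibres of \<open>energy_momentum\<close>, in dual form: the density is tested against
  its own conjugate times the weight, truncated so that all quantities are finite.\<close>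
lemma wave_density_weighted_bound:
  fixes A :: "(real ^ 'n) \<times> (real ^ 'n) \<Rightarrow> complex" and m :: "real \<times> (real ^ 'n) \<Rightarrow> real"
  assumes s: "s > 0" and d: "CARD('n) \<ge> 2" and \<Phi>: "wave_density s A \<Phi>"
    and mm [measurable]: "m \<in> borel_measurable borel" and m0: "\<And>q. m q \<ge> 0"
    and mpos: "\<And>q. fibre_mass s q > 0 \<Longrightarrow> m q > 0"
  shows "(\<integral>\<^sup>+q. ennreal ((m q)\<^sup>2 * (norm (\<Phi> q))\<^sup>2) \<partial>lborel) \<le>
    (\<integral>\<^sup>+z. ennreal ((norm (A z))\<^sup>2 * (phi s (norm (fst z)) * phi s (norm (snd z))) * ((m (energy_momentum s z))\<^sup>2 * fibre_mass s (energy_momentum s z))) \<partial>lborel)"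
    (is "_ \<le> ?Y")
proof -
  have Am [measurable]: "A \<in> borel_measurable borel" and \<Phi>m [measurable]: "\<Phi> \<in> borel_measurable borel"
    using \<Phi> by (auto simp: wave_density_def dest: borel_measurable_integrable)
  define w where "w z = phi s (norm (fst z)) * phi s (norm (snd z))" for z :: "(real ^ 'n) \<times> (real ^ 'n)"
  have wm [measurable]: "w \<in> borel_measurable borel" unfolding w_def[abs_def] by measurable
  have w: "w z > 0" for z using phi_pos[OF s] by (simp add: w_def)
  let ?T = "energy_momentum s" and ?I = "fibre_mass s"
  \<comment> \<open>Truncation in \<open>\<Phi>\<close>, \<open>m\<close> and \<open>q\<close> makes
    the integral \<open>X\<close> below finite, so that half of it can be absorbed at the
    end.\<close>
  define S where "S N = {q :: real \<times> (real ^ 'n). norm (\<Phi> q) \<le> real N \<and> m q \<le> real N \<and> norm q \<le> real N}" for N :: nat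
  have Sm [measurable]: "S N \<in> sets borel" for N unfolding S_def by measurable
  define F where "F q = (m q)\<^sup>2 * (norm (\<Phi> q))\<^sup>2" for q
  have Fm [measurable]: "F \<in> borel_measurable borel" unfolding F_def[abs_def] by measurable
  have F0: "F q \<ge> 0" for q by (simp add: F_def)
  have main: "(\<integral>\<^sup>+q. ennreal (F q) * indicator (S N) q \<partial>lborel) \<le> ?Y" for N
  proof -
    define X where "X = (\<integral>\<^sup>+q. ennreal (F q) * indicator (S N) q \<partial>lborel)"
    have FS: "F q \<le> real N ^ 4" if "q \<in> S N" for q
    proof -
      have "F q \<le> (real N)\<^sup>2 * (real N)\<^sup>2"
        unfolding F_def using that m0[of q] by (intro mult_mono power_mono) (auto simp: S_def)
      then show ?thesis by (simp add: power_add[symmetric])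
    qed
    have "X \<le> (\<integral>\<^sup>+q. ennreal (real N ^ 4) * indicator (cball 0 (real N)) q \<partial>(lborel :: (real \<times> (real ^ 'n)) measure))"
      unfolding X_def by (intro nn_integral_mono) (auto simp: S_def split: split_indicator intro!: ennreal_leI FS)
    also have "\<dots> < \<infinity>" by (simp add: nn_integral_cmult_indicator emeasure_cball ennreal_mult_less_top)
    finally have Xfin: "X < \<infinity>" .
    \<comment> \<open>Chosen such that \<open>\<Phi> * h\<close> is the truncated integrand
      \<open>F\<close>; it is bounded, as \<open>wave_density\<close> demands.\<close>
    define h where "h q = cnj (\<Phi> q) * complex_of_real ((m q)\<^sup>2) * indicator (S N) q" for q
    have [measurable]: "(\<lambda>q. cnj (\<Phi> q)) \<in> borel_measurable borel"
      by (rule measurable_compose[OF \<Phi>m borel_measurable_continuous_onI[OF continuous_on_cnj[OF continuous_on_id]]])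
    have [measurable]: "(indicator (S N) :: _ \<Rightarrow> complex) \<in> borel_measurable borel"
      by (rule borel_measurable_indicator) simp
    have hm [measurable]: "h \<in> borel_measurable borel" unfolding h_def[abs_def] by measurable
    have nh: "norm (h q) = norm (\<Phi> q) * (m q)\<^sup>2 * indicator (S N) q" for q
      by (simp add: h_def norm_mult norm_power split: split_indicator)
    have hb: "norm (h q) \<le> real N * (real N)\<^sup>2" for q
      unfolding nh using m0[of q] by (auto simp: S_def split: split_indicator intro!: mult_mono power_mono)
    have \<Phi>h: "\<Phi> q * h q = complex_of_real (F q * indicator (S N) q)" for q
      by (simp add: h_def F_def mult.assoc[symmetric] complex_norm_square[symmetric] split: split_indicator)
    have Fi: "integrable lborel (\<lambda>q. F q * indicator (S N) q)"
    proof (rule integrableI_bounded)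
      have "(\<integral>\<^sup>+q. ennreal (norm (F q * indicator (S N) q)) \<partial>lborel) = X"
        unfolding X_def by (intro nn_integral_cong) (simp add: F0 split: split_indicator)
      then show "(\<integral>\<^sup>+q. ennreal (norm (F q * indicator (S N) q)) \<partial>lborel) < \<infinity>" using Xfin by simp
    qed measurable
    have "X = ennreal (LINT q|lborel. F q * indicator (S N) q)"
    proof -
      have "X = (\<integral>\<^sup>+q. ennreal (F q * indicator (S N) q) \<partial>lborel)"
        unfolding X_def by (intro nn_integral_cong) (simp split: split_indicator)
      also have "\<dots> = ennreal (LINT q|lborel. F q * indicator (S N) q)"
        by (rule nn_integral_eq_integral[OF Fi]) (simp add: F0 AE_I2)
      finally show ?thesis .
    qed
    also have "\<dots> \<le> ennreal (norm (LINT q|lborel. \<Phi> q * h q))"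
      unfolding \<Phi>h integral_complex_of_real norm_of_real by (intro ennreal_leI abs_ge_self)
    also have "\<dots> = ennreal (norm (LINT z|lborel. A z * h (?T z)))"
      unfolding wave_densityD[OF \<Phi> hm hb] ..
    also have "\<dots> \<le> (\<integral>\<^sup>+z. ennreal (norm (A z * h (?T z))) \<partial>lborel)"
      by (rule ennreal_norm_integral_le)
    \<comment> \<open>The arithmetic-geometric mean inequality, balanced by the weight
      \<open>v\<close> below. The first term is half of the right-hand side of the claim; the second
      is a function of \<open>energy_momentum\<close> times the invariant weight, which pushes
      forward to an integral of at most \<open>X / 2\<close>.\<close>
    also have "\<dots> \<le> (\<integral>\<^sup>+z. ennreal ((norm (A z))\<^sup>2 * w z * ((m (?T z))\<^sup>2 * ?I (?T z))) * ennreal (1/2) +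
        ennreal ((norm (h (?T z)))\<^sup>2 / ((m (?T z))\<^sup>2 * ?I (?T z)) / 2) * ennreal (1 / w z) \<partial>lborel)"
    proof (rule nn_integral_mono_AE)
      show "AE z in lborel. ennreal (norm (A z * h (?T z))) \<le> ennreal ((norm (A z))\<^sup>2 * w z * ((m (?T z))\<^sup>2 * ?I (?T z))) * ennreal (1/2) +
        ennreal ((norm (h (?T z)))\<^sup>2 / ((m (?T z))\<^sup>2 * ?I (?T z)) / 2) * ennreal (1 / w z)"
        using AE_fibre_mass_pos[OF s d]
      proof eventually_elim
        case (elim z)
        define a where "a = norm (A z)"
        define b where "b = norm (h (?T z))"
        define v where "v = w z * ((m (?T z))\<^sup>2 * ?I (?T z))"
        have v: "v > 0" using w[of z] mpos[OF elim] elim by (simp add: v_def)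
        have "0 \<le> (a * sqrt v - b / sqrt v)\<^sup>2" by simp
        also have "\<dots> = a\<^sup>2 * v + b\<^sup>2 / v - 2 * (a * b)"
          using v by (simp add: power2_diff power_mult_distrib power_divide)
        finally have "a * b \<le> a\<^sup>2 * v / 2 + b\<^sup>2 / v / 2" by simp
        then have "ennreal (a * b) \<le> ennreal (a\<^sup>2 * v / 2 + b\<^sup>2 / v / 2)" by (rule ennreal_leI)
        also have "\<dots> = ennreal (a\<^sup>2 * v / 2) + ennreal (b\<^sup>2 / v / 2)" using v by (intro ennreal_plus) auto
        also have "ennreal (a\<^sup>2 * v / 2) = ennreal (a\<^sup>2 * v) * ennreal (1/2)"
          using v by (subst ennreal_mult[symmetric]) auto
        also have "b\<^sup>2 / v / 2 = (b\<^sup>2 / ((m (?T z))\<^sup>2 * ?I (?T z)) / 2) * (1 / w z)"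
          unfolding v_def by simp
        also have "ennreal \<dots> = ennreal (b\<^sup>2 / ((m (?T z))\<^sup>2 * ?I (?T z)) / 2) * ennreal (1 / w z)"
          using w[of z] elim by (intro ennreal_mult) auto
        finally show ?case unfolding a_def b_def v_def norm_mult mult.assoc .
      qed
    qed
    also have "\<dots> = (\<integral>\<^sup>+z. ennreal ((norm (A z))\<^sup>2 * w z * ((m (?T z))\<^sup>2 * ?I (?T z))) * ennreal (1/2) \<partial>lborel) +
        (\<integral>\<^sup>+z. ennreal ((norm (h (?T z)))\<^sup>2 / ((m (?T z))\<^sup>2 * ?I (?T z)) / 2) * ennreal (1 / w z) \<partial>lborel)"
      by (rule nn_integral_add) measurable
    also have "\<dots> = ?Y * ennreal (1/2) + (\<integral>\<^sup>+q. ennreal ((norm (h q))\<^sup>2 / ((m q)\<^sup>2 * ?I q) / 2) * ennreal (?I q) \<partial>lborel)"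
      unfolding w_def
      by (rule arg_cong2[where f="(+)"], rule nn_integral_multc, measurable)
        (rule nn_integral_energy_momentum[OF s d, of "\<lambda>q. ennreal ((norm (h q))\<^sup>2 / ((m q)\<^sup>2 * ?I q) / 2)"], measurable)
    also have "\<dots> \<le> ?Y * ennreal (1/2) + (\<integral>\<^sup>+q. ennreal (F q) * indicator (S N) q * ennreal (1/2) \<partial>lborel)"
    proof (intro add_left_mono nn_integral_mono)
      fix q
      show "ennreal ((norm (h q))\<^sup>2 / ((m q)\<^sup>2 * ?I q) / 2) * ennreal (?I q) \<le> ennreal (F q) * indicator (S N) q * ennreal (1/2)"
      proof (cases "?I q > 0 \<and> q \<in> S N")
        case True
        then have eq: "(norm (h q))\<^sup>2 / ((m q)\<^sup>2 * ?I q) / 2 * ?I q = F q * (1/2)"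
          unfolding nh F_def using mpos[of q] by (simp add: power_mult_distrib power2_eq_square)
        have "ennreal ((norm (h q))\<^sup>2 / ((m q)\<^sup>2 * ?I q) / 2) * ennreal (?I q) = ennreal ((norm (h q))\<^sup>2 / ((m q)\<^sup>2 * ?I q) / 2 * ?I q)"
          using True by (intro ennreal_mult[symmetric]) auto
        also have "\<dots> = ennreal (F q) * ennreal (1/2)"
          unfolding eq using F0[of q] by (intro ennreal_mult) auto
        finally show ?thesis using True by simp
      next
        case False
        then show ?thesis using fibre_mass_nonneg[of s q] by (auto simp: nh ennreal_neg)
      qed
    qed
    also have "\<dots> = ?Y * ennreal (1/2) + X * ennreal (1/2)"
      unfolding X_def by (rule arg_cong2[where f="(+)"], rule refl, rule nn_integral_multc) measurable
    finally have le: "X \<le> ?Y * ennreal (1/2) + X * ennreal (1/2)" .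
    show "X \<le> ?Y"
    proof (cases "?Y = \<infinity>")
      case False
      then have "?Y < top" by (simp add: less_top)
      then obtain y where y: "?Y = ennreal y" "y \<ge> 0" by (auto simp: less_top_ennreal)
      obtain x where x: "X = ennreal x" "x \<ge> 0" using Xfin by (auto simp: less_top_ennreal)
      have "ennreal x \<le> ennreal (y * (1/2) + x * (1/2))"
        using le x(2) y(2) unfolding x(1) y(1) by (simp only: ennreal_plus ennreal_mult' mult_nonneg_nonneg zero_le_divide_1_iff zero_le_numeral)
      then have "x \<le> y * (1/2) + x * (1/2)" using x(2) y(2) by (subst (asm) ennreal_le_iff) auto
      then show ?thesis unfolding x y by (intro ennreal_leI) simp
    qed simp
  qed
  have inc: "incseq S"
    unfolding incseq_def S_def by (auto intro: order_trans)
  have un: "(\<Union>N. S N) = UNIV"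
  proof (intro set_eqI iffI UNIV_I)
    fix q :: "real \<times> (real ^ 'n)"
    obtain N :: nat where "max (norm (\<Phi> q)) (max (m q) (norm q)) \<le> real N" using real_arch_simple by blast
    then have "q \<in> S N" by (simp add: S_def)
    then show "q \<in> (\<Union>N. S N)" by blast
  qed
  have "(\<lambda>N. \<integral>\<^sup>+q. ennreal (F q) * indicator (S N) q \<partial>lborel) \<longlonglongrightarrow> (\<integral>\<^sup>+q. ennreal (F q) * indicator (\<Union>N. S N) q \<partial>lborel)"
    by (rule nn_integral_indicator_incseq_LIMSEQ[OF _ _ inc]) measurable
  then have "(\<integral>\<^sup>+q. ennreal (F q) * indicator (\<Union>N. S N) q \<partial>lborel) \<le> ?Y"
    by (rule LIMSEQ_le_const2) (use main in blast)
  then show ?thesis unfolding un F_def by simp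
qed

lemma box_symbol_nonneg: "box_symbol s \<beta> q \<ge> 0"
  by (simp add: box_symbol_def split_beta)

lemma box_symbol_pos: "fibre_mass s q > 0 \<Longrightarrow> box_symbol s \<beta> q > 0"
  unfolding fibre_mass_pos_iff by (drule above_mass_shell(1)) (simp add: box_symbol_def split_beta)

lemma kg_const_pos: "d > 0 \<Longrightarrow> kg_const \<beta> d > 0"
  by (simp add: kg_const_def)

lemma KG_pp_pos: "d \<ge> 2 \<Longrightarrow> KG_pp \<beta> d > 0"
  unfolding KG_pp_def by (intro divide_pos_pos mult_pos_pos Gamma_real_pos) auto

section \<open>From the weighted bound to the estimate\<close>

abbreviation (input) wave_factor :: "nat \<Rightarrow> real" where
  "wave_factor d \<equiv> (2 * pi) ^ (d + 1) / ((2 * pi) ^ d)\<^sup>2"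

lemma L2_norm_sq_box_symbol_mult:
  fixes \<Phi> :: "real \<times> (real ^ 'n) \<Rightarrow> complex"
  assumes [measurable]: "\<Phi> \<in> borel_measurable borel"
  shows "L2_norm_sq (\<lambda>q. complex_of_real (box_symbol s \<beta> q) * (complex_of_real c * \<Phi> q)) =
    ennreal (c\<^sup>2) * (\<integral>\<^sup>+q. ennreal ((box_symbol s \<beta> q)\<^sup>2 * (norm (\<Phi> q))\<^sup>2) \<partial>lborel)"
proof -
  have "L2_norm_sq (\<lambda>q. complex_of_real (box_symbol s \<beta> q) * (complex_of_real c * \<Phi> q)) =
    (\<integral>\<^sup>+q. ennreal (c\<^sup>2) * ennreal ((box_symbol s \<beta> q)\<^sup>2 * (norm (\<Phi> q))\<^sup>2) \<partial>lborel)"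
    unfolding L2_norm_sq_def by (intro nn_integral_cong) (simp add: norm_mult power_mult_distrib ennreal_mult'[symmetric] mult_ac)
  also have "\<dots> = ennreal (c\<^sup>2) * (\<integral>\<^sup>+q. ennreal ((box_symbol s \<beta> q)\<^sup>2 * (norm (\<Phi> q))\<^sup>2) \<partial>lborel)"
    by (rule nn_integral_cmult) measurable
  finally show ?thesis .
qed

lemma kg_const_mult_kg_integral:
  fixes f g :: "real ^ 'n \<Rightarrow> complex"
  assumes s: "s > 0" and [measurable]: "fourier f \<in> borel_measurable borel" "fourier g \<in> borel_measurable borel"
  shows "ennreal (kg_const \<beta> CARD('n)) * kg_integral s \<beta> f g =
    (\<integral>\<^sup>+z. ennreal ((norm (fourier f (fst z) * fourier g (snd z)))\<^sup>2 * (phi s (norm (fst z)) * phi s (norm (snd z))) *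
      ((box_symbol s \<beta> (energy_momentum s z))\<^sup>2 * fibre_mass s (energy_momentum s z))) \<partial>lborel)"
proof -
  have kc: "kg_const \<beta> CARD('n) > 0" by (simp add: kg_const_pos)
  define G where "G z = (norm (fourier f (fst z) * fourier g (snd z)))\<^sup>2 * (phi s (norm (fst z)) * phi s (norm (snd z))) *
      ((box_symbol s \<beta> (energy_momentum s z))\<^sup>2 * fibre_mass s (energy_momentum s z))" for z
  have "kg_integral s \<beta> f g = (\<integral>\<^sup>+z. ennreal (1 / kg_const \<beta> CARD('n)) * ennreal (G z) \<partial>lborel)"
    unfolding kg_integral_def
  proof (rule nn_integral_cong)
    fix z :: "(real ^ 'n) \<times> (real ^ 'n)"
    obtain \<eta>1 \<eta>2 where z: "z = (\<eta>1, \<eta>2)" by (cases z)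
    have "1 / kg_const \<beta> CARD('n) * G z = (norm (fourier f \<eta>1))\<^sup>2 * (norm (fourier g \<eta>2))\<^sup>2 * phi s (norm \<eta>1) * phi s (norm \<eta>2)
          * kg_kernel s (1/2) ((real CARD('n) - 2) / 2 + 2 * \<beta>) \<eta>1 \<eta>2"
      unfolding G_def z box_symbol_fibre_mass[OF s] using kc by (simp add: norm_mult power_mult_distrib)
    then show "(case z of (\<eta>1, \<eta>2) \<Rightarrow> ennreal ((norm (fourier f \<eta>1))\<^sup>2 * (norm (fourier g \<eta>2))\<^sup>2
          * phi s (norm \<eta>1) * phi s (norm \<eta>2) * kg_kernel s (1/2) ((real CARD('n) - 2) / 2 + 2 * \<beta>) \<eta>1 \<eta>2)) = ennreal (1 / kg_const \<beta> CARD('n)) * ennreal (G z)"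
      using kc by (simp add: z ennreal_mult'[symmetric])
  qed
  also have "\<dots> = ennreal (1 / kg_const \<beta> CARD('n)) * (\<integral>\<^sup>+z. ennreal (G z) \<partial>lborel)"
  proof (rule nn_integral_cmult)
    have [measurable]: "(\<lambda>z. fourier f (fst z)) \<in> borel_measurable (borel :: ((real ^ 'n) \<times> (real ^ 'n)) measure)"
      "(\<lambda>z. fourier g (snd z)) \<in> borel_measurable (borel :: ((real ^ 'n) \<times> (real ^ 'n)) measure)"
      unfolding borel_prod[symmetric] by measurable
    show "(\<lambda>z. ennreal (G z)) \<in> borel_measurable lborel" unfolding G_def by measurable
  qed
  finally have "ennreal (kg_const \<beta> CARD('n)) * kg_integral s \<beta> f g = (ennreal (kg_const \<beta> CARD('n)) * ennreal (1 / kg_const \<beta> CARD('n))) * (\<integral>\<^sup>+z. ennreal (G z) \<partial>lborel)"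
    by (simp only: mult.assoc)
  also have "ennreal (kg_const \<beta> CARD('n)) * ennreal (1 / kg_const \<beta> CARD('n)) = 1"
    using kc by (subst ennreal_mult[symmetric]) auto
  finally show ?thesis unfolding G_def by simp
qed

text \<open>The existential choice hidden in \<open>fourier_multiplier\<close> is harmless: by
  uniqueness, any admissible transform of the product is the explicit one almost everywhere.\<close>

lemma kg_box_product_has_fourier_transform:
  fixes f g :: "real ^ 'n \<Rightarrow> complex"
  assumes fi: "integrable lborel (fourier f)" "integrable lborel (fourier g)"
    and \<Phi>: "wave_density s (\<lambda>z. fourier f (fst z) * fourier g (snd z)) \<Phi>"
    and H: "kg_box_product s \<beta> f g H"
  shows "has_fourier_transform H (\<lambda>q. complex_of_real (box_symbol s \<beta> q) * (complex_of_real (wave_factor CARD('n)) * \<Phi> q))"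
proof -
  note ft = has_fourier_transform_wave_product[OF fi \<Phi>]
  have \<Phi>m [measurable]: "\<Phi> \<in> borel_measurable borel" using \<Phi> by (auto simp: wave_density_def dest: borel_measurable_integrable)
  obtain \<Phi>' where 1: "has_fourier_transform (\<lambda>p. kg_propagator s f p * kg_propagator s g p) \<Phi>'"
    and 2: "has_fourier_transform H (\<lambda>p. complex_of_real (box_symbol s \<beta> p) * \<Phi>' p)"
    using H unfolding kg_box_product_def fourier_multiplier_def by blast
  show ?thesis
  proof (rule has_fourier_transform_cong_AE[OF 2])
    show "AE p in lborel. complex_of_real (box_symbol s \<beta> p) * \<Phi>' p = complex_of_real (box_symbol s \<beta> p) * (complex_of_real (wave_factor CARD('n)) * \<Phi> p)"
      using has_fourier_transform_unique[OF 1 ft] by eventually_elim simp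
  qed measurable
qed

text \<open>The weight in the fibrewise bound is \<open>box_symbol\<close>, for which the fibre term
  becomes the kernel. The factor \<open>(2 * pi) ^ (CARD('n) + 1)\<close> is carried along until
  Plancherel in space-time cancels it.\<close>

lemma kg_box_product_exists_and_bound:
  fixes f g :: "real ^ 'n \<Rightarrow> complex"
  assumes d: "CARD('n) \<ge> 2" and s: "s > 0" and nice: "nice_pair s \<beta> f g"
  shows "\<exists>H. kg_box_product s \<beta> f g H"
    and "kg_box_product s \<beta> f g H \<Longrightarrow> L2_norm_sq H \<le> ennreal (KG_pp \<beta> CARD('n)) * kg_integral s \<beta> f g"
proof -
  have fi: "integrable lborel (fourier f)" "integrable lborel (fourier g)" and fin: "kg_integral s \<beta> f g < \<infinity>"
    using nice by (auto simp: nice_pair_def)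
  have [measurable]: "fourier f \<in> borel_measurable borel" "fourier g \<in> borel_measurable borel"
    using fi by (auto dest: borel_measurable_integrable)
  obtain \<Phi> where \<Phi>: "wave_density s (\<lambda>z. fourier f (fst z) * fourier g (snd z)) \<Phi>"
    using wave_density_exists[OF s d integrable_tensor[OF fi]] by blast
  have \<Phi>m [measurable]: "\<Phi> \<in> borel_measurable borel" using \<Phi> by (auto simp: wave_density_def dest: borel_measurable_integrable)
  let ?c = "wave_factor CARD('n)"
  note ft = has_fourier_transform_wave_product[OF fi \<Phi>]
  define G where "G q = complex_of_real (box_symbol s \<beta> q) * (complex_of_real ?c * \<Phi> q)" for q
  have Gm: "G \<in> borel_measurable borel" unfolding G_def[abs_def] by measurable
  have "L2_norm_sq G \<le> ennreal (?c\<^sup>2) * (ennreal (kg_const \<beta> CARD('n)) * kg_integral s \<beta> f g)"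
    unfolding G_def L2_norm_sq_box_symbol_mult[OF \<Phi>m] kg_const_mult_kg_integral[OF s \<open>fourier f \<in> borel_measurable borel\<close> \<open>fourier g \<in> borel_measurable borel\<close>]
    by (intro mult_left_mono wave_density_weighted_bound[OF s d \<Phi>] box_symbol_nonneg box_symbol_pos) auto
  also have "\<dots> = ennreal (?c\<^sup>2 * kg_const \<beta> CARD('n)) * kg_integral s \<beta> f g"
    by (subst ennreal_mult') (auto simp: mult.assoc kg_const_pos less_imp_le)
  also have "\<dots> = ennreal ((2 * pi) ^ (CARD('n) + 1)) * (ennreal (KG_pp \<beta> CARD('n)) * kg_integral s \<beta> f g)"
    unfolding KG_pp_eq[OF d] using KG_pp_pos[OF d, of \<beta>] by (subst ennreal_mult) (auto simp: mult.assoc)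
  finally have L2: "L2_norm_sq G \<le> ennreal ((2 * pi) ^ (CARD('n) + 1)) * (ennreal (KG_pp \<beta> CARD('n)) * kg_integral s \<beta> f g)" .
  also have "\<dots> < \<infinity>" using fin by (simp add: ennreal_mult_less_top)
  finally have Gfin: "L2_norm_sq G < \<infinity>" .
  obtain H0 where "has_fourier_transform H0 G" using has_fourier_transform_L2_exists[OF Gm Gfin] by blast
  then show "\<exists>H. kg_box_product s \<beta> f g H"
    unfolding kg_box_product_def fourier_multiplier_def G_def using ft by blast
  show "L2_norm_sq H \<le> ennreal (KG_pp \<beta> CARD('n)) * kg_integral s \<beta> f g" if "kg_box_product s \<beta> f g H"
  proof -
    have "has_fourier_transform H G"
      unfolding G_def by (rule kg_box_product_has_fourier_transform[OF fi \<Phi> that])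
    from plancherel[OF this Gfin] L2
    have "ennreal ((2 * pi) ^ (CARD('n) + 1)) * L2_norm_sq H \<le> ennreal ((2 * pi) ^ (CARD('n) + 1)) * (ennreal (KG_pp \<beta> CARD('n)) * kg_integral s \<beta> f g)"
      by (simp add: add.commute)
    then show ?thesis
      by (subst (asm) ennreal_mult_le_mult_iff) (auto simp: ennreal_eq_0_iff not_le)
  qed
qed

section \<open>Extremal data\<close>

lemma power_le_exp: "(r::real) \<ge> 0 \<Longrightarrow> r ^ k \<le> real k ^ k * exp r"
proof (cases "k = 0")
  case False
  assume r: "r \<ge> 0"
  have "r / real k \<le> exp (r / real k)" using exp_ge_add_one_self[of "r / real k"] by linarith
  then have "(r / real k) ^ k \<le> exp (r / real k) ^ k" using r by (intro power_mono) auto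
  also have "\<dots> = exp r" using False by (simp add: exp_of_nat_mult[symmetric])
  finally show ?thesis using False by (simp add: power_divide field_simps)
qed simp

lemma nn_integral_exp_norm_finite: "(\<integral>\<^sup>+x. ennreal (exp (- norm x)) \<partial>(lborel :: 'a::euclidean_space measure)) < \<infinity>"
proof -
  define k where "k = 2 * DIM('a)"
  define C where "C = real k ^ k * exp 1"
  have "(\<integral>\<^sup>+x. ennreal (exp (- norm x)) \<partial>(lborel :: 'a measure)) \<le> (\<integral>\<^sup>+x. ennreal (C * weight x) \<partial>(lborel :: 'a measure))"
  proof (intro nn_integral_mono ennreal_leI)
    fix x :: 'a
    have "exp (- norm x) * 1 \<le> exp (- norm x) * (weight x * (1 + norm x) ^ k)"
      unfolding k_def by (intro mult_left_mono weight_ge) auto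
    also have "\<dots> \<le> exp (- norm x) * (weight x * (real k ^ k * exp (1 + norm x)))"
      using weight_pos[of x] by (intro mult_left_mono power_le_exp) auto
    also have "\<dots> = C * weight x" unfolding C_def exp_add exp_minus by simp
    finally show "exp (- norm x) \<le> C * weight x" by simp
  qed
  also have "\<dots> < \<infinity>"
  proof -
    have "integrable lborel (\<lambda>x::'a. C * weight x)" by (intro integrable_mult_right integrable_weight)
    then have "(\<integral>\<^sup>+x. ennreal (norm (C * weight x)) \<partial>(lborel :: 'a measure)) < \<infinity>" unfolding integrable_iff_bounded by blast
    moreover have "norm (C * weight x) = C * weight x" for x :: 'a using weight_pos[of x] by (simp add: C_def)
    ultimately show ?thesis by (simp only:)
  qed
  finally show ?thesis .
qed

text \<open>Separates the two dangers in the extremal integral: near 0 the worst exponent is -1/2,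
  which is integrable, and at infinity a natural power is absorbed by an exponential.\<close>

lemma powr_le_sqrt_plus_power:
  fixes x :: real
  assumes x: "x > 0" and g: "- 1/2 \<le> \<gamma>" "\<gamma> \<le> real n"
  shows "x powr \<gamma> \<le> x powr (- 1/2) + x ^ n"
proof (cases "x \<le> 1")
  case True
  then have "x powr \<gamma> \<le> x powr (- 1/2)" using x g by (intro powr_mono') auto
  then show ?thesis using x by (simp add: add_increasing2)
next
  case False
  then have "x powr \<gamma> \<le> x powr real n" using g by (intro powr_mono) auto
  also have "\<dots> = x ^ n" using x by (rule powr_realpow)
  finally show ?thesis by (simp add: add_increasing)
qed

lemma fibre_mass_le:
  fixes q :: "real \<times> 'a::euclidean_space"
  assumes s: "s > 0" and d: "DIM('a) \<ge> 2" and q: "fst q > sqrt (4 * s\<^sup>2 + (norm (snd q))\<^sup>2)"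
  shows "fibre_mass s q \<le> DIM('a) * unit_ball_vol DIM('a) * ((fst q)\<^sup>2 - (norm (snd q))\<^sup>2 - (2 * s)\<^sup>2) powr ((real DIM('a) - 2) / 2) / (2 * s)"
proof -
  define X where "X = (fst q)\<^sup>2 - (norm (snd q))\<^sup>2 - (2 * s)\<^sup>2"
  have X: "X > 0" unfolding X_def by (rule above_mass_shell(1)[OF q])
  have "fibre_mass s q = DIM('a) * unit_ball_vol DIM('a) * (X / 4) powr ((real DIM('a) - 2) / 2) / sqrt (X + (2 * s)\<^sup>2)"
    using q by (simp add: fibre_mass_def split_beta X_def)
  also have "\<dots> \<le> DIM('a) * unit_ball_vol DIM('a) * X powr ((real DIM('a) - 2) / 2) / (2 * s)"
  proof (intro frac_le mult_left_mono powr_mono2)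
    show "2 * s \<le> sqrt (X + (2 * s)\<^sup>2)" using X s by (intro real_le_rsqrt) auto
  qed (use X s d in auto)
  finally show ?thesis unfolding X_def .
qed

text \<open>Here the lower bound on \<open>\<beta>\<close> enters, through
  \<open>\<gamma> \<ge> - 1/2\<close>. With \<open>v\<close> the distance of \<open>\<tau>\<close>
  from the threshold \<open>\<rho> \<xi>\<close>, the quantity \<open>X\<close> factors as
  \<open>v * (\<tau> + \<rho> \<xi>)\<close> and is at least \<open>4 * s * v\<close>, so the
  singularity is at most \<open>v powr (- 1/2)\<close>. One half of the exponent in
  \<open>exp (- 2 * \<tau>)\<close> absorbs the powers of \<open>X\<close>, the other gives decay in
  \<open>v\<close> and in \<open>norm \<xi>\<close>.\<close>

lemma extremal_integral_finite:
  assumes s: "s > 0" and d: "CARD('n) \<ge> 2" and \<beta>: "\<beta> > (3 - 2 * real CARD('n)) / 4"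
  shows "(\<integral>\<^sup>+q. ennreal (exp (- 2 * fst q) * (box_symbol s \<beta> q * fibre_mass s q)\<^sup>2) \<partial>(lborel :: (real \<times> (real ^ 'n)) measure)) < \<infinity>"
proof -
  define \<gamma> where "\<gamma> = 2 * \<beta> + real CARD('n) - 2"
  have \<gamma>: "\<gamma> \<ge> - 1/2" using \<beta> by (simp add: \<gamma>_def)
  obtain n :: nat where n: "\<gamma> \<le> real n" using real_arch_simple by blast
  define S where "S = CARD('n) * unit_ball_vol CARD('n) / (2 * s)"
  \<comment> \<open>\<open>C1\<close> is the constant of \<open>power_le_exp\<close> for
    \<open>\<tau> ^ (2 * n)\<close>, which bounds \<open>X ^ n\<close>; \<open>C2\<close> is split
    off from \<open>(v * (4 * s)) powr (- 1/2)\<close>.\<close>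
  define C1 where "C1 = real (2 * n) ^ (2 * n)"
  define C2 where "C2 = (4 * s) powr (- 1/2)"
  define C where "C = S\<^sup>2 * (C1 + C2)"
  have C12: "C1 \<ge> 0" "C2 \<ge> 0" "C \<ge> 0" by (auto simp: C1_def C2_def C_def)
  define g where "g v = (v powr (- 1/2) + 1) * exp (- v) * indicator {0..} v" for v :: real
  have g0: "g v \<ge> 0" for v by (simp add: g_def)
  have gm [measurable]: "g \<in> borel_measurable borel" unfolding g_def[abs_def] by measurable
  have gfin: "(\<integral>\<^sup>+v. ennreal (g v) \<partial>lborel) < \<infinity>"
  proof -
    have "(\<integral>\<^sup>+v. ennreal (g v) \<partial>lborel) = (\<integral>\<^sup>+t. ennreal (indicator {0..} t * t powr (1/2 - 1) / exp t) + ennreal (indicator {0..} t * t powr (1 - 1) / exp t) \<partial>lborel)"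
    proof (rule nn_integral_cong_AE)
      \<comment> \<open>At \<open>v = 0\<close> the two sides differ, because
        \<open>0 powr 0 = 0\<close> while \<open>g 0 = 1\<close>.\<close>
      have "AE v in lborel. v \<noteq> (0::real)" by (rule AE_lborel_singleton)
      then show "AE v in lborel. ennreal (g v) = ennreal (indicator {0..} v * v powr (1/2 - 1) / exp v) + ennreal (indicator {0..} v * v powr (1 - 1) / exp v)"
      proof eventually_elim
        case (elim v)
        have "g v = indicator {0..} v * v powr (1/2 - 1) / exp v + indicator {0..} v * v powr (1 - 1) / exp v"
          using elim by (auto simp: g_def exp_minus field_simps split: split_indicator)
        then show ?case by (simp add: ennreal_plus[symmetric] del: ennreal_plus)
      qed
    qed
    also have "\<dots> = (\<integral>\<^sup>+t. ennreal (indicator {0..} t * t powr (1/2 - 1) / exp t) \<partial>lborel) + (\<integral>\<^sup>+t. ennreal (indicator {0..} t * t powr (1 - 1) / exp t) \<partial>lborel)"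
      by (rule nn_integral_add) measurable
    also have "\<dots> = ennreal (Gamma (1/2)) + ennreal (Gamma 1)"
      using Gamma_conv_nn_integral_real[of "1/2"] Gamma_conv_nn_integral_real[of 1] by simp
    also have "\<dots> < \<infinity>" by simp
    finally show ?thesis .
  qed
  define \<rho> where "\<rho> \<xi> = sqrt (4 * s\<^sup>2 + (norm \<xi>)\<^sup>2)" for \<xi> :: "real ^ 'n"
  have \<rho>m [measurable]: "\<rho> \<in> borel_measurable borel" unfolding \<rho>_def[abs_def] by measurable
  have bound: "exp (- 2 * \<tau>) * (box_symbol s \<beta> (\<tau>, \<xi>) * fibre_mass s (\<tau>, \<xi>))\<^sup>2 \<le> C * exp (- norm \<xi>) * g (- \<rho> \<xi> + \<tau>)" for \<tau> and \<xi> :: "real ^ 'n"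
  proof (cases "\<tau> > \<rho> \<xi>")
    case False
    then have "fibre_mass s (\<tau>, \<xi>) = 0" by (simp add: fibre_mass_def \<rho>_def)
    then show ?thesis using C12 g0 by simp
  next
    case True
    define X where "X = \<tau>\<^sup>2 - (norm \<xi>)\<^sup>2 - (2 * s)\<^sup>2"
    have X: "X > 0" unfolding X_def using above_mass_shell(1)[of s "(\<tau>, \<xi>)"] True by (simp add: \<rho>_def)
    have \<rho>s: "\<rho> \<xi> \<ge> 2 * s" unfolding \<rho>_def by (intro real_le_rsqrt) (simp add: power_mult_distrib)
    have \<rho>n: "\<rho> \<xi> \<ge> norm \<xi>" unfolding \<rho>_def by (intro real_le_rsqrt) simp
    have \<tau>0: "\<tau> > 0" using True \<rho>s s by linarith
    define v where "v = \<tau> - \<rho> \<xi>"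
    have v: "v > 0" using True by (simp add: v_def)
    have "X = v * (\<tau> + \<rho> \<xi>)"
      unfolding X_def v_def by (simp add: square_diff_square_factored[symmetric] power2_eq_square[symmetric] \<rho>_def mult.commute power_mult_distrib)
        (simp add: algebra_simps \<rho>_def power2_eq_square[symmetric])
    then have Xge: "X \<ge> v * (4 * s)" using v \<rho>s True by simp
    have fm: "fibre_mass s (\<tau>, \<xi>) \<le> S * X powr ((real CARD('n) - 2) / 2)"
      using fibre_mass_le[OF s, of "(\<tau>, \<xi>)"] True d by (simp add: S_def X_def \<rho>_def)
    have bs: "box_symbol s \<beta> (\<tau>, \<xi>) = X powr \<beta>" using X by (simp add: box_symbol_def X_def)
    have "(box_symbol s \<beta> (\<tau>, \<xi>) * fibre_mass s (\<tau>, \<xi>))\<^sup>2 \<le> (X powr \<beta> * (S * X powr ((real CARD('n) - 2) / 2)))\<^sup>2"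
      unfolding bs by (intro power_mono mult_left_mono fm mult_nonneg_nonneg fibre_mass_nonneg) auto
    also have "\<dots> = S\<^sup>2 * (X powr \<beta> * X powr \<beta> * X powr ((real CARD('n) - 2) / 2) * X powr ((real CARD('n) - 2) / 2))"
      by (simp add: power2_eq_square)
    also have "X powr \<beta> * X powr \<beta> * X powr ((real CARD('n) - 2) / 2) * X powr ((real CARD('n) - 2) / 2) = X powr \<gamma>"
      unfolding powr_add[symmetric] \<gamma>_def by (rule arg_cong[where f="(powr) X"]) (simp add: field_simps)
    also have "S\<^sup>2 * X powr \<gamma> \<le> S\<^sup>2 * (C2 * v powr (- 1/2) + C1 * exp \<tau>)"
    proof (rule mult_left_mono)
      have "X powr \<gamma> \<le> X powr (- 1/2) + X ^ n" by (rule powr_le_sqrt_plus_power[OF X \<gamma> n])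
      moreover have "X powr (- 1/2) \<le> (v * (4 * s)) powr (- 1/2)"
        using Xge v s by (intro powr_mono2') auto
      moreover have "(v * (4 * s)) powr (- 1/2) = C2 * v powr (- 1/2)"
        unfolding C2_def using v s by (subst powr_mult) (auto simp: mult.commute)
      moreover have "X ^ n \<le> C1 * exp \<tau>"
      proof -
        have "X \<le> \<tau>\<^sup>2" unfolding X_def using zero_le_power2[of "norm \<xi>"] zero_le_power2[of "2 * s"] by linarith
        then have "X ^ n \<le> (\<tau>\<^sup>2) ^ n" using X by (intro power_mono) auto
        also have "\<dots> = \<tau> ^ (2 * n)" by (simp add: power_mult)
        also have "\<dots> \<le> C1 * exp \<tau>" unfolding C1_def using \<tau>0 by (intro power_le_exp) simp
        finally show ?thesis .
      qed
      ultimately show "X powr \<gamma> \<le> C2 * v powr (- 1/2) + C1 * exp \<tau>" by linarith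
    qed simp
    finally have "exp (- 2 * \<tau>) * (box_symbol s \<beta> (\<tau>, \<xi>) * fibre_mass s (\<tau>, \<xi>))\<^sup>2 \<le> exp (- 2 * \<tau>) * (S\<^sup>2 * (C2 * v powr (- 1/2) + C1 * exp \<tau>))"
      by (intro mult_left_mono) auto
    also have "\<dots> = S\<^sup>2 * (C2 * v powr (- 1/2) * exp (- 2 * \<tau>) + C1 * (exp (- 2 * \<tau>) * exp \<tau>))"
      by (simp add: algebra_simps)
    also have "exp (- 2 * \<tau>) * exp \<tau> = exp (- \<tau>)" by (simp add: exp_add[symmetric])
    also have "S\<^sup>2 * (C2 * v powr (- 1/2) * exp (- 2 * \<tau>) + C1 * exp (- \<tau>)) \<le> S\<^sup>2 * (C2 * v powr (- 1/2) * exp (- \<tau>) + C1 * exp (- \<tau>))"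
      using C12 \<tau>0 by (intro mult_left_mono add_right_mono mult_nonneg_nonneg) auto
    also have "\<dots> \<le> S\<^sup>2 * ((C1 + C2) * (v powr (- 1/2) + 1) * exp (- \<tau>))"
    proof (intro mult_left_mono)
      have "C2 * v powr (- 1/2) * exp (- \<tau>) + C1 * exp (- \<tau>) = (C2 * v powr (- 1/2) + C1) * exp (- \<tau>)"
        by (simp add: distrib_right)
      also have "\<dots> \<le> ((C1 + C2) * (v powr (- 1/2) + 1)) * exp (- \<tau>)"
        using C12 by (intro mult_right_mono) (auto simp: algebra_simps)
      finally show "C2 * v powr (- 1/2) * exp (- \<tau>) + C1 * exp (- \<tau>) \<le> (C1 + C2) * (v powr (- 1/2) + 1) * exp (- \<tau>)" .
    qed simp
    also have "\<dots> = C * ((v powr (- 1/2) + 1) * exp (- v)) * exp (- \<rho> \<xi>)"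
      unfolding C_def v_def by (simp add: exp_add[symmetric] mult.assoc)
    also have "\<dots> \<le> C * ((v powr (- 1/2) + 1) * exp (- v)) * exp (- norm \<xi>)"
      using C12 \<rho>n by (intro mult_left_mono) (auto intro!: mult_nonneg_nonneg)
    also have "\<dots> = C * exp (- norm \<xi>) * g (- \<rho> \<xi> + \<tau>)"
      using v by (simp add: g_def v_def)
    finally show ?thesis .
  qed
  define G where "G q = ennreal (exp (- 2 * fst q) * (box_symbol s \<beta> q * fibre_mass s q)\<^sup>2)" for q :: "real \<times> (real ^ 'n)"
  have Gm: "G \<in> borel_measurable (lborel \<Otimes>\<^sub>M lborel)"
  proof -
    have [measurable]: "fst \<in> borel_measurable (borel :: (real \<times> (real ^ 'n)) measure)" unfolding borel_prod[symmetric] by measurable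
    have "G \<in> borel_measurable borel" unfolding G_def[abs_def] by measurable
    then show ?thesis by (simp add: lborel_prod)
  qed
  have "(\<integral>\<^sup>+q. G q \<partial>lborel) = (\<integral>\<^sup>+\<xi>. \<integral>\<^sup>+\<tau>. G (\<tau>, \<xi>) \<partial>lborel \<partial>lborel)"
    unfolding lborel_prod[symmetric] by (rule lborel_pair.nn_integral_snd[OF Gm, symmetric])
  also have "\<dots> \<le> (\<integral>\<^sup>+\<xi>. \<integral>\<^sup>+\<tau>. ennreal C * (ennreal (exp (- norm \<xi>)) * ennreal (g (- \<rho> \<xi> + \<tau>))) \<partial>lborel \<partial>lborel)"
  proof (rule nn_integral_mono, rule nn_integral_mono)
    fix \<xi> :: "real ^ 'n" and \<tau> :: real
    have "G (\<tau>, \<xi>) \<le> ennreal (C * exp (- norm \<xi>) * g (- \<rho> \<xi> + \<tau>))"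
      unfolding G_def fst_conv by (intro ennreal_leI bound)
    also have "\<dots> = ennreal C * (ennreal (exp (- norm \<xi>)) * ennreal (g (- \<rho> \<xi> + \<tau>)))"
      using C12 g0 by (simp add: ennreal_mult mult.assoc)
    finally show "G (\<tau>, \<xi>) \<le> ennreal C * (ennreal (exp (- norm \<xi>)) * ennreal (g (- \<rho> \<xi> + \<tau>)))" .
  qed
  also have "\<dots> = (\<integral>\<^sup>+\<xi>. ennreal C * (ennreal (exp (- norm \<xi>)) * (\<integral>\<^sup>+v. ennreal (g v) \<partial>lborel)) \<partial>(lborel :: (real ^ 'n) measure))"
  proof (rule nn_integral_cong)
    fix \<xi> :: "real ^ 'n"
    have "(\<integral>\<^sup>+\<tau>. ennreal (g (- \<rho> \<xi> + \<tau>)) \<partial>lborel) = (\<integral>\<^sup>+v. ennreal (g v) \<partial>lborel)"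
      by (rule nn_integral_lborel_translate[of "\<lambda>v. ennreal (g v)"]) measurable
    then show "(\<integral>\<^sup>+\<tau>. ennreal C * (ennreal (exp (- norm \<xi>)) * ennreal (g (- \<rho> \<xi> + \<tau>))) \<partial>lborel) = ennreal C * (ennreal (exp (- norm \<xi>)) * (\<integral>\<^sup>+v. ennreal (g v) \<partial>lborel))"
      by (simp add: nn_integral_cmult)
  qed
  also have "\<dots> = ennreal C * ((\<integral>\<^sup>+\<xi>. ennreal (exp (- norm \<xi>)) \<partial>(lborel :: (real ^ 'n) measure)) * (\<integral>\<^sup>+v. ennreal (g v) \<partial>lborel))"
    by (simp add: nn_integral_cmult nn_integral_multc)
  also have "\<dots> < \<infinity>"
    using gfin nn_integral_exp_norm_finite[where 'a="real ^ 'n"] by (simp add: ennreal_mult_less_top)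
  finally show ?thesis unfolding G_def .
qed

section \<open>The extremal data and the density of their product\<close>

definition extremal :: "real \<Rightarrow> real ^ 'n \<Rightarrow> real" where
  "extremal s \<eta> = exp (- phi s (norm \<eta>)) / phi s (norm \<eta>)"

lemma borel_measurable_extremal [measurable]: "extremal s \<in> borel_measurable borel"
  unfolding extremal_def[abs_def] by measurable

lemma integrable_extremal:
  assumes s: "s > 0"
  shows "integrable lborel (\<lambda>\<eta> :: real ^ 'n. complex_of_real (extremal s \<eta>))"
proof (rule integrableI_bounded)
  have "(\<integral>\<^sup>+\<eta>. ennreal (norm (complex_of_real (extremal s \<eta>))) \<partial>(lborel :: (real ^ 'n) measure)) \<le> (\<integral>\<^sup>+\<eta>. ennreal (1 / s) * ennreal (exp (- norm \<eta>)) \<partial>(lborel :: (real ^ 'n) measure))"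
  proof (rule nn_integral_mono)
    fix \<eta> :: "real ^ 'n"
    have 1: "phi s (norm \<eta>) \<ge> s" unfolding phi_def by (rule real_le_rsqrt) simp
    have 2: "phi s (norm \<eta>) \<ge> norm \<eta>" unfolding phi_def by (rule real_le_rsqrt) simp
    have "norm (complex_of_real (extremal s \<eta>)) = exp (- phi s (norm \<eta>)) / phi s (norm \<eta>)"
      unfolding norm_of_real extremal_def using phi_pos[OF s, of "norm \<eta>"] by simp
    also have "\<dots> \<le> exp (- norm \<eta>) / s" using 1 2 s by (intro frac_le) auto
    finally have "ennreal (norm (complex_of_real (extremal s \<eta>))) \<le> ennreal (1 / s * exp (- norm \<eta>))" by (intro ennreal_leI) simp
    also have "\<dots> = ennreal (1 / s) * ennreal (exp (- norm \<eta>))" using s by (intro ennreal_mult) auto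
    finally show "ennreal (norm (complex_of_real (extremal s \<eta>))) \<le> ennreal (1 / s) * ennreal (exp (- norm \<eta>))" .
  qed
  also have "\<dots> = ennreal (1 / s) * (\<integral>\<^sup>+\<eta>. ennreal (exp (- norm \<eta>)) \<partial>(lborel :: (real ^ 'n) measure))"
    by (rule nn_integral_cmult) measurable
  also have "\<dots> < \<infinity>" using nn_integral_exp_norm_finite[where 'a="real ^ 'n"] by (simp add: ennreal_mult_less_top)
  finally show "(\<integral>\<^sup>+\<eta>. ennreal (norm (complex_of_real (extremal s (\<eta> :: real ^ 'n)))) \<partial>lborel) < \<infinity>" .
qed measurable

lemma extremal_tensor:
  fixes z :: "(real ^ 'n) \<times> (real ^ 'n)"
  shows "extremal s (fst z) * extremal s (snd z) =
    1 / (phi s (norm (fst z)) * phi s (norm (snd z))) * exp (- fst (energy_momentum s z))"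
  by (simp add: extremal_def energy_momentum_def split_beta exp_diff exp_minus field_simps)

text \<open>On pairs, the data multiply to the invariant weight times a function of the total
  energy, so the push-forward formula gives the density explicitly, where in general only
  Radon-Nikodym is available.\<close>

lemma wave_density_extremal:
  assumes s: "s > 0" and d: "CARD('n) \<ge> 2"
  shows "wave_density s (\<lambda>z :: (real ^ 'n) \<times> (real ^ 'n). complex_of_real (extremal s (fst z)) * complex_of_real (extremal s (snd z)))
    (\<lambda>q. complex_of_real (exp (- fst q) * fibre_mass s q))"
  unfolding wave_density_def
proof (intro conjI allI impI)
  let ?w = "\<lambda>z :: (real ^ 'n) \<times> (real ^ 'n). 1 / (phi s (norm (fst z)) * phi s (norm (snd z)))"
  have w0: "?w z \<ge> 0" for z using phi_pos[OF s] by (simp add: less_imp_le)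
  have [measurable]: "fst \<in> borel_measurable (borel :: (real \<times> (real ^ 'n)) measure)" unfolding borel_prod[symmetric] by measurable
  show Ai: "integrable lborel (\<lambda>z :: (real ^ 'n) \<times> (real ^ 'n). complex_of_real (extremal s (fst z)) * complex_of_real (extremal s (snd z)))"
    by (rule integrable_tensor[OF integrable_extremal[OF s] integrable_extremal[OF s]])
  have A: "complex_of_real (extremal s (fst z)) * complex_of_real (extremal s (snd z)) = complex_of_real (?w z * exp (- fst (energy_momentum s z)))" for z :: "(real ^ 'n) \<times> (real ^ 'n)"
    unfolding of_real_mult[symmetric] extremal_tensor ..
  show "integrable lborel (\<lambda>q :: real \<times> (real ^ 'n). complex_of_real (exp (- fst q) * fibre_mass s q))"
  proof (rule integrableI_bounded)
    have "(\<integral>\<^sup>+q. ennreal (norm (complex_of_real (exp (- fst q) * fibre_mass s q))) \<partial>(lborel :: (real \<times> (real ^ 'n)) measure)) = (\<integral>\<^sup>+q. ennreal (exp (- fst q)) * ennreal (fibre_mass s q) \<partial>(lborel :: (real \<times> (real ^ 'n)) measure))"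
      unfolding norm_of_real abs_mult abs_exp_cancel abs_of_nonneg[OF fibre_mass_nonneg]
      by (intro nn_integral_cong ennreal_mult fibre_mass_nonneg exp_ge_zero)
    also have "\<dots> = (\<integral>\<^sup>+z. ennreal (exp (- fst (energy_momentum s z))) * ennreal (?w z) \<partial>lborel)"
      by (rule nn_integral_energy_momentum[OF s d, symmetric]) measurable
    also have "\<dots> = (\<integral>\<^sup>+z. ennreal (norm (complex_of_real (extremal s (fst z)) * complex_of_real (extremal s (snd z)))) \<partial>(lborel :: ((real ^ 'n) \<times> (real ^ 'n)) measure))"
    proof (rule nn_integral_cong)
      fix z :: "(real ^ 'n) \<times> (real ^ 'n)"
      have "norm (complex_of_real (?w z * exp (- fst (energy_momentum s z)))) = exp (- fst (energy_momentum s z)) * ?w z"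
        unfolding norm_of_real abs_mult abs_exp_cancel abs_of_nonneg[OF w0] by (rule mult.commute)
      then show "ennreal (exp (- fst (energy_momentum s z))) * ennreal (?w z) = ennreal (norm (complex_of_real (extremal s (fst z)) * complex_of_real (extremal s (snd z))))"
        unfolding A by (simp only: ennreal_mult[OF exp_ge_zero w0])
    qed
    also have "\<dots> < \<infinity>" using Ai by (simp add: integrable_iff_bounded)
    finally show "(\<integral>\<^sup>+q. ennreal (norm (complex_of_real (exp (- fst q) * fibre_mass s q))) \<partial>(lborel :: (real \<times> (real ^ 'n)) measure)) < \<infinity>" .
  qed measurable
  fix h :: "real \<times> (real ^ 'n) \<Rightarrow> complex" and B
  assume hm [measurable]: "h \<in> borel_measurable borel" and "\<forall>q. norm (h q) \<le> B"
  have meas: "distr (density lborel (\<lambda>z. ennreal (?w z))) borel (energy_momentum s) = density lborel (\<lambda>q :: real \<times> (real ^ 'n). ennreal (fibre_mass s q))"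
  proof (rule measure_eqI)
    fix N :: "(real \<times> (real ^ 'n)) set" assume "N \<in> sets (distr (density lborel (\<lambda>z. ennreal (?w z))) borel (energy_momentum s))"
    then have [measurable]: "N \<in> sets borel" by simp
    have "emeasure (distr (density lborel (\<lambda>z. ennreal (?w z))) borel (energy_momentum s)) N = (\<integral>\<^sup>+q. indicator N q \<partial>distr (density lborel (\<lambda>z. ennreal (?w z))) borel (energy_momentum s))"
      by simp
    also have "\<dots> = (\<integral>\<^sup>+z. indicator N (energy_momentum s z) \<partial>density lborel (\<lambda>z. ennreal (?w z)))"
      by (rule nn_integral_distr) measurable
    also have "\<dots> = (\<integral>\<^sup>+z. ennreal (?w z) * indicator N (energy_momentum s z) \<partial>lborel)"
      by (rule nn_integral_density) measurable
    also have "\<dots> = (\<integral>\<^sup>+z. indicator N (energy_momentum s z) * ennreal (?w z) \<partial>lborel)" by (simp only: mult.commute)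
    also have "\<dots> = (\<integral>\<^sup>+q. indicator N q * ennreal (fibre_mass s q) \<partial>lborel)"
      by (rule nn_integral_energy_momentum[OF s d]) measurable
    also have "\<dots> = emeasure (density lborel (\<lambda>q. ennreal (fibre_mass s q))) N"
      by (subst emeasure_density) (auto simp: mult.commute)
    finally show "emeasure (distr (density lborel (\<lambda>z. ennreal (?w z))) borel (energy_momentum s)) N = emeasure (density lborel (\<lambda>q. ennreal (fibre_mass s q))) N" .
  qed simp
  define k where "k q = complex_of_real (exp (- fst q)) * h q" for q
  have km [measurable]: "k \<in> borel_measurable borel" unfolding k_def[abs_def] by measurable
  have "(LINT z|lborel. complex_of_real (extremal s (fst z)) * complex_of_real (extremal s (snd z)) * h (energy_momentum s z)) = (LINT z|lborel. ?w z *\<^sub>R k (energy_momentum s z))"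
    unfolding A k_def by (intro Bochner_Integration.integral_cong refl) (simp add: scaleR_conv_of_real)
  also have "\<dots> = (LINT z|density lborel (\<lambda>z. ennreal (?w z)). k (energy_momentum s z))"
    by (rule integral_density[symmetric]) (measurable, rule AE_I2, rule w0)
  also have "\<dots> = (LINT q|distr (density lborel (\<lambda>z. ennreal (?w z))) borel (energy_momentum s). k q)"
    by (rule integral_distr[symmetric]) measurable
  also have "\<dots> = (LINT q|lborel. fibre_mass s q *\<^sub>R k q)"
    unfolding meas by (rule integral_density) (measurable, rule AE_I2, rule fibre_mass_nonneg)
  also have "\<dots> = (LINT q|lborel. complex_of_real (exp (- fst q) * fibre_mass s q) * h q)"
    unfolding k_def by (intro Bochner_Integration.integral_cong refl) (simp add: scaleR_conv_of_real)
  finally show "(LINT z|lborel. complex_of_real (extremal s (fst z)) * complex_of_real (extremal s (snd z)) * h (energy_momentum s z)) = (LINT q|lborel. complex_of_real (exp (- fst q) * fibre_mass s q) * h q)" .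
qed

section \<open>The subordination integral and superpositions of Gaussians\<close>

lemma integral_exp_minus_square:
  "integrable lborel (\<lambda>w::real. exp (- w\<^sup>2))" "(LINT w|lborel. exp (- w\<^sup>2)) = sqrt pi"
proof -
  have g: "gauss (sqrt 2 *\<^sub>R w) = exp (- w\<^sup>2)" for w :: real
    by (simp add: gauss_def power_mult_distrib)
  show "integrable lborel (\<lambda>w::real. exp (- w\<^sup>2))"
    using integrable_gauss_scaled[of "sqrt 2", where 'a=real] unfolding g by simp
  have "sqrt (2 * pi) = sqrt 2 * (LINT w|lborel. exp (- w\<^sup>2))"
    using lborel_integral_affine[of "sqrt 2" "gauss :: real \<Rightarrow> real" 0] integral_gauss[where 'a=real] unfolding add_0 g by simp
  then show "(LINT w|lborel. exp (- w\<^sup>2)) = sqrt pi" by (simp add: real_sqrt_mult)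
qed

text \<open>The substitution \<open>w = c v - 1 / (2 v)\<close> maps the half-line onto the line and turns the exponent
  into \<open>- w\<^sup>2 - c\<close>; the part of its Jacobian that is not constant is odd in \<open>w\<close>.\<close>
lemma nn_integral_exp_square_inverse_square:
  fixes c :: real
  assumes c: "c > 0"
  shows "(\<integral>\<^sup>+v. ennreal (exp (- (c\<^sup>2 * v\<^sup>2) - 1 / (4 * v\<^sup>2))) * indicator {0<..} v \<partial>lborel) = ennreal (sqrt pi / 2 * (exp (- c) / c))"
proof -
  \<comment> \<open>\<open>g w\<close> is the positive root of
    \<open>2 * c * v\<^sup>2 - 2 * w * v - 1 = 0\<close>, that is the inverse of the substitution
    \<open>w = c * v - 1 / (2 * v)\<close>; \<open>r w\<close> is the root of the discriminant up to
    a factor.\<close>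
  define r where "r w = sqrt (w\<^sup>2 + 2 * c)" for w
  define g where "g w = (w + r w) / (2 * c)" for w
  define g' where "g' w = (1 + w / r w) / (2 * c)" for w
  have rpos: "r w > 0" and rsq: "(r w)\<^sup>2 = w\<^sup>2 + 2 * c" for w
    using c by (auto simp: r_def add_nonneg_pos)
  have rw: "\<bar>w\<bar> < r w" for w
    using c unfolding r_def by (intro real_less_rsqrt) simp
  have gpos: "g w > 0" for w using rw[of w] c by (simp add: g_def)
  have g'nn: "g' w \<ge> 0" for w
  proof -
    have "- 1 \<le> w / r w" using rw[of w] rpos[of w] by (simp add: pos_le_divide_eq)
    then show ?thesis using c by (simp add: g'_def)
  qed
  have D: "(g has_real_derivative g' w) (at w)" for w
  proof -
    have "(r has_real_derivative w / r w) (at w)"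
    proof -
      have "w\<^sup>2 + 2 * c > 0" using c by (simp add: add_nonneg_pos)
      then show ?thesis unfolding r_def by (auto intro!: derivative_eq_intros simp: field_simps)
    qed
    then show ?thesis unfolding g_def g'_def by (intro DERIV_cdivide DERIV_add DERIV_ident)
  qed
  have rne: "r w \<noteq> 0" for w using rpos[of w] by simp
  have rc: "continuous_on UNIV r" unfolding r_def by (intro continuous_intros)
  have C: "continuous_on UNIV g'" unfolding g'_def
    using c rne by (intro continuous_intros rc) auto
  have gr: "g w * (r w - w) = 1" for w
  proof -
    have "(r w - w) * (r w + w) = 2 * c" using rsq[of w] by (simp add: algebra_simps power2_eq_square)
    moreover have "g w * (r w - w) = ((r w - w) * (r w + w)) / (2 * c)" by (simp add: g_def add.commute mult.commute)
    ultimately show ?thesis using c by simp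
  qed
  have key: "c\<^sup>2 * (g w)\<^sup>2 + 1 / (4 * (g w)\<^sup>2) = w\<^sup>2 + c" for w
  proof -
    have "1 / (2 * g w) = (g w * (r w - w)) / (2 * g w)" unfolding gr ..
    then have i: "1 / (2 * g w) = (r w - w) / 2" using gpos[of w] by simp
    have j: "c * g w = (w + r w) / 2" using c by (simp add: g_def)
    have "(c * g w)\<^sup>2 + (1 / (2 * g w))\<^sup>2 = ((w + r w) / 2)\<^sup>2 + ((r w - w) / 2)\<^sup>2"
      unfolding i j ..
    then have "c\<^sup>2 * (g w)\<^sup>2 + 1 / (4 * (g w)\<^sup>2) = ((w + r w) / 2)\<^sup>2 + ((r w - w) / 2)\<^sup>2"
      unfolding power_mult_distrib power_divide by simp
    also have "\<dots> = (w\<^sup>2 + (r w)\<^sup>2) / 2" by (simp add: power2_eq_square field_simps)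
    finally show ?thesis unfolding rsq by simp
  qed
  let ?a = "\<lambda>n. - real (Suc n)" and ?b = "\<lambda>n. real (Suc n)"
  have 1: "(\<Union>n. {?a n..?b n}) = UNIV"
  proof (intro set_eqI iffI UNIV_I)
    fix x :: real
    obtain n :: nat where "\<bar>x\<bar> \<le> n" using real_arch_simple by blast
    then have "x \<in> {?a n..?b n}" by auto
    then show "x \<in> (\<Union>n. {?a n..?b n})" by blast
  qed
  \<comment> \<open>The images exhaust the positive half-line: by \<open>gr\<close> the left end is
    at most \<open>1 / (2 * n)\<close>, and the right end is at least \<open>n / c\<close>. Hence
    \<open>n\<close> is taken above both \<open>1 / (2 * y)\<close> and
    \<open>c * y\<close>.\<close>
  have 2: "(\<Union>n. {g (?a n)..g (?b n)}) = {0<..}"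
  proof (intro set_eqI iffI)
    fix y :: real assume y: "y \<in> {0<..}"
    obtain n :: nat where n: "max (c * y) (1 / (2 * y)) \<le> real n" using real_arch_simple by blast
    have npos: "real n > 0"
    proof -
      have "0 < 1 / (2 * y)" using y by simp
      also have "\<dots> \<le> real n" using n by simp
      finally show ?thesis .
    qed
    have "g (?a n) \<le> y"
    proof -
      have "r (?a n) - ?a n \<noteq> 0" using rw[of "?a n"] by linarith
      then have "g (?a n) = 1 / (r (?a n) - ?a n)" using gr[of "?a n"] by (simp add: eq_divide_eq)
      also have "\<dots> \<le> 1 / (2 * real n)"
      proof (rule divide_left_mono)
        show "2 * real n \<le> r (?a n) - ?a n" using rw[of "?a n"] by simp
        have "r (?a n) - ?a n > 0" using rw[of "?a n"] by linarith
        then show "0 < (r (?a n) - ?a n) * (2 * real n)" using npos by (intro mult_pos_pos) auto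
      qed simp
      also have "\<dots> \<le> y"
      proof -
        have "1 / (2 * y) \<le> real n" using n by simp
        moreover have "1 / (2 * y) > 0" using y by simp
        ultimately show ?thesis using y npos by (simp add: field_simps)
      qed
      finally show ?thesis .
    qed
    moreover have "y \<le> g (?b n)"
    proof -
      have "y \<le> real n / c" using n c by (simp add: field_simps)
      also have "\<dots> \<le> g (?b n)" unfolding g_def using rw[of "?b n"] c by (simp add: field_simps)
      finally show ?thesis .
    qed
    ultimately show "y \<in> (\<Union>n. {g (?a n)..g (?b n)})" by auto
  next
    fix y assume "y \<in> (\<Union>n. {g (?a n)..g (?b n)})"
    then obtain n where "g (?a n) \<le> y" by auto
    then show "y \<in> {0<..}" using gpos[of "?a n"] by simp
  qed
  define q where "q w = exp (- w\<^sup>2) * (w / r w)" for w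
  have rm [measurable]: "r \<in> borel_measurable borel" using rc by (rule borel_measurable_continuous_onI)
  have qb: "\<bar>q w\<bar> \<le> exp (- w\<^sup>2)" for w
  proof -
    have le: "\<bar>w / r w\<bar> \<le> 1" using rw[of w] rpos[of w] by (simp add: abs_divide)
    have "\<bar>q w\<bar> = exp (- w\<^sup>2) * \<bar>w / r w\<bar>" by (simp only: q_def abs_mult abs_exp_cancel)
    also have "\<dots> \<le> exp (- w\<^sup>2)" by (intro mult_left_le le) simp
    finally show ?thesis .
  qed
  have qi: "integrable lborel q"
    by (rule Bochner_Integration.integrable_bound[OF integral_exp_minus_square(1)]) (use qb in \<open>auto simp: q_def[abs_def]\<close>)
  have "(LINT w|lborel. q (0 + (- 1) *\<^sub>R w)) = (LINT w|lborel. q w)"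
    using lborel_integral_affine[of "-1" q 0] borel_measurable_integrable[OF qi] by simp
  moreover have "q (0 + (- 1) *\<^sub>R w) = - q w" for w by (simp add: q_def r_def)
  ultimately have q0: "(LINT w|lborel. q w) = 0" by simp
  have "(\<integral>\<^sup>+v. ennreal (exp (- (c\<^sup>2 * v\<^sup>2) - 1 / (4 * v\<^sup>2))) * indicator (\<Union>n. {g (?a n)..g (?b n)}) v \<partial>lborel)
     = (\<integral>\<^sup>+w. ennreal (exp (- (c\<^sup>2 * (g w)\<^sup>2) - 1 / (4 * (g w)\<^sup>2))) * ennreal (g' w) * indicator (\<Union>n. {?a n..?b n}) w \<partial>lborel)"
    by (rule nn_integral_substitution_exhaustion) (use D C g'nn in \<open>auto simp: decseq_def incseq_def\<close>)
  also have "\<dots> = (\<integral>\<^sup>+w. ennreal (exp (- c) / (2 * c) * (exp (- w\<^sup>2) + q w)) \<partial>lborel)"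
    unfolding 1
  proof (rule nn_integral_cong)
    fix w
    have "exp (- (c\<^sup>2 * (g w)\<^sup>2) - 1 / (4 * (g w)\<^sup>2)) = exp (- c) * exp (- w\<^sup>2)"
      unfolding exp_add[symmetric] using key[of w] by simp
    then have "exp (- (c\<^sup>2 * (g w)\<^sup>2) - 1 / (4 * (g w)\<^sup>2)) * g' w = exp (- c) / (2 * c) * (exp (- w\<^sup>2) + q w)"
      using c by (simp add: g'_def q_def field_simps)
    then show "ennreal (exp (- (c\<^sup>2 * (g w)\<^sup>2) - 1 / (4 * (g w)\<^sup>2))) * ennreal (g' w) * indicator UNIV w = ennreal (exp (- c) / (2 * c) * (exp (- w\<^sup>2) + q w))"
      using g'nn[of w] by (simp add: ennreal_mult[symmetric] del: times_divide_eq_left times_divide_eq_right)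
  qed
  also have "\<dots> = ennreal (LINT w|lborel. exp (- c) / (2 * c) * (exp (- w\<^sup>2) + q w))"
  proof (rule nn_integral_eq_integral)
    show "integrable lborel (\<lambda>w. exp (- c) / (2 * c) * (exp (- w\<^sup>2) + q w))"
      by (intro integrable_mult_right Bochner_Integration.integrable_add integral_exp_minus_square qi)
    show "AE w in lborel. 0 \<le> exp (- c) / (2 * c) * (exp (- w\<^sup>2) + q w)"
    proof (rule AE_I2, rule mult_nonneg_nonneg)
      fix w show "0 \<le> exp (- w\<^sup>2) + q w" using qb[of w] by linarith
    qed (use c in simp)
  qed
  also have "(LINT w|lborel. exp (- c) / (2 * c) * (exp (- w\<^sup>2) + q w)) = exp (- c) / (2 * c) * sqrt pi"
    unfolding integral_mult_right_zero
    by (subst Bochner_Integration.integral_add) (simp_all add: integral_exp_minus_square qi q0)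
  finally show ?thesis unfolding 2 by (simp add: mult.commute)
qed

text \<open>For \<open>v > 0\<close> the kernel of the heat semigroup at time
  \<open>v\<^sup>2\<close>: nonnegative, of mass one, and with the Gaussian
  \<open>exp (- (v\<^sup>2 * (norm \<eta>)\<^sup>2))\<close> as its transform.\<close>

definition heat_kernel :: "real \<Rightarrow> 'a::euclidean_space \<Rightarrow> complex" where
  "heat_kernel v x = complex_of_real (1 / (sqrt (2 * pi) * (sqrt 2 * v)) ^ DIM('a)) * gauss_wave (1 / (sqrt 2 * v)) 0 x"

lemma fourier_heat_kernel:
  fixes \<eta> :: "'a::euclidean_space"
  assumes v: "v > 0"
  shows "fourier (heat_kernel v) \<eta> = complex_of_real (exp (- (v\<^sup>2 * (norm \<eta>)\<^sup>2)))"
proof -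
  define e where "e = 1 / (sqrt 2 * v)"
  have e: "e > 0" using v by (simp add: e_def)
  define k where "k = 1 / (sqrt (2 * pi) * (sqrt 2 * v)) ^ DIM('a)"
  have "fourier (heat_kernel v) \<eta> = complex_of_real k * fourier (gauss_wave e 0) \<eta>"
    unfolding fourier_def heat_kernel_def e_def[symmetric] k_def[symmetric]
    unfolding integral_mult_right_zero[symmetric] by (simp only: mult.left_commute)
  also have "\<dots> = complex_of_real (k * gauss_kernel e \<eta>)"
    unfolding fourier_gauss_wave[OF e] by simp
  also have "k * gauss_kernel e \<eta> = gauss (\<eta> /\<^sub>R e)"
    using v unfolding k_def gauss_kernel_def e_def by (simp add: power_mult_distrib power_divide field_simps)
  also have "\<dots> = exp (- (v\<^sup>2 * (norm \<eta>)\<^sup>2))"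
    using v unfolding gauss_def e_def by (simp add: power_mult_distrib)
  finally show ?thesis .
qed

lemma integrable_heat_kernel: "v > 0 \<Longrightarrow> integrable lborel (heat_kernel v)"
  unfolding heat_kernel_def[abs_def] by (intro integrable_mult_right integrable_gauss_wave) simp

lemma norm_heat_kernel: "v > 0 \<Longrightarrow> complex_of_real (norm (heat_kernel v x)) = heat_kernel v x"
  unfolding heat_kernel_def gauss_wave_def by (simp add: norm_mult norm_power gauss_pos abs_of_pos norm_divide)

lemma integral_norm_heat_kernel:
  assumes v: "v > 0"
  shows "(LINT x|(lborel :: 'a::euclidean_space measure). norm (heat_kernel v x)) = 1"
proof -
  have "complex_of_real (LINT x|(lborel :: 'a measure). norm (heat_kernel v x)) = (LINT x|(lborel :: 'a measure). heat_kernel v x)"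
    unfolding integral_complex_of_real[symmetric] norm_heat_kernel[OF v] ..
  also have "\<dots> = fourier (heat_kernel v) (0 :: 'a)" by (simp add: fourier_def)
  also have "\<dots> = 1" unfolding fourier_heat_kernel[OF v] by simp
  finally show ?thesis by simp
qed

lemma borel_measurable_heat_kernel [measurable]:
  "(\<lambda>(v, x). heat_kernel v x) \<in> borel_measurable (borel \<Otimes>\<^sub>M (borel :: 'a::euclidean_space measure))"
  unfolding heat_kernel_def gauss_wave_def by measurable

text \<open>All heat kernels have mass one, so integrability of \<open>k\<close> alone makes the
  superposition integrable. The condition on \<open>k\<close> removes the parameters
  \<open>v \<le> 0\<close>, for which \<open>heat_kernel\<close> has no meaning.\<close>

lemma gaussian_superposition:
  fixes k :: "real \<Rightarrow> complex"
  assumes k: "integrable lborel k" and k0: "\<And>v. v \<le> 0 \<Longrightarrow> k v = 0"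
  shows "\<exists>f :: 'a::euclidean_space \<Rightarrow> complex. integrable lborel f \<and>
    (\<forall>\<eta>. fourier f \<eta> = (LINT v|lborel. k v * complex_of_real (exp (- (v\<^sup>2 * (norm \<eta>)\<^sup>2)))))"
proof -
  have [measurable]: "k \<in> borel_measurable borel" using k by (auto dest: borel_measurable_integrable)
  define F where "F = (\<lambda>(v, x :: 'a). k v * heat_kernel v x)"
  have Fm [measurable]: "F \<in> borel_measurable (borel \<Otimes>\<^sub>M borel)" unfolding F_def by measurable
  have Fi: "integrable (lborel \<Otimes>\<^sub>M lborel) F"
  proof (rule lborel_pair.Fubini_integrable)
    show "F \<in> borel_measurable (lborel \<Otimes>\<^sub>M lborel)" using Fm by simp
    have "(LINT x|lborel. norm (F (v, x))) = norm (k v)" for v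
      by (cases "v > 0") (simp_all add: F_def norm_mult integral_norm_heat_kernel k0)
    then show "integrable lborel (\<lambda>v. LINT x|lborel. norm (F (v, x)))" using k by simp
    show "AE v in lborel. integrable lborel (\<lambda>x. F (v, x))"
    proof (rule AE_I2)
      fix v show "integrable lborel (\<lambda>x. F (v, x))"
        by (cases "v > 0") (simp_all add: F_def k0 integrable_heat_kernel)
    qed
  qed
  define f where "f x = (LINT v|lborel. F (v, x))" for x
  have "integrable lborel f"
    unfolding f_def using lborel_pair.integrable_snd[of "\<lambda>v x. F (v, x)"] Fi by simp
  moreover have "fourier f \<eta> = (LINT v|lborel. k v * complex_of_real (exp (- (v\<^sup>2 * (norm \<eta>)\<^sup>2))))" for \<eta>
  proof -
    define E where "E x = exp (- (\<i> * complex_of_real (x \<bullet> \<eta>)))" for x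
    have [measurable]: "E \<in> borel_measurable borel" unfolding E_def[abs_def] by measurable
    have EF: "integrable (lborel \<Otimes>\<^sub>M lborel) (\<lambda>(v, x). E x * F (v, x))"
      by (rule Bochner_Integration.integrable_bound[OF Fi]) (measurable, auto simp: E_def norm_mult)
    have "fourier f \<eta> = (LINT x|lborel. LINT v|lborel. E x * F (v, x))"
      unfolding fourier_def f_def E_def by simp
    also have "\<dots> = (LINT v|lborel. LINT x|lborel. E x * F (v, x))"
      by (rule lborel_pair.Fubini_integral[OF EF])
    also have "\<dots> = (LINT v|lborel. k v * fourier (heat_kernel v) \<eta>)"
      unfolding fourier_def E_def F_def case_prod_conv integral_mult_right_zero[symmetric] by (simp only: mult.left_commute)
    also have "\<dots> = (LINT v|lborel. k v * complex_of_real (exp (- (v\<^sup>2 * (norm \<eta>)\<^sup>2))))"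
    proof (rule Bochner_Integration.integral_cong[OF refl])
      fix v show "k v * fourier (heat_kernel v) \<eta> = k v * complex_of_real (exp (- (v\<^sup>2 * (norm \<eta>)\<^sup>2)))"
        by (cases "v > 0") (simp_all add: fourier_heat_kernel k0)
    qed
    finally show ?thesis .
  qed
  ultimately show ?thesis by blast
qed

text \<open>The subordination formula writes \<open>exp (- c) / c\<close> as an integral of
  \<open>exp (- (c\<^sup>2 * v\<^sup>2))\<close> against a positive weight. For
  \<open>c = phi s r\<close> the square splits into \<open>s\<^sup>2 + r\<^sup>2\<close>: the first
  part joins the weight \<open>p\<close>, the second is a Gaussian in \<open>r\<close>.
  Integrability of \<open>p\<close> is the case \<open>r = 0\<close>.\<close>

lemma extremizer_exists:
  fixes s :: real
  assumes s: "s > 0"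
  shows "\<exists>f :: 'a::euclidean_space \<Rightarrow> complex. integrable lborel f \<and>
    (\<forall>\<eta>. fourier f \<eta> = complex_of_real (exp (- phi s (norm \<eta>)) / phi s (norm \<eta>)))"
proof -
  define p where "p v = 2 / sqrt pi * (exp (- (s\<^sup>2 * v\<^sup>2) - 1 / (4 * v\<^sup>2)) * indicator {0<..} v)" for v :: real
  have p0: "p v \<ge> 0" for v by (simp add: p_def)
  have pm [measurable]: "p \<in> borel_measurable borel" unfolding p_def[abs_def] by measurable
  have I: "(\<integral>\<^sup>+v. ennreal (p v * exp (- (v\<^sup>2 * r\<^sup>2))) \<partial>lborel) = ennreal (exp (- phi s r) / phi s r)" for r
  proof -
    have c: "phi s r > 0" by (rule phi_pos[OF s])
    have "(\<integral>\<^sup>+v. ennreal (p v * exp (- (v\<^sup>2 * r\<^sup>2))) \<partial>lborel) = (\<integral>\<^sup>+v. ennreal (2 / sqrt pi) * (ennreal (exp (- ((phi s r)\<^sup>2 * v\<^sup>2) - 1 / (4 * v\<^sup>2))) * indicator {0<..} v) \<partial>lborel)"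
    proof (rule nn_integral_cong)
      fix v :: real
      have "exp (- (s\<^sup>2 * v\<^sup>2) - 1 / (4 * v\<^sup>2)) * exp (- (v\<^sup>2 * r\<^sup>2)) = exp (- ((phi s r)\<^sup>2 * v\<^sup>2) - 1 / (4 * v\<^sup>2))"
        unfolding exp_add[symmetric] by (simp add: phi_def algebra_simps)
      then have "p v * exp (- (v\<^sup>2 * r\<^sup>2)) = 2 / sqrt pi * (exp (- ((phi s r)\<^sup>2 * v\<^sup>2) - 1 / (4 * v\<^sup>2)) * indicator {0<..} v)"
        unfolding p_def by (auto split: split_indicator)
      then show "ennreal (p v * exp (- (v\<^sup>2 * r\<^sup>2))) = ennreal (2 / sqrt pi) * (ennreal (exp (- ((phi s r)\<^sup>2 * v\<^sup>2) - 1 / (4 * v\<^sup>2))) * indicator {0<..} v)"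
        by (simp add: ennreal_mult'[symmetric] split: split_indicator)
    qed
    also have "\<dots> = ennreal (2 / sqrt pi) * ennreal (sqrt pi / 2 * (exp (- phi s r) / phi s r))"
      unfolding nn_integral_exp_square_inverse_square[OF c, symmetric] by (rule nn_integral_cmult) measurable
    also have "\<dots> = ennreal ((2 / sqrt pi) * (sqrt pi / 2 * (exp (- phi s r) / phi s r)))"
      using c by (intro ennreal_mult[symmetric]) auto
    also have "(2 / sqrt pi) * (sqrt pi / 2 * (exp (- phi s r) / phi s r)) = exp (- phi s r) / phi s r" by simp
    finally show ?thesis .
  qed
  have "integrable lborel p"
    by (rule integrableI_nonneg) (use I[of 0] p0 in auto)
  then have k: "integrable lborel (\<lambda>v. complex_of_real (p v))" by (rule integrable_of_real)
  have "(LINT v|lborel. complex_of_real (p v) * complex_of_real (exp (- (v\<^sup>2 * r\<^sup>2)))) = complex_of_real (exp (- phi s r) / phi s r)" for r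
  proof -
    have "(LINT v|lborel. p v * exp (- (v\<^sup>2 * r\<^sup>2))) = enn2real (\<integral>\<^sup>+v. ennreal (p v * exp (- (v\<^sup>2 * r\<^sup>2))) \<partial>lborel)"
      by (rule integral_eq_nn_integral) (measurable, simp add: p0)
    also have "\<dots> = exp (- phi s r) / phi s r" unfolding I using phi_pos[OF s, of r] by simp
    finally show ?thesis unfolding of_real_mult[symmetric] integral_complex_of_real by simp
  qed
  moreover have "complex_of_real (p v) = 0" if "v \<le> 0" for v using that by (simp add: p_def)
  ultimately show ?thesis using gaussian_superposition[OF k, where 'a='a] by metis
qed

text \<open>Up to known factors both \<open>kg_integral\<close> and the norm of the multiplied
  transform equal the same integral \<open>J\<close>, so no loss occurs. A right-hand side that is
  finite and nonzero is what lets this equality exclude a smaller constant.\<close>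

lemma sharp_pair:
  assumes d: "CARD('n) \<ge> 2" and s: "s > 0" and \<beta>: "\<beta> > (3 - 2 * real CARD('n)) / 4"
  shows "\<exists>f :: real ^ 'n \<Rightarrow> complex. nice_pair s \<beta> f f \<and> kg_integral s \<beta> f f \<noteq> 0 \<and>
    (\<forall>H. kg_box_product s \<beta> f f H \<longrightarrow> L2_norm_sq H = ennreal (KG_pp \<beta> CARD('n)) * kg_integral s \<beta> f f)"
proof -
  obtain f :: "real ^ 'n \<Rightarrow> complex" where f: "integrable lborel f" and ff: "fourier f = (\<lambda>\<eta>. complex_of_real (extremal s \<eta>))"
    using extremizer_exists[OF s, where 'a="real ^ 'n"] unfolding extremal_def by blast
  have fi: "integrable lborel (fourier f)" unfolding ff by (rule integrable_extremal[OF s])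
  have [measurable]: "fourier f \<in> borel_measurable borel" using fi by (auto dest: borel_measurable_integrable)
  have [measurable]: "fst \<in> borel_measurable (borel :: (real \<times> (real ^ 'n)) measure)" unfolding borel_prod[symmetric] by measurable
  define J where "J = (\<integral>\<^sup>+q. ennreal (exp (- 2 * fst q) * (box_symbol s \<beta> q * fibre_mass s q)\<^sup>2) \<partial>(lborel :: (real \<times> (real ^ 'n)) measure))"
  have Jfin: "J < \<infinity>" unfolding J_def by (rule extremal_integral_finite[OF s d \<beta>])
  let ?w = "\<lambda>z :: (real ^ 'n) \<times> (real ^ 'n). phi s (norm (fst z)) * phi s (norm (snd z))"
  let ?T = "energy_momentum s :: (real ^ 'n) \<times> (real ^ 'n) \<Rightarrow> _"
  have w: "?w z > 0" for z using phi_pos[OF s] by simp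
  \<comment> \<open>For these data the whole integrand on the right is \<open>K\<close> of
    \<open>energy_momentum\<close> times the invariant weight, so the push-forward formula evaluates
    it exactly.\<close>
  define K where "K q = exp (- 2 * fst q) * ((box_symbol s \<beta> q)\<^sup>2 * fibre_mass s q)" for q :: "real \<times> (real ^ 'n)"
  have [measurable]: "K \<in> borel_measurable borel" unfolding K_def[abs_def] by measurable
  have K0: "K q \<ge> 0" for q unfolding K_def by (intro mult_nonneg_nonneg fibre_mass_nonneg) auto
  have integrand: "(norm (fourier f (fst z) * fourier f (snd z)))\<^sup>2 * ?w z * ((box_symbol s \<beta> (?T z))\<^sup>2 * fibre_mass s (?T z)) = K (?T z) * (1 / ?w z)" for z
  proof -
    have "norm (fourier f (fst z) * fourier f (snd z)) = 1 / ?w z * exp (- fst (?T z))"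
      unfolding ff of_real_mult[symmetric] extremal_tensor norm_of_real using w[of z] by simp
    then have N: "(norm (fourier f (fst z) * fourier f (snd z)))\<^sup>2 = (1 / ?w z)\<^sup>2 * exp (- 2 * fst (?T z))"
      by (simp only: power_mult_distrib) (simp add: power2_eq_square exp_add[symmetric])
    have W: "(1 / ?w z)\<^sup>2 * ?w z = 1 / ?w z" using w[of z] by (simp add: power2_eq_square)
    have "(norm (fourier f (fst z) * fourier f (snd z)))\<^sup>2 * ?w z * ((box_symbol s \<beta> (?T z))\<^sup>2 * fibre_mass s (?T z)) =
      ((1 / ?w z)\<^sup>2 * ?w z) * (exp (- 2 * fst (?T z)) * ((box_symbol s \<beta> (?T z))\<^sup>2 * fibre_mass s (?T z)))"
      unfolding N by (simp only: mult_ac)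
    then show ?thesis unfolding W K_def by (simp only: mult.commute)
  qed
  have kJ': "ennreal (kg_const \<beta> CARD('n)) * kg_integral s \<beta> f f = (\<integral>\<^sup>+z. ennreal (K (?T z)) * ennreal (1 / ?w z) \<partial>lborel)"
    unfolding kg_const_mult_kg_integral[OF s \<open>fourier f \<in> borel_measurable borel\<close> \<open>fourier f \<in> borel_measurable borel\<close>] integrand
    by (intro nn_integral_cong ennreal_mult K0) (use w in \<open>simp add: less_imp_le\<close>)
  also have "\<dots> = (\<integral>\<^sup>+q. ennreal (K q) * ennreal (fibre_mass s q) \<partial>lborel)"
    by (rule nn_integral_energy_momentum[OF s d]) measurable
  also have "\<dots> = J"
    unfolding J_def
  proof (rule nn_integral_cong)
    fix q :: "real \<times> (real ^ 'n)"
    have "K q * fibre_mass s q = exp (- 2 * fst q) * (box_symbol s \<beta> q * fibre_mass s q)\<^sup>2"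
      unfolding K_def by (simp add: power2_eq_square)
    then show "ennreal (K q) * ennreal (fibre_mass s q) = ennreal (exp (- 2 * fst q) * (box_symbol s \<beta> q * fibre_mass s q)\<^sup>2)"
      by (simp only: ennreal_mult[OF K0 fibre_mass_nonneg, symmetric])
  qed
  finally have kJ: "ennreal (kg_const \<beta> CARD('n)) * kg_integral s \<beta> f f = J" .
  have kc: "kg_const \<beta> CARD('n) > 0" by (simp add: kg_const_pos)
  have kfin: "kg_integral s \<beta> f f < \<infinity>"
  proof (rule ccontr)
    assume "\<not> kg_integral s \<beta> f f < \<infinity>"
    then have "kg_integral s \<beta> f f = \<infinity>" unfolding infinity_ennreal_def less_top[symmetric] by blast
    then have "J = \<infinity>" unfolding kJ[symmetric] using kc by (simp add: ennreal_mult_eq_top_iff ennreal_eq_0_iff not_le)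
    with Jfin show False by simp
  qed
  have kpos: "kg_integral s \<beta> f f \<noteq> 0"
  proof
    assume "kg_integral s \<beta> f f = 0"
    then have "(\<integral>\<^sup>+z. ennreal (K (?T z)) * ennreal (1 / ?w z) \<partial>lborel) = 0" using kJ' by simp
    then have "AE z in lborel. ennreal (K (?T z)) * ennreal (1 / ?w z) = 0"
      by (subst nn_integral_0_iff_AE[symmetric]) simp_all
    then have "AE z in (lborel :: ((real ^ 'n) \<times> (real ^ 'n)) measure). False"
      using AE_fibre_mass_pos[OF s d]
    proof eventually_elim
      case (elim z)
      have "K (?T z) > 0" unfolding K_def using box_symbol_pos[OF elim(2), of \<beta>] elim(2) by simp
      moreover have "1 / ?w z > 0" using w[of z] by simp
      ultimately show False using elim(1) by (simp add: ennreal_eq_0_iff not_le[symmetric])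
    qed
    then have "ae_filter (lborel :: ((real ^ 'n) \<times> (real ^ 'n)) measure) = bot" by (simp add: trivial_limit_def)
    then show False by (simp add: ae_filter_eq_bot_iff)
  qed
  have nice: "nice_pair s \<beta> f f" unfolding nice_pair_def using f fi kfin by blast
  define \<Phi> where "\<Phi> q = complex_of_real (exp (- fst q) * fibre_mass s q)" for q :: "real \<times> (real ^ 'n)"
  have \<Phi>: "wave_density s (\<lambda>z. fourier f (fst z) * fourier f (snd z)) \<Phi>"
    unfolding ff \<Phi>_def[abs_def] by (rule wave_density_extremal[OF s d])
  have \<Phi>m [measurable]: "\<Phi> \<in> borel_measurable borel" unfolding \<Phi>_def[abs_def] by measurable
  let ?c = "wave_factor CARD('n)"
  define G where "G q = complex_of_real (box_symbol s \<beta> q) * (complex_of_real ?c * \<Phi> q)" for q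
  have "L2_norm_sq G = ennreal (?c\<^sup>2) * J"
    unfolding G_def L2_norm_sq_box_symbol_mult[OF \<Phi>m] J_def
  proof (rule arg_cong[where f="(*) _"], rule nn_integral_cong, rule arg_cong[where f=ennreal])
    fix q :: "real \<times> (real ^ 'n)"
    have "(norm (\<Phi> q))\<^sup>2 = exp (- 2 * fst q) * (fibre_mass s q)\<^sup>2"
      unfolding \<Phi>_def norm_of_real by (simp add: power_mult_distrib) (simp add: power2_eq_square exp_add[symmetric])
    then show "(box_symbol s \<beta> q)\<^sup>2 * (norm (\<Phi> q))\<^sup>2 = exp (- 2 * fst q) * (box_symbol s \<beta> q * fibre_mass s q)\<^sup>2"
      by (simp add: power_mult_distrib)
  qed
  also have "\<dots> = ennreal (?c\<^sup>2 * kg_const \<beta> CARD('n)) * kg_integral s \<beta> f f"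
    unfolding kJ[symmetric] using kc by (subst ennreal_mult') (auto simp: mult.assoc less_imp_le)
  also have "\<dots> = ennreal ((2 * pi) ^ (CARD('n) + 1)) * (ennreal (KG_pp \<beta> CARD('n)) * kg_integral s \<beta> f f)"
    unfolding KG_pp_eq[OF d] using KG_pp_pos[OF d, of \<beta>] by (subst ennreal_mult) (auto simp: mult.assoc)
  finally have L2: "L2_norm_sq G = ennreal ((2 * pi) ^ (CARD('n) + 1)) * (ennreal (KG_pp \<beta> CARD('n)) * kg_integral s \<beta> f f)" .
  then have Gfin: "L2_norm_sq G < \<infinity>" using kfin by (simp add: ennreal_mult_less_top)
  have "L2_norm_sq H = ennreal (KG_pp \<beta> CARD('n)) * kg_integral s \<beta> f f" if H: "kg_box_product s \<beta> f f H" for H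
  proof -
    have "has_fourier_transform H G"
      unfolding G_def by (rule kg_box_product_has_fourier_transform[OF fi fi \<Phi> H])
    from plancherel[OF this Gfin] L2
    have "ennreal ((2 * pi) ^ (CARD('n) + 1)) * L2_norm_sq H = ennreal ((2 * pi) ^ (CARD('n) + 1)) * (ennreal (KG_pp \<beta> CARD('n)) * kg_integral s \<beta> f f)"
      by (simp add: add.commute)
    moreover have "ennreal ((2 * pi) ^ (CARD('n) + 1)) \<noteq> 0" by (simp add: ennreal_eq_0_iff not_le)
    ultimately show ?thesis by (auto simp: ennreal_mult_cancel_left)
  qed
  with nice kpos show ?thesis by blast
qed

theorem theorem5p1:
  fixes s \<beta> :: real
  assumes "CARD('n::finite) \<ge> 2"
    and "s > 0"
    and "\<beta> > (3 - 2 * real CARD('n)) / 4"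
  shows "(\<forall>f g :: real ^ 'n \<Rightarrow> complex. nice_pair s \<beta> f g \<longrightarrow>
           (\<exists>H. kg_box_product s \<beta> f g H) \<and>
           (\<forall>H. kg_box_product s \<beta> f g H \<longrightarrow>
              L2_norm_sq H \<le> ennreal (KG_pp \<beta> CARD('n)) * kg_integral s \<beta> f g)) \<and>
         (\<forall>C < KG_pp \<beta> CARD('n).
           \<not> (\<forall>f g :: real ^ 'n \<Rightarrow> complex. nice_pair s \<beta> f g \<longrightarrow>
             (\<forall>H. kg_box_product s \<beta> f g H \<longrightarrow>
                L2_norm_sq H \<le> ennreal C * kg_integral s \<beta> f g)))"
proof (intro conjI allI impI notI)
  fix f g :: "real ^ 'n \<Rightarrow> complex"
  assume "nice_pair s \<beta> f g"
  note 1 = kg_box_product_exists_and_bound[OF assms(1,2) this]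
  show "\<exists>H. kg_box_product s \<beta> f g H" by (rule 1(1))
  show "L2_norm_sq H \<le> ennreal (KG_pp \<beta> CARD('n)) * kg_integral s \<beta> f g" if "kg_box_product s \<beta> f g H" for H
    using that by (rule 1(2))
next
  fix C assume C: "C < KG_pp \<beta> CARD('n)"
    and bound: "\<forall>f g :: real ^ 'n \<Rightarrow> complex. nice_pair s \<beta> f g \<longrightarrow>
             (\<forall>H. kg_box_product s \<beta> f g H \<longrightarrow> L2_norm_sq H \<le> ennreal C * kg_integral s \<beta> f g)"
  obtain f :: "real ^ 'n \<Rightarrow> complex" where f: "nice_pair s \<beta> f f" "kg_integral s \<beta> f f \<noteq> 0"
    "\<And>H. kg_box_product s \<beta> f f H \<Longrightarrow> L2_norm_sq H = ennreal (KG_pp \<beta> CARD('n)) * kg_integral s \<beta> f f"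
    using sharp_pair[OF assms] by blast
  obtain H where H: "kg_box_product s \<beta> f f H" using kg_box_product_exists_and_bound(1)[OF assms(1,2) f(1)] by blast
  have "ennreal (KG_pp \<beta> CARD('n)) * kg_integral s \<beta> f f \<le> ennreal C * kg_integral s \<beta> f f"
    using bound[rule_format, OF f(1) H] unfolding f(3)[OF H] .
  moreover have "kg_integral s \<beta> f f < \<infinity>" using f(1) by (simp add: nice_pair_def)
  \<comment> \<open>\<open>C\<close> may be negative, in which case \<open>ennreal C\<close> is 0;
    positivity of \<open>KG_pp\<close> keeps the inequality strict.\<close>
  moreover have "ennreal C < ennreal (KG_pp \<beta> CARD('n))"
    using C KG_pp_pos[OF assms(1), of \<beta>] by (intro ennreal_lessI) auto
  ultimately show False
    using f(2) ennreal_mult_strict_right_mono[of "ennreal C" "ennreal (KG_pp \<beta> CARD('n))" "kg_integral s \<beta> f f"]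
    by (simp add: not_le[symmetric] zero_less_iff_neq_zero)
qed

end
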